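(* In the setting of the context, let $n\ge1$ be an integer and $\theta$ real with $\theta+n>0$; if $\theta\ne0$ assume $E[T^{-\theta}|\rho,\eta]<\infty$ and $E[T^{-(\theta+n)}|\rho,\eta]<\infty$. Let $f_1,\dots,f_q$ be real-valued functions on $\mathcal{Y}$, $z_1,\dots,z_q$ non-negative scalars, write $g:=\sum_{l=1}^qz_lf_l$ and $Pf_l=\int_{\mathcal{Y}}f_l(y)P(dy)$. Then: (i) $$\int\Big(1+\sum_{l=1}^qz_lPf_l\Big)^{-(\theta+n)}\tilde{\mathcal{P}}(dP|\rho,\eta,\theta)=\sum_{\mathbf{p}}\int_0^\infty\mathcal{L}_\mu\big(vg|e^{-vh}\rho,\eta,\mathbf{p}\big)\,\pi_{\theta+n,\theta}(dv,\mathbf{p}|\rho,\eta).$$ (ii) The expressions in (i) are equal to $$\sum_{\mathbf{p}}\int_{\mathcal{Y}^{n(\mathbf{p})}}\left[\int_0^\infty\mathcal{L}_\mu\big(vg|e^{-vh}\rho,\eta,\mathbf{p},\mathbf{Y}^*\big)\,\pi_{\theta+n,\theta}(dv|\rho,\eta,\mathbf{p},\mathbf{Y}^* )\right]\pi(d\mathbf{Y}),$$ which indicates that the posterior Cauchy–Stieltjes transform satisfies $$\int\Big(1+\sum_{l=1}^qz_lPf_l\Big)^{-(\theta+n)}\tilde{\mathcal{P}}(dP|\rho,\eta,\theta,\mathbf{Y})=\int_0^\infty\mathcal{L}_\mu\big(vg|e^{-vh}\rho,\eta,\mathbf{p},\mathbf{Y}^*\big)\,\pi_{\theta+n,\theta}(dv|\rho,\eta,\mathbf{p},\mathbf{Y}^*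 ),$$ where $\tilde{\mathcal{P}}(dP|\rho,\eta,\theta,\mathbf{Y})$ is the posterior law of $P$ given $\mathbf{Y}=(Y_1,\dots,Y_n)$ when $P\sim\tilde{\mathcal{P}}(dP|\rho,\eta,\theta)$ and $Y_1,\dots,Y_n$ are i.i.d. $P$ given $P$.
   Context: $\mathcal{S},\mathcal{Y}$ are Polish spaces; $\eta$ is a $\sigma$-finite non-atomic measure on $\mathcal{Y}$; $\rho(ds|y)$ is a Lévy measure on $\mathcal{S}$ depending on $y\in\mathcal{Y}$; $h$ is a strictly positive function on $\mathcal{S}$. $N$ is a Poisson random measure on $\mathcal{S}\times\mathcal{Y}$ with intensity $\rho(ds|y)\eta(dy)$, with law $\mathcal{P}(dN|\rho,\eta)$ and expectation $E[\cdot|\rho,\eta]$; $\mu(dy)=\int_{\mathcal{S}}h(s)N(ds,dy)$; $T=\mu(\mathcal{Y})$ is almost surely finite; $P=\mu/T$. $\tilde{\mathcal{P}}(dP|\rho,\eta,\theta)$ is the law of $P$ when $N$ has law $T^{-\theta}\mathcal{P}(dN|\rho,\eta)/E[T^{-\theta}|\rho,\eta]$ (for $\theta=0$, the law of $P$ under $\mathcal{P}(dN|\rho,\eta)$). $e^{-vh}\rho$ is the kernel $e^{-vh(s)}\rho(ds|y)$; $\mathcal{L}_\mu(g|\rho,\eta)=\exp(-\int\int(1-e^{-g(y)h(s)})\rho(ds|y)\eta(dy))$. $\kappa_m(e^{-vh}\rho|y)=\int h(s)^me^{-vh(s)}\rho(ds|y)$, $\kappa_m(e^{-vh}\Omega)=\int\kappa_m(e^{-vh}\rho|y)\eta(dy)$.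 $\mathbf{Y}$ is encoded as $(\mathbf{Y}^*,\mathbf{p})$: $Y_1^*,\dots,Y^*_{n(\mathbf{p})}$ are the distinct values, $\mathbf{p}=\{C_1,\dots,C_{n(\mathbf{p})}\}$ is the partition of $\{1,\dots,n\}$ with $Y_i=Y_j^*$ iff $i\in C_j$, $e_{j,n}=|C_j|$; sums over $\mathbf{p}$ are over all partitions of $\{1,\dots,n\}$. $\mathcal{L}_\mu(g|e^{-vh}\rho,\eta,\mathbf{p},\mathbf{Y}^* )=\mathcal{L}_\mu(g|e^{-vh}\rho,\eta)\prod_{j=1}^{n(\mathbf{p})}\frac{\int e^{-g(Y_j^* )h(s)}h(s)^{e_{j,n}}e^{-vh(s)}\rho(ds|Y_j^* )}{\kappa_{e_{j,n}}(e^{-vh}\rho|Y_j^* )}$, and $\mathcal{L}_\mu(g|e^{-vh}\rho,\eta,\mathbf{p})=\int_{\mathcal{Y}^{n(\mathbf{p})}}\mathcal{L}_\mu(g|e^{-vh}\rho,\eta,\mathbf{p},\mathbf{Y}^* )\prod_j\frac{\kappa_{e_{j,n}}(e^{-vh}\rho|Y_j^* )\eta(dY_j^* )}{\kappa_{e_{j,n}}(e^{-vh}\Omega)}$. $\pi_{\theta+n,\theta}(dv,\mathbf{p}|\rho,\eta)=\frac{[\prod_j\kappa_{e_{j,n}}(e^{-vh}\Omega)]v^{\theta+n-1}E[e^{-vT}|\rho,\eta]dv}{\Gamma(\theta+n)E[T^{-\theta}|\rho,\eta]}$. $\pi_{\theta+n,\theta}(dv|\rho,\eta,\mathbf{p},\mathbf{Y}^*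 )$ is the probability measure on $(0,\infty)$ proportional to $[\prod_j\kappa_{e_{j,n}}(e^{-vh}\rho|Y_j^* )]v^{\theta+n-1}E[e^{-vT}|\rho,\eta]dv$. $\pi(d\mathbf{Y})$ is the marginal law of $\mathbf{Y}$, $\pi(d\mathbf{Y})=\int_0^\infty\Big[\prod_j\frac{\kappa_{e_{j,n}}(e^{-vh}\rho|Y_j^* )\eta(dY_j^* )}{\kappa_{e_{j,n}}(e^{-vh}\Omega)}\Big]\pi_{\theta+n,\theta}(dv,\mathbf{p}|\rho,\eta)$.
   Formalization: The functions f_l are taken Borel with Pf_l finite a.s., and 1+Σ z_l Pf_l is assumed a.s. positive (automatic for non-negative f_l); without this the real power can be undefined or the identity false, e.g. θ=0, n=1, z_1=1, f_1=-2. *)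

theory Defs
  imports "HOL-Probability.Probability"
begin

definition nonatomic :: "'a measure \<Rightarrow> bool" where
  "nonatomic M \<longleftrightarrow>
     (\<forall>A\<in>sets M. emeasure M A > 0 \<longrightarrow>
        (\<exists>B\<in>sets M. B \<subseteq> A \<and> 0 < emeasure M B \<and> emeasure M B < emeasure M A))"

text \<open>On a general space the only size function available is the jump size \<open>h\<close>, so
  "Levy measure" means that \<open>min 1 h\<close> is integrable; for \<open>h s = s\<close> on the positive half-line
  this is the usual condition on the Levy measure of a subordinator.\<close>

definition levy_kernel ::
    "('s::polish_space \<Rightarrow> real) \<Rightarrow> ('y::polish_space \<Rightarrow> 's measure) \<Rightarrow> bool" where
  "levy_kernel h \<rho> \<longleftrightarrow>
     (\<forall>y. sets (\<rho> y) = sets borel) \<and>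
     (\<forall>A\<in>sets borel. (\<lambda>y. emeasure (\<rho> y) A) \<in> borel_measurable borel) \<and>
     (\<forall>y. (\<integral>\<^sup>+s. min 1 (ennreal (h s)) \<partial>\<rho> y) < \<infinity>)"

definition intensity ::
    "('y::polish_space \<Rightarrow> 's::polish_space measure) \<Rightarrow> 'y measure \<Rightarrow> ('s \<times> 'y) measure" where
  "intensity \<rho> \<eta> = measure_of UNIV (sets (borel \<Otimes>\<^sub>M borel))
     (\<lambda>A. \<integral>\<^sup>+y. emeasure (\<rho> y) {s. (s, y) \<in> A} \<partial>\<eta>)"

definition poisson_random_measure :: "'w measure \<Rightarrow> ('w \<Rightarrow> 'a measure) \<Rightarrow> 'a measure \<Rightarrow> bool" where
  "poisson_random_measure M N \<nu> \<longleftrightarrow>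
     prob_space M \<and>
     (\<forall>\<omega>\<in>space M. sets (N \<omega>) = sets \<nu>) \<and>
     (\<forall>\<omega>\<in>space M. \<forall>A\<in>sets \<nu>. emeasure (N \<omega>) A \<in> insert \<infinity> (range of_nat)) \<and>
     (\<forall>A\<in>sets \<nu>. (\<lambda>\<omega>. emeasure (N \<omega>) A) \<in> borel_measurable M) \<and>
     (\<forall>A\<in>sets \<nu>. emeasure \<nu> A < \<infinity> \<longrightarrow>
        (\<forall>k. measure M {\<omega>\<in>space M. emeasure (N \<omega>) A = of_nat k}
              = exp (- measure \<nu> A) * measure \<nu> A ^ k / fact k)) \<and>
     (\<forall>A\<in>sets \<nu>. emeasure \<nu> A = \<infinity> \<longrightarrow> (AE \<omega> in M. emeasure (N \<omega>) A = \<infinity>)) \<and>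
     (\<forall>(I::nat set) A. finite I \<longrightarrow> (\<forall>i\<in>I. A i \<in> sets \<nu>) \<longrightarrow> disjoint_family_on A I \<longrightarrow>
        prob_space.indep_vars M (\<lambda>_. borel) (\<lambda>i \<omega>. emeasure (N \<omega>) (A i)) I)"

definition crm :: "('s::polish_space \<Rightarrow> real) \<Rightarrow> ('s \<times> 'y::polish_space) measure \<Rightarrow> 'y measure" where
  "crm h N = distr (density N (\<lambda>(s, y). ennreal (h s))) borel snd"

definition total_mass :: "('s::polish_space \<Rightarrow> real) \<Rightarrow> ('s \<times> 'y::polish_space) measure \<Rightarrow> ennreal" where
  "total_mass h N = emeasure (crm h N) UNIV"

text \<open>Off the event \<open>0 < T < \<infinity>\<close> this is the null measure, because \<open>inverse \<infinity> = 0\<close> and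
  \<open>\<infinity> * 0 = 0\<close> in \<^typ>\<open>ennreal\<close>; so it is always a sub-probability measure.\<close>

definition nrm :: "('s::polish_space \<Rightarrow> real) \<Rightarrow> ('s \<times> 'y::polish_space) measure \<Rightarrow> 'y measure" where
  "nrm h N = scale_measure (inverse (total_mass h N)) (crm h N)"

text \<open>\<open>E[T\<^sup>a]\<close> and \<open>E[exp (- v T)]\<close>; \<open>T\<close> is almost surely in \<open>(0,\<infinity>)\<close> wherever these are used.\<close>

definition T_moment ::
    "'w measure \<Rightarrow> ('w \<Rightarrow> ('s::polish_space \<times> 'y::polish_space) measure) \<Rightarrow> ('s \<Rightarrow> real) \<Rightarrow> real \<Rightarrow> ennreal" where
  "T_moment M N h a = (\<integral>\<^sup>+\<omega>. ennreal (enn2real (total_mass h (N \<omega>)) powr a) \<partial>M)"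

definition T_laplace ::
    "'w measure \<Rightarrow> ('w \<Rightarrow> ('s::polish_space \<times> 'y::polish_space) measure) \<Rightarrow> ('s \<Rightarrow> real) \<Rightarrow> real \<Rightarrow> ennreal" where
  "T_laplace M N h v = (\<integral>\<^sup>+\<omega>. ennreal (exp (- v * enn2real (total_mass h (N \<omega>)))) \<partial>M)"

definition P_tilde ::
    "'w measure \<Rightarrow> ('w \<Rightarrow> ('s::polish_space \<times> 'y::polish_space) measure) \<Rightarrow> ('s \<Rightarrow> real) \<Rightarrow> real
      \<Rightarrow> 'y measure measure" where
  "P_tilde M N h \<theta> =
     distr (density M (\<lambda>\<omega>. ennreal (enn2real (total_mass h (N \<omega>)) powr (- \<theta>)) / T_moment M N h (- \<theta>)))
       (subprob_algebra borel) (\<lambda>\<omega>. nrm h (N \<omega>))"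

definition tilt :: "real \<Rightarrow> ('s::polish_space \<Rightarrow> real) \<Rightarrow> ('y \<Rightarrow> 's measure) \<Rightarrow> 'y \<Rightarrow> 's measure" where
  "tilt v h \<rho> y = density (\<rho> y) (\<lambda>s. ennreal (exp (- v * h s)))"

definition kappa :: "('s::polish_space \<Rightarrow> real) \<Rightarrow> nat \<Rightarrow> ('y \<Rightarrow> 's measure) \<Rightarrow> 'y \<Rightarrow> ennreal" where
  "kappa h m \<rho> y = (\<integral>\<^sup>+s. ennreal (h s ^ m) \<partial>\<rho> y)"

definition kappa_total ::
    "('s::polish_space \<Rightarrow> real) \<Rightarrow> nat \<Rightarrow> ('y \<Rightarrow> 's measure) \<Rightarrow> 'y measure \<Rightarrow> ennreal" where
  "kappa_total h m \<rho> \<eta> = (\<integral>\<^sup>+y. kappa h m \<rho> y \<partial>\<eta>)"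

text \<open>The exponent is a Bochner integral because \<open>g\<close> may take both signs; the formula is meant
  for the absolutely convergent case.\<close>

definition laplace ::
    "('s::polish_space \<Rightarrow> real) \<Rightarrow> ('y \<Rightarrow> real) \<Rightarrow> ('y \<Rightarrow> 's measure) \<Rightarrow> 'y measure \<Rightarrow> real" where
  "laplace h g \<rho> \<eta> = exp (- (LINT y|\<eta>. LINT s|\<rho> y. 1 - exp (- g y * h s)))"

text \<open>A partition \<open>p\<close> is a set of blocks (\<^const>\<open>partition_on\<close>). Instead of numbering the blocks,
  the vector of distinct values is indexed by them: \<open>Ys C\<close> is the value shared by the
  observations in the block \<open>C\<close>, and \<open>Y\<^sup>n\<^sup>(\<^sup>p\<^sup>)\<close> is the product over the index set \<open>p\<close>.\<close>

definition laplace_cond ::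
    "('s::polish_space \<Rightarrow> real) \<Rightarrow> ('y \<Rightarrow> real) \<Rightarrow> ('y \<Rightarrow> 's measure) \<Rightarrow> 'y measure
      \<Rightarrow> nat set set \<Rightarrow> (nat set \<Rightarrow> 'y) \<Rightarrow> ennreal" where
  "laplace_cond h g \<rho> \<eta> p Ys = ennreal (laplace h g \<rho> \<eta>) *
     (\<Prod>C\<in>p. (\<integral>\<^sup>+s. ennreal (exp (- g (Ys C) * h s) * h s ^ card C) \<partial>\<rho> (Ys C))
              / kappa h (card C) \<rho> (Ys C))"

definition laplace_part ::
    "('s::polish_space \<Rightarrow> real) \<Rightarrow> ('y \<Rightarrow> real) \<Rightarrow> ('y \<Rightarrow> 's measure) \<Rightarrow> 'y measure
      \<Rightarrow> nat set set \<Rightarrow> ennreal" where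
  "laplace_part h g \<rho> \<eta> p =
     (\<integral>\<^sup>+Ys. laplace_cond h g \<rho> \<eta> p Ys *
         (\<Prod>C\<in>p. kappa h (card C) \<rho> (Ys C) / kappa_total h (card C) \<rho> \<eta>) \<partial>(\<Pi>\<^sub>M C\<in>p. \<eta>))"

definition mixing ::
    "'w measure \<Rightarrow> ('w \<Rightarrow> ('s::polish_space \<times> 'y::polish_space) measure) \<Rightarrow> ('s \<Rightarrow> real)
      \<Rightarrow> ('y \<Rightarrow> 's measure) \<Rightarrow> 'y measure \<Rightarrow> real \<Rightarrow> nat \<Rightarrow> nat set set \<Rightarrow> real measure" where
  "mixing M N h \<rho> \<eta> \<theta> n p = density lborel (\<lambda>v. indicator {0<..} v *
     ((\<Prod>C\<in>p. kappa_total h (card C) (tilt v h \<rho>) \<eta>) * ennreal (v powr (\<theta> + real n - 1))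
        * T_laplace M N h v
      / (ennreal (Gamma (\<theta> + real n)) * T_moment M N h (- \<theta>))))"

definition mixing_weight ::
    "'w measure \<Rightarrow> ('w \<Rightarrow> ('s::polish_space \<times> 'y::polish_space) measure) \<Rightarrow> ('s \<Rightarrow> real)
      \<Rightarrow> ('y \<Rightarrow> 's measure) \<Rightarrow> real \<Rightarrow> nat \<Rightarrow> nat set set \<Rightarrow> (nat set \<Rightarrow> 'y) \<Rightarrow> real \<Rightarrow> ennreal" where
  "mixing_weight M N h \<rho> \<theta> n p Ys v = indicator {0<..} v *
     ((\<Prod>C\<in>p. kappa h (card C) (tilt v h \<rho>) (Ys C)) * ennreal (v powr (\<theta> + real n - 1))
        * T_laplace M N h v)"

definition mixing_cond ::
    "'w measure \<Rightarrow> ('w \<Rightarrow> ('s::polish_space \<times> 'y::polish_space) measure) \<Rightarrow> ('s \<Rightarrow> real)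
      \<Rightarrow> ('y \<Rightarrow> 's measure) \<Rightarrow> real \<Rightarrow> nat \<Rightarrow> nat set set \<Rightarrow> (nat set \<Rightarrow> 'y) \<Rightarrow> real measure" where
  "mixing_cond M N h \<rho> \<theta> n p Ys = density lborel (\<lambda>v.
     mixing_weight M N h \<rho> \<theta> n p Ys v / (\<integral>\<^sup>+u. mixing_weight M N h \<rho> \<theta> n p Ys u \<partial>lborel))"

abbreviation sample_space :: "nat \<Rightarrow> (nat \<Rightarrow> 'y::polish_space) measure" where
  "sample_space n \<equiv> (\<Pi>\<^sub>M i\<in>{1..n}. borel)"

definition joint_law ::
    "nat \<Rightarrow> 'y::polish_space measure measure \<Rightarrow> ('y measure \<times> (nat \<Rightarrow> 'y)) measure" where
  "joint_law n Q = Q \<bind> (\<lambda>p. distr (\<Pi>\<^sub>M i\<in>{1..n}. p) (subprob_algebra borel \<Otimes>\<^sub>M sample_space n) (Pair p))"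

definition marginal_law :: "nat \<Rightarrow> 'y::polish_space measure measure \<Rightarrow> (nat \<Rightarrow> 'y) measure" where
  "marginal_law n Q = distr (joint_law n Q) (sample_space n) snd"

definition posterior_law ::
    "nat \<Rightarrow> 'y::polish_space measure measure \<Rightarrow> ((nat \<Rightarrow> 'y) \<Rightarrow> 'y measure measure) \<Rightarrow> bool" where
  "posterior_law n Q K \<longleftrightarrow>
     K \<in> sample_space n \<rightarrow>\<^sub>M prob_algebra (subprob_algebra borel) \<and>
     (\<forall>A\<in>sets (subprob_algebra borel). \<forall>B\<in>sets (sample_space n).
        emeasure (joint_law n Q) (A \<times> B) = (\<integral>\<^sup>+Y\<in>B. emeasure (K Y) A \<partial>marginal_law n Q))"

text \<open>\<open>(ties n Y, distinct_values n Y)\<close> is the encoding of \<open>Y\<close> as a partition together with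
  its distinct values; \<open>Min C\<close> is just a representative of \<open>C\<close>, on which \<open>Y\<close> is constant.
  \<open>marginal_part\<close> transports the law of \<open>Y\<close>, restricted to the event that the partition is
  \<open>p\<close>, along this encoding.\<close>

definition ties :: "nat \<Rightarrow> (nat \<Rightarrow> 'y) \<Rightarrow> nat set set" where
  "ties n Y = (\<lambda>i. {j\<in>{1..n}. Y j = Y i}) ` {1..n}"

definition distinct_values :: "nat \<Rightarrow> (nat \<Rightarrow> 'y) \<Rightarrow> nat set \<Rightarrow> 'y" where
  "distinct_values n Y = (\<lambda>C\<in>ties n Y. Y (Min C))"

definition marginal_part ::
    "nat \<Rightarrow> 'y::polish_space measure measure \<Rightarrow> nat set set \<Rightarrow> (nat set \<Rightarrow> 'y) measure" where
  "marginal_part n Q p =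
     distr (restrict_space (marginal_law n Q) {Y. ties n Y = p}) (\<Pi>\<^sub>M C\<in>p. borel) (distinct_values n)"

end

theory Submission
  imports Defs
begin

text \<open>
  Write \<open>X = \<integral> (1 + g) d\<mu>\<close>, so that \<open>1 + P g = X / T\<close>. Under the tilted law the transform, restricted to
  an event \<open>B\<close> for the sample, is \<open>E[X powr -(\<theta>+n) \<mu>\<^sup>n(B)] / E[T powr -\<theta>]\<close>. The gamma integral turns
  \<open>X powr -(\<theta>+n)\<close> into a mixture of \<open>e\<^bsup>-vX\<^esup>\<close>, and a multivariate Mecke formula splits
  \<open>E[e\<^bsup>-vX\<^esup> \<mu>\<^sup>n(B)]\<close> into \<open>E[e\<^bsup>-vX\<^esup>]\<close> times a sum over partitions of products of tilted kernels.
  Everything follows by comparing this with the special case \<open>g = 0\<close>, which is the law of the sample.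

  Mecke's formula is derived from the Laplace functional alone: \<open>k (1 - e\<^bsup>-x/k\<^esup>)\<close> increases to \<open>x\<close>, so
  moments are monotone limits of differences of Laplace functionals. Applied to the positive and negative
  parts of \<open>(1 + g) h\<close> it also shows that \<open>X > 0\<close> almost surely forces \<open>1 + g \<ge> 0\<close> wherever there are jumps.
\<close>

section \<open>Exponentials on the extended non-negative reals\<close>

text \<open>The obstacle is that \<open>1 + g\<close> may take both signs while the jump measures
  may be infinite. Identities are therefore stated for non-negative extended functions, with
  \<open>eneg\<close> as an exponential that vanishes at \<open>\<top>\<close>; the signed exponent
  in \<open>laplace\<close> is converted only once, in \<open>laplace_ratio\<close>. Subtractions
  need finiteness of integrals over the jumps. It comes from the random integrals themselves:
  \<open>pint f < \<top>\<close> almost surely forces the integral of \<open>1 - eneg f\<close>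
  against the intensity to be finite. Non-atomicity enters in a single way: under a product of
  copies of \<eta> the values of different blocks differ almost everywhere, so that the partition
  and the distinct values can be recovered from the sample. The conditional formulas divide by
  moments that vanish where \<open>\<rho> y\<close> is null, and by a density of the sample that is
  finite only almost everywhere; for this reason both sides are compared as densities relative to
  products of \<eta>.\<close>

definition eneg :: "ennreal \<Rightarrow> ennreal" where
  "eneg x = (if x = \<top> then 0 else ennreal (exp (- enn2real x)))"

lemma eneg_top [simp]: "eneg \<top> = 0"
  by (simp add: eneg_def)

lemma eneg_ennreal [simp]: "0 \<le> r \<Longrightarrow> eneg (ennreal r) = ennreal (exp (- r))"
  by (simp add: eneg_def)

lemma eneg_0 [simp]: "eneg 0 = 1"
  by (simp add: eneg_def)

lemma eneg_finite: "x < \<top> \<Longrightarrow> eneg x = ennreal (exp (- enn2real x))"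
  by (simp add: eneg_def)

lemma eneg_le_1 [simp]: "eneg x \<le> 1"
  by (cases x) (auto simp: ennreal_le_1)

lemma eneg_less_top [simp]: "eneg x < \<top>"
  by (rule le_less_trans[OF eneg_le_1]) simp

lemma eneg_neq_top [simp]: "eneg x \<noteq> \<top>"
  by (rule less_imp_neq) (rule eneg_less_top)

lemma eneg_eq_0_iff [simp]: "eneg x = 0 \<longleftrightarrow> x = \<top>"
  by (cases x) auto

lemma eneg_add: "eneg (x + y) = eneg x * eneg y"
proof (cases "x = \<top> \<or> y = \<top>")
  case False
  then show ?thesis
    by (cases x; cases y)
       (simp_all add: ennreal_plus[symmetric] ennreal_mult[symmetric] exp_add[symmetric] del: ennreal_plus)
qed auto

lemma eneg_sum: "finite I \<Longrightarrow> eneg (\<Sum>i\<in>I. f i) = (\<Prod>i\<in>I. eneg (f i))"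
  by (induction I rule: finite_induct) (auto simp: eneg_add)

lemma eneg_of_nat_mult: "eneg (of_nat k * x) = eneg x ^ k"
proof (induction k)
  case (Suc k)
  have "of_nat (Suc k) * x = x + of_nat k * x"
    by (simp add: distrib_right)
  then show ?case
    using Suc by (simp add: eneg_add)
qed simp

lemma eneg_antimono: "x \<le> y \<Longrightarrow> eneg y \<le> eneg x"
  by (cases x; cases y) (auto simp: top_unique)

lemma measurable_eneg [measurable]: "eneg \<in> borel_measurable borel"
  unfolding eneg_def[abs_def] by measurable

lemma eneg_plus_complement: "eneg x + (1 - eneg x) = 1"
  by (simp add: add_diff_eq_ennreal)

text \<open>With \<open>p = eneg x\<close> and \<open>q = eneg y\<close> this is
  \<open>1 - p q = (1 - p) + p (1 - q)\<close>; subtraction on \<open>ennreal\<close> is truncated,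
  so it is verified on reals in [0,1]. It splits the Laplace exponent of \<open>\<phi> + f\<close>
  into that of \<open>\<phi>\<close> and the increment caused by \<open>f\<close>.\<close>

lemma one_minus_eneg_mult: "1 - eneg x * eneg y = (1 - eneg x) + eneg x * (1 - eneg y)"
proof -
  have "1 - eneg x * eneg y = (1 - eneg x) + eneg x * (1 - eneg y)"
    if "eneg x = ennreal a" "eneg y = ennreal b" "0 \<le> a" "a \<le> 1" "0 \<le> b" "b \<le> 1" for a b
    using that mult_le_one[of a b] mult_left_le[of b a]
    by (simp add: ennreal_mult[symmetric] ennreal_1[symmetric] ennreal_minus
        ennreal_plus[symmetric] right_diff_distrib del: ennreal_1 ennreal_plus)
  moreover have "\<exists>a. eneg z = ennreal a \<and> 0 \<le> a \<and> a \<le> 1" for z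
    by (cases z) (auto intro: exI[of _ 0])
  ultimately show ?thesis by metis
qed

text \<open>Continuity of a decreasing map along increasing sequences. An infinite supremum needs
  its own argument, since \<open>enn2real \<top> = 0\<close> makes the real exponential useless
  there.\<close>

lemma eneg_SUP:
  fixes f :: "nat \<Rightarrow> ennreal"
  assumes "incseq f"
  shows "eneg (SUP k. f k) = (INF k. eneg (f k))"
proof (cases "(SUP k. f k) = \<top>")
  case True
  have "(INF k. eneg (f k)) \<le> 0"
  proof (rule ennreal_le_epsilon)
    fix e :: real assume e: "0 < e"
    define r where "r = max 0 (- ln e)"
    obtain k where k: "ennreal r < f k"
      using True by (metis SUP_eq_top_iff UNIV_I ennreal_less_top)
    have "(INF k. eneg (f k)) \<le> eneg (f k)"
      by (rule INF_lower) simp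
    also have "\<dots> \<le> eneg (ennreal r)"
      using k by (intro eneg_antimono) simp
    also have "\<dots> \<le> ennreal e"
    proof -
      have "exp (- r) \<le> exp (ln e)" by (simp add: r_def)
      then show ?thesis using e by (subst eneg_ennreal) (simp_all add: r_def ennreal_leI)
    qed
    finally show "(INF k. eneg (f k)) \<le> 0 + ennreal e" by simp
  qed
  then show ?thesis using True by simp
next
  case False
  define s where "s = (SUP k. f k)"
  have s: "s < \<top>" using False unfolding s_def by (metis less_top)
  have fs: "f k \<le> s" for k unfolding s_def by (rule SUP_upper) simp
  then have fin: "f k < \<top>" for k using s by (meson le_less_trans)
  have "f \<longlonglongrightarrow> s"
    unfolding s_def using assms by (rule LIMSEQ_SUP)
  then have "(\<lambda>k. enn2real (f k)) \<longlonglongrightarrow> enn2real s"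
    using s by (intro tendsto_enn2real) auto
  then have "(\<lambda>k. ennreal (exp (- enn2real (f k)))) \<longlonglongrightarrow> ennreal (exp (- enn2real s))"
    by (intro tendsto_ennrealI tendsto_exp tendsto_minus)
  then have "(\<lambda>k. eneg (f k)) \<longlonglongrightarrow> eneg s"
    using s fin by (simp add: eneg_finite)
  moreover have "decseq (\<lambda>k. eneg (f k))"
    using assms by (auto simp: decseq_def incseq_def intro: eneg_antimono)
  then have "(\<lambda>k. eneg (f k)) \<longlonglongrightarrow> (INF k. eneg (f k))"
    by (rule LIMSEQ_INF)
  ultimately show ?thesis
    unfolding s_def by (rule LIMSEQ_unique)
qed

text \<open>The difference quotient \<open>(1 - exp (- t x)) / t\<close> at
  \<open>t = 1 / (k + 1)\<close>; \<open>Suc k\<close> avoids a division by 0. It is bounded by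
  \<open>k + 1\<close>, also at \<open>x = \<top>\<close>, and it involves only exponentials, so its
  expectation can be read off from Laplace functionals.\<close>

definition dquot :: "nat \<Rightarrow> ennreal \<Rightarrow> ennreal" where
  "dquot k x = of_nat (Suc k) * (1 - eneg (x / of_nat (Suc k)))"

lemma measurable_dquot [measurable]: "dquot k \<in> borel_measurable borel"
  unfolding dquot_def[abs_def] by measurable

lemma dquot_ennreal:
  assumes "0 \<le> r"
  shows "dquot k (ennreal r) = ennreal (real (Suc k) * (1 - exp (- r / real (Suc k))))"
proof -
  have "ennreal r / of_nat (Suc k) = ennreal (r / real (Suc k))"
    using assms by (subst ennreal_of_nat_eq_real_of_nat) (rule divide_ennreal, auto)
  then have "dquot k (ennreal r) = ennreal (real (Suc k)) * (1 - ennreal (exp (- (r / real (Suc k)))))"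
    unfolding dquot_def using assms
    by (simp add: ennreal_of_nat_eq_real_of_nat del: of_nat_Suc)
  also have "\<dots> = ennreal (real (Suc k) * (1 - exp (- r / real (Suc k))))"
    using assms
    by (simp add: ennreal_mult[symmetric] ennreal_1[symmetric] ennreal_minus del: ennreal_1 of_nat_Suc)
  finally show ?thesis .
qed

lemma dquot_top [simp]: "dquot k \<top> = of_nat (Suc k)"
  unfolding dquot_def by (simp add: ennreal_top_divide del: of_nat_Suc)

lemma dquot_mono: "x \<le> y \<Longrightarrow> dquot k x \<le> dquot k y"
  unfolding dquot_def by (intro mult_left_mono ennreal_minus_mono eneg_antimono divide_right_mono_ennreal) auto

text \<open>Convexity of \<open>exp\<close>: the point \<open>- r / b\<close> is the convex
  combination of \<open>0\<close> and \<open>- r / a\<close> with weight \<open>a / b\<close> on the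
  latter, and the chord lies above the graph.\<close>

lemma real_dquot_mono:
  fixes r :: real
  assumes "0 \<le> r" "0 < a" "a \<le> b"
  shows "a * (1 - exp (- r / a)) \<le> b * (1 - exp (- r / b))"
proof -
  have "exp ((1 - a / b) *\<^sub>R 0 + (a / b) *\<^sub>R (- r / a)) \<le> (1 - a / b) * exp 0 + (a / b) * exp (- r / a)"
    using assms by (intro convex_onD[OF exp_convex]) auto
  then have "exp (- r / b) \<le> 1 - a / b + (a / b) * exp (- r / a)"
    using assms by (simp add: field_simps)
  then have "b * exp (- r / b) \<le> b * (1 - a / b + (a / b) * exp (- r / a))"
    using assms by (intro mult_left_mono) auto
  also have "\<dots> = b - a + a * exp (- r / a)"
    using assms by (simp add: field_simps)
  finally show ?thesis by (simp add: algebra_simps)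
qed

lemma incseq_dquot: "incseq (\<lambda>k. dquot k x)"
proof (cases x)
  case (real r)
  then show ?thesis
    unfolding incseq_def
    by (auto simp: dquot_ennreal simp del: of_nat_Suc minus_divide_left[symmetric]
        intro!: ennreal_leI real_dquot_mono[simplified])
next
  case top
  then show ?thesis
    by (auto simp: incseq_def simp del: of_nat_Suc)
qed

text \<open>For finite \<open>x = r\<close> the quotient with \<open>a = k + 1\<close> is squeezed
  between \<open>r / (1 + r / a)\<close> and \<open>r\<close>; both bounds are the inequality
  \<open>1 + t \<le> exp t\<close>, used at \<open>r / a\<close> and at
  \<open>- r / a\<close>.\<close>

lemma SUP_dquot: "(SUP k. dquot k x) = x"
proof (cases x)
  case (real r)
  have "(\<lambda>k. real (Suc k) * (1 - exp (- r / real (Suc k)))) \<longlonglongrightarrow> r"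
  proof (rule tendsto_sandwich)
    have "(\<lambda>k. r / (1 + r * inverse (real (Suc k)))) \<longlonglongrightarrow> r / (1 + r * 0)"
      by (intro tendsto_intros LIMSEQ_inverse_real_of_nat) auto
    then show "(\<lambda>k. r / (1 + r * inverse (real (Suc k)))) \<longlonglongrightarrow> r" by simp
    show "\<forall>\<^sub>F k in sequentially. r / (1 + r * inverse (real (Suc k)))
        \<le> real (Suc k) * (1 - exp (- r / real (Suc k)))"
    proof (intro always_eventually allI)
      fix k
      define a where "a = real (Suc k)"
      have a: "a > 0" by (simp add: a_def)
      have "1 + r / a \<le> exp (r / a)" by (rule exp_ge_add_one_self)
      then have "exp (- (r / a)) \<le> inverse (1 + r / a)"
        using a real by (subst exp_minus) (intro le_imp_inverse_le, auto simp: add_pos_nonneg)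
      then have "a * (1 - inverse (1 + r / a)) \<le> a * (1 - exp (- r / a))"
        using a by simp
      moreover have "a * (1 - inverse (1 + r / a)) = r / (1 + r * inverse a)"
        using a real by (simp add: field_simps)
      ultimately show "r / (1 + r * inverse a) \<le> a * (1 - exp (- r / a))" by simp
    qed
    show "\<forall>\<^sub>F k in sequentially. real (Suc k) * (1 - exp (- r / real (Suc k))) \<le> r"
    proof (intro always_eventually allI)
      fix k
      have "1 - exp (- r / real (Suc k)) \<le> r / real (Suc k)"
        using exp_ge_add_one_self[of "- r / real (Suc k)"] by simp
      then have "real (Suc k) * (1 - exp (- r / real (Suc k))) \<le> real (Suc k) * (r / real (Suc k))"
        by (intro mult_left_mono) auto
      then show "real (Suc k) * (1 - exp (- r / real (Suc k))) \<le> r" by simp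
    qed
  qed simp
  then have "(\<lambda>k. dquot k x) \<longlonglongrightarrow> x"
    using real by (simp add: dquot_ennreal tendsto_ennrealI del: of_nat_Suc)
  then show ?thesis
    using LIMSEQ_SUP[OF incseq_dquot, of x] by (intro LIMSEQ_unique)
next
  case top
  have "(SUP k. of_nat (Suc k) :: ennreal) = \<top>"
  proof -
    have "(SUP k. of_nat k :: ennreal) \<le> (SUP k. of_nat (Suc k))"
      by (intro SUP_mono) (metis UNIV_I le_SucI of_nat_mono order_refl)
    then show ?thesis by (simp add: ennreal_SUP_of_nat_eq_top top_unique del: of_nat_Suc)
  qed
  then show ?thesis using top by (simp del: of_nat_Suc)
qed

lemma dquot_le: "dquot k x \<le> x"
  using SUP_upper[of k UNIV "\<lambda>k. dquot k x"] by (simp add: SUP_dquot)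

text \<open>Any product \<open>f i * g j\<close> is dominated by the diagonal term at
  \<open>max i j\<close>. The argument uses only the order, so products of \<open>0\<close> and
  \<open>\<top>\<close> are covered.\<close>

lemma SUP_mult_incseq:
  fixes f g :: "nat \<Rightarrow> ennreal"
  assumes "incseq f" "incseq g"
  shows "(SUP k. f k * g k) = (SUP k. f k) * (SUP k. g k)"
proof (rule antisym)
  show "(SUP k. f k * g k) \<le> (SUP k. f k) * (SUP k. g k)"
    by (intro SUP_least mult_mono SUP_upper) auto
  have "f i * g j \<le> (SUP k. f k * g k)" for i j
  proof -
    have "f i * g j \<le> f (max i j) * g (max i j)"
      using assms by (intro mult_mono) (auto simp: incseq_def)
    also have "\<dots> \<le> (SUP k. f k * g k)"
      by (rule SUP_upper) simp
    finally show ?thesis .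
  qed
  then show "(SUP k. f k) * (SUP k. g k) \<le> (SUP k. f k * g k)"
    by (auto simp: SUP_mult_right_ennreal SUP_mult_left_ennreal intro!: SUP_least)
qed

lemma incseq_mult_ennreal:
  fixes f g :: "nat \<Rightarrow> ennreal"
  shows "incseq f \<Longrightarrow> incseq g \<Longrightarrow> incseq (\<lambda>k. f k * g k)"
  by (auto simp: incseq_def intro!: mult_mono)

lemma incseq_prod_ennreal:
  fixes f :: "'i \<Rightarrow> nat \<Rightarrow> ennreal"
  assumes "\<And>i. i \<in> I \<Longrightarrow> incseq (f i)"
  shows "incseq (\<lambda>k. \<Prod>i\<in>I. f i k)"
  using assms unfolding incseq_def by (intro allI impI prod_mono_ennreal) auto

lemma SUP_prod_incseq:
  fixes f :: "'i \<Rightarrow> nat \<Rightarrow> ennreal"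
  assumes "finite I" "\<And>i. i \<in> I \<Longrightarrow> incseq (f i)"
  shows "(SUP k. \<Prod>i\<in>I. f i k) = (\<Prod>i\<in>I. SUP k. f i k)"
  using assms
  by (induction I rule: finite_induct) (auto simp: SUP_mult_incseq incseq_prod_ennreal)

text \<open>The measures \<open>\<kappa> \<omega>\<close> may be infinite. Because the integrand
  does not depend on \<open>\<omega>\<close>, induction over the construction of \<open>f\<close>
  from indicators gets by with the measurability of \<open>emeasure (\<kappa> \<omega>) A\<close> in
  \<open>\<omega>\<close>.\<close>

lemma borel_measurable_nn_integral_family:
  assumes f: "f \<in> borel_measurable X"
    and \<kappa>: "\<And>\<omega>. \<omega> \<in> space M \<Longrightarrow> sets (\<kappa> \<omega>) = sets X"
      "\<And>A. A \<in> sets X \<Longrightarrow> (\<lambda>\<omega>. emeasure (\<kappa> \<omega>) A) \<in> borel_measurable M"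
  shows "(\<lambda>\<omega>. \<integral>\<^sup>+x. f x \<partial>\<kappa> \<omega>) \<in> borel_measurable M"
proof -
  note [measurable_cong] = \<kappa>(1)
  have m: "u \<in> borel_measurable (\<kappa> \<omega>)" if "u \<in> borel_measurable X" "\<omega> \<in> space M" for u :: "_ \<Rightarrow> ennreal" and \<omega>
    using that \<kappa>(1) measurable_cong_sets by blast
  have sp: "space (\<kappa> \<omega>) = space X" if "\<omega> \<in> space M" for \<omega>
    using that by (intro sets_eq_imp_space_eq \<kappa>)
  show ?thesis
    using f
  proof induct
    case (cong u v)
    have "(\<lambda>\<omega>. \<integral>\<^sup>+x. u x \<partial>\<kappa> \<omega>) \<in> borel_measurable M \<longleftrightarrow> (\<lambda>\<omega>. \<integral>\<^sup>+x. v x \<partial>\<kappa> \<omega>) \<in> borel_measurable M"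
      by (intro measurable_cong nn_integral_cong) (auto simp: sp cong)
    with cong show ?case by simp
  next
    case (set A)
    have "(\<lambda>\<omega>. \<integral>\<^sup>+x. indicator A x \<partial>\<kappa> \<omega>) \<in> borel_measurable M
        \<longleftrightarrow> (\<lambda>\<omega>. emeasure (\<kappa> \<omega>) A) \<in> borel_measurable M"
      using set \<kappa>(1) by (intro measurable_cong nn_integral_indicator) auto
    with set \<kappa>(2) show ?case by simp
  next
    case (mult u c)
    have "(\<lambda>\<omega>. \<integral>\<^sup>+x. c * u x \<partial>\<kappa> \<omega>) \<in> borel_measurable M
        \<longleftrightarrow> (\<lambda>\<omega>. c * \<integral>\<^sup>+x. u x \<partial>\<kappa> \<omega>) \<in> borel_measurable M"
      by (intro measurable_cong nn_integral_cmult m mult)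
    with mult show ?case by simp
  next
    case (add u v)
    have "(\<lambda>\<omega>. \<integral>\<^sup>+x. v x + u x \<partial>\<kappa> \<omega>) \<in> borel_measurable M
        \<longleftrightarrow> (\<lambda>\<omega>. (\<integral>\<^sup>+x. v x \<partial>\<kappa> \<omega>) + (\<integral>\<^sup>+x. u x \<partial>\<kappa> \<omega>)) \<in> borel_measurable M"
      by (intro measurable_cong nn_integral_add m add)
    with add show ?case by simp
  next
    case (seq U)
    have SUP_U: "(SUP i. U i) = (\<lambda>x. SUP i. U i x)"
      by (rule ext) (rule SUP_apply)
    have "(\<lambda>\<omega>. \<integral>\<^sup>+x. (SUP i. U i) x \<partial>\<kappa> \<omega>) \<in> borel_measurable M
        \<longleftrightarrow> (\<lambda>\<omega>. (SUP i. \<integral>\<^sup>+x. U i x \<partial>\<kappa> \<omega>)) \<in> borel_measurable M"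
    proof (intro measurable_cong)
      fix \<omega> assume "\<omega> \<in> space M"
      then show "(\<integral>\<^sup>+x. (SUP i. U i) x \<partial>\<kappa> \<omega>) = (SUP i. \<integral>\<^sup>+x. U i x \<partial>\<kappa> \<omega>)"
        unfolding SUP_U by (intro nn_integral_monotone_convergence_SUP seq m)
    qed
    with seq show ?case by simp
  qed
qed

text \<open>Used to integrate against the law of the sample, which is known on sets as a sum of
  image measures, one for each partition.\<close>

lemma nn_integral_eq_sum_of_measures:
  assumes J: "finite J"
    and R: "\<And>A. A \<in> sets R \<Longrightarrow> emeasure R A = (\<Sum>j\<in>J. emeasure (Q j) A)"
    and Q: "\<And>j. j \<in> J \<Longrightarrow> sets (Q j) = sets R"
    and f: "f \<in> borel_measurable R"
  shows "(\<integral>\<^sup>+x. f x \<partial>R) = (\<Sum>j\<in>J. \<integral>\<^sup>+x. f x \<partial>Q j)"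
proof -
  have m: "u \<in> borel_measurable (Q j)" if "u \<in> borel_measurable R" "j \<in> J" for u :: "_ \<Rightarrow> ennreal" and j
    using that Q measurable_cong_sets by blast
  have sp: "space (Q j) = space R" if "j \<in> J" for j
    using that by (intro sets_eq_imp_space_eq Q)
  show ?thesis
    using f
  proof induct
    case (cong u v)
    have "(\<Sum>j\<in>J. \<integral>\<^sup>+x. u x \<partial>Q j) = (\<Sum>j\<in>J. \<integral>\<^sup>+x. v x \<partial>Q j)"
      by (intro sum.cong nn_integral_cong) (auto simp: sp cong)
    moreover have "(\<integral>\<^sup>+x. u x \<partial>R) = (\<integral>\<^sup>+x. v x \<partial>R)"
      by (intro nn_integral_cong cong)
    ultimately show ?case using cong by simp
  next
    case (set A)
    then show ?case using R Q by (simp cong: sum.cong)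
  next
    case (mult u c)
    have "(\<Sum>j\<in>J. \<integral>\<^sup>+x. c * u x \<partial>Q j) = (\<Sum>j\<in>J. c * (\<integral>\<^sup>+x. u x \<partial>Q j))"
      by (intro sum.cong refl nn_integral_cmult m mult)
    then show ?case
      using mult by (simp add: nn_integral_cmult sum_distrib_left)
  next
    case (add u v)
    have "(\<Sum>j\<in>J. \<integral>\<^sup>+x. v x + u x \<partial>Q j) = (\<Sum>j\<in>J. (\<integral>\<^sup>+x. v x \<partial>Q j) + (\<integral>\<^sup>+x. u x \<partial>Q j))"
      by (intro sum.cong refl nn_integral_add m add)
    then show ?case
      using add by (simp add: nn_integral_add sum.distrib)
  next
    case (seq U)
    have SUP_U: "(SUP i. U i) = (\<lambda>x. SUP i. U i x)"
      by (rule ext) (rule SUP_apply)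
    have "(\<integral>\<^sup>+x. (SUP i. U i) x \<partial>R) = (SUP i. \<integral>\<^sup>+x. U i x \<partial>R)"
      unfolding SUP_U by (intro nn_integral_monotone_convergence_SUP seq)
    also have "\<dots> = (SUP i. \<Sum>j\<in>J. \<integral>\<^sup>+x. U i x \<partial>Q j)"
      using seq by simp
    also have "\<dots> = (\<Sum>j\<in>J. SUP i. \<integral>\<^sup>+x. U i x \<partial>Q j)"
      using seq by (intro ennreal_SUP_sum) (auto simp: incseq_def le_fun_def intro!: nn_integral_mono)
    also have "\<dots> = (\<Sum>j\<in>J. \<integral>\<^sup>+x. (SUP i. U i) x \<partial>Q j)"
    proof (intro sum.cong refl)
      fix j assume "j \<in> J"
      then show "(SUP i. \<integral>\<^sup>+x. U i x \<partial>Q j) = (\<integral>\<^sup>+x. (SUP i. U i) x \<partial>Q j)"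
        unfolding SUP_U by (intro nn_integral_monotone_convergence_SUP[symmetric] seq m)
    qed
    finally show ?case .
  qed
qed

text \<open>Makes one measure out of a sum over partitions, so that uniqueness of measures applies
  to the right side of the multivariate Mecke formula.\<close>

lemma ex_sum_of_measures:
  assumes J: "finite J" and Q: "\<And>j. j \<in> J \<Longrightarrow> sets (Q j) = sets X"
  obtains R where "sets R = sets X" "\<And>A. A \<in> sets X \<Longrightarrow> emeasure R A = (\<Sum>j\<in>J. emeasure (Q j) A)"
proof
  let ?R = "measure_of (space X) (sets X) (\<lambda>A. \<Sum>j\<in>J. emeasure (Q j) A)"
  show "sets ?R = sets X" by simp
  show "emeasure ?R A = (\<Sum>j\<in>J. emeasure (Q j) A)" if "A \<in> sets X" for A
  proof (rule emeasure_measure_of_sigma[OF sets.sigma_algebra_axioms _ _ that])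
    show "positive (sets X) (\<lambda>A. \<Sum>j\<in>J. emeasure (Q j) A)"
      by (simp add: positive_def)
    show "countably_additive (sets X) (\<lambda>A. \<Sum>j\<in>J. emeasure (Q j) A)"
    proof (rule countably_additiveI)
      fix F :: "nat \<Rightarrow> _"
      assume F: "range F \<subseteq> sets X" "disjoint_family F"
      have "(\<Sum>i. \<Sum>j\<in>J. emeasure (Q j) (F i)) = (\<Sum>j\<in>J. \<Sum>i. emeasure (Q j) (F i))"
        by (intro suminf_sum) auto
      also have "\<dots> = (\<Sum>j\<in>J. emeasure (Q j) (\<Union>i. F i))"
        using F Q by (intro sum.cong refl suminf_emeasure) auto
      finally show "(\<Sum>i. \<Sum>j\<in>J. emeasure (Q j) (F i)) = (\<Sum>j\<in>J. emeasure (Q j) (\<Union>i. F i))" .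
    qed
  qed
qed

section \<open>Laplace functional of a Poisson random measure\<close>

text \<open>Stated for an arbitrary \<open>H\<close> because the same level sets serve twice: with
  \<open>H\<close> the identity under \<open>N \<omega>\<close>, and with
  \<open>H c = 1 - eneg c\<close> under \<open>\<nu>\<close>.\<close>

lemma nn_integral_comp_simple:
  assumes "simple_function \<mu> \<phi>"
  shows "(\<integral>\<^sup>+x. H (\<phi> x) \<partial>\<mu>) = (\<Sum>c\<in>\<phi> ` space \<mu>. H c * emeasure \<mu> (\<phi> -` {c} \<inter> space \<mu>))"
proof -
  have fin: "finite (\<phi> ` space \<mu>)" and A: "\<phi> -` {c} \<inter> space \<mu> \<in> sets \<mu>" for c
    using assms by (auto simp: simple_functionD)
  have "(\<integral>\<^sup>+x. H (\<phi> x) \<partial>\<mu>)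
      = (\<integral>\<^sup>+x. (\<Sum>c\<in>\<phi> ` space \<mu>. H c * indicator (\<phi> -` {c} \<inter> space \<mu>) x) \<partial>\<mu>)"
  proof (rule nn_integral_cong)
    fix x assume x: "x \<in> space \<mu>"
    have "(\<Sum>c\<in>\<phi> ` space \<mu>. H c * indicator (\<phi> -` {c} \<inter> space \<mu>) x)
        = (\<Sum>c\<in>{\<phi> x}. H c * indicator (\<phi> -` {c} \<inter> space \<mu>) x)"
      using x fin by (intro sum.mono_neutral_right) (auto simp: indicator_def)
    then show "H (\<phi> x) = (\<Sum>c\<in>\<phi> ` space \<mu>. H c * indicator (\<phi> -` {c} \<inter> space \<mu>) x)"
      using x by (simp add: indicator_def)
  qed
  also have "\<dots> = (\<Sum>c\<in>\<phi> ` space \<mu>. H c * emeasure \<mu> (\<phi> -` {c} \<inter> space \<mu>))"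
    using A by (subst nn_integral_sum) (auto simp: nn_integral_cmult_indicator)
  finally show ?thesis .
qed

text \<open>The probability generating function of the Poisson law at \<open>r = eneg c\<close>,
  summed by the exponential series. The case \<open>c = \<top>\<close> is \<open>r = 0\<close>,
  where only the term \<open>k = 0\<close> survives since \<open>0 ^ 0 = 1\<close>.\<close>

lemma poisson_generating_function:
  assumes "0 \<le> lam"
  shows "(\<Sum>k. eneg c ^ k * ennreal (exp (- lam) * lam ^ k / fact k)) = eneg ((1 - eneg c) * ennreal lam)"
proof -
  obtain r where r: "eneg c = ennreal r" "0 \<le> r" "r \<le> 1"
  proof (cases c)
    case (real a)
    then show ?thesis using that[of "exp (- a)"] by simp
  next
    case top
    then show ?thesis using that[of 0] by simp
  qed
  have "(\<lambda>k. (r * lam) ^ k /\<^sub>R fact k) sums exp (r * lam)"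
    by (rule exp_converges)
  then have "(\<lambda>k. exp (- lam) * ((r * lam) ^ k /\<^sub>R fact k)) sums (exp (- lam) * exp (r * lam))"
    by (rule sums_mult)
  then have s: "(\<lambda>k. r ^ k * (exp (- lam) * lam ^ k / fact k)) sums exp (- ((1 - r) * lam))"
    by (simp add: power_mult_distrib field_simps exp_add[symmetric] exp_diff exp_minus)
  have "(\<Sum>k. eneg c ^ k * ennreal (exp (- lam) * lam ^ k / fact k))
      = (\<Sum>k. ennreal (r ^ k * (exp (- lam) * lam ^ k / fact k)))"
  proof (intro suminf_cong)
    fix k
    have "eneg c ^ k = ennreal (r ^ k)" using r by (simp add: ennreal_power)
    then show "eneg c ^ k * ennreal (exp (- lam) * lam ^ k / fact k)
        = ennreal (r ^ k * (exp (- lam) * lam ^ k / fact k))"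
      using r assms by (subst ennreal_mult) auto
  qed
  also have "\<dots> = ennreal (exp (- ((1 - r) * lam)))"
    using r assms by (intro suminf_ennreal_eq s) auto
  also have "\<dots> = eneg ((1 - eneg c) * ennreal lam)"
    using r assms
    by (simp add: ennreal_1[symmetric] ennreal_minus ennreal_mult[symmetric] del: ennreal_1)
  finally show ?thesis .
qed

locale poisson_measure = prob_space M
  for M :: "'w measure" and N :: "'w \<Rightarrow> 'a measure" and \<nu> :: "'a measure" +
  assumes prm: "poisson_random_measure M N \<nu>"
begin

lemma sets_N: "\<omega> \<in> space M \<Longrightarrow> sets (N \<omega>) = sets \<nu>"
  using prm by (simp add: poisson_random_measure_def)

lemma space_N: "\<omega> \<in> space M \<Longrightarrow> space (N \<omega>) = space \<nu>"
  by (intro sets_eq_imp_space_eq sets_N)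

lemma measurable_N: "\<omega> \<in> space M \<Longrightarrow> measurable (N \<omega>) X = measurable \<nu> X"
  by (intro measurable_cong_sets sets_N refl)

lemma measurable_emeasure_N [measurable]:
  "A \<in> sets \<nu> \<Longrightarrow> (\<lambda>\<omega>. emeasure (N \<omega>) A) \<in> borel_measurable M"
  using prm by (simp add: poisson_random_measure_def)

definition pint :: "('a \<Rightarrow> ennreal) \<Rightarrow> 'w \<Rightarrow> ennreal" where
  "pint f \<omega> = (\<integral>\<^sup>+x. f x \<partial>N \<omega>)"

lemma measurable_pint [measurable]: "f \<in> borel_measurable \<nu> \<Longrightarrow> pint f \<in> borel_measurable M"
  unfolding pint_def[abs_def]
  by (rule borel_measurable_nn_integral_family) (auto simp: sets_N)

lemma pint_add:
  "f \<in> borel_measurable \<nu> \<Longrightarrow> g \<in> borel_measurable \<nu> \<Longrightarrow> \<omega> \<in> space M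
    \<Longrightarrow> pint (\<lambda>x. f x + g x) \<omega> = pint f \<omega> + pint g \<omega>"
  unfolding pint_def by (intro nn_integral_add) (auto simp: measurable_N)

lemma pint_cmult:
  "f \<in> borel_measurable \<nu> \<Longrightarrow> \<omega> \<in> space M \<Longrightarrow> pint (\<lambda>x. c * f x) \<omega> = c * pint f \<omega>"
  unfolding pint_def by (intro nn_integral_cmult) (auto simp: measurable_N)

lemma pint_mono: "(\<And>x. f x \<le> g x) \<Longrightarrow> pint f \<omega> \<le> pint g \<omega>"
  unfolding pint_def by (intro nn_integral_mono)

lemma pint_SUP:
  assumes "\<And>i. f i \<in> borel_measurable \<nu>" "\<And>x. incseq (\<lambda>i. f i x)" "\<omega> \<in> space M"
  shows "pint (\<lambda>x. SUP i. f i x) \<omega> = (SUP i. pint (f i) \<omega>)"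
  unfolding pint_def using assms
  by (intro nn_integral_monotone_convergence_SUP) (auto simp: measurable_N incseq_def le_fun_def)

lemma incseq_pint: "(\<And>x. incseq (\<lambda>i. f i x)) \<Longrightarrow> incseq (\<lambda>i. pint (f i) \<omega>)"
  by (auto simp: incseq_def intro!: pint_mono)

text \<open>For infinite intensity the count is almost surely infinite, so both sides are 0, or 1 if
  \<open>c = 0\<close>. For finite intensity the expectation is the Poisson generating function at
  \<open>eneg c\<close>.\<close>

lemma laplace_indicator:
  assumes A: "A \<in> sets \<nu>"
  shows "(\<integral>\<^sup>+\<omega>. eneg (c * emeasure (N \<omega>) A) \<partial>M) = eneg ((1 - eneg c) * emeasure \<nu> A)"
proof (cases "emeasure \<nu> A = \<infinity>")
  case True
  then have AE: "AE \<omega> in M. emeasure (N \<omega>) A = \<infinity>"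
    using A prm by (auto simp: poisson_random_measure_def)
  show ?thesis
  proof (cases "c = 0")
    case True
    then show ?thesis by (simp add: emeasure_space_1)
  next
    case False
    have "1 - eneg c \<noteq> 0"
    proof
      assume "1 - eneg c = 0"
      then have "eneg c = 1"
        using eneg_plus_complement[of c] by simp
      then show False using False by (cases c) (auto simp: ennreal_eq_1)
    qed
    moreover have "(\<integral>\<^sup>+\<omega>. eneg (c * emeasure (N \<omega>) A) \<partial>M) = (\<integral>\<^sup>+\<omega>. 0 \<partial>M)"
      using AE False by (intro nn_integral_cong_AE) (auto simp: ennreal_mult_top)
    ultimately show ?thesis using True by (simp add: ennreal_mult_top)
  qed
next
  case False
  then have fin: "emeasure \<nu> A < \<infinity>" by (simp add: less_top)
  define lam where "lam = measure \<nu> A"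
  define E where "E k = {\<omega>\<in>space M. emeasure (N \<omega>) A = of_nat k}" for k :: nat
  define p where "p k = exp (- lam) * lam ^ k / fact k" for k :: nat
  have lam: "0 \<le> lam" by (simp add: lam_def)
  have nuA: "emeasure \<nu> A = ennreal lam"
    using fin by (simp add: lam_def emeasure_eq_ennreal_measure less_top)
  have [measurable]: "E k \<in> sets M" for k
    using A unfolding E_def by measurable
  have pE: "emeasure M (E k) = ennreal (p k)" for k
    using prm A fin by (simp add: emeasure_eq_measure poisson_random_measure_def E_def p_def lam_def)
  have disj: "disjoint_family E"
    by (auto simp: disjoint_family_on_def E_def)
  \<comment> \<open>The definition prescribes the probabilities of finite counts only; that they add
    up to 1, which is the generating function at \<open>c = 0\<close>, excludes an infinite count
    almost surely.\<close>
  have "emeasure M (\<Union>k. E k) = (\<Sum>k. emeasure M (E k))"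
    using disj by (intro suminf_emeasure[symmetric]) auto
  also have "\<dots> = (\<Sum>k. eneg 0 ^ k * ennreal (exp (- lam) * lam ^ k / fact k))"
    by (simp add: pE p_def)
  also have "\<dots> = 1"
    by (subst poisson_generating_function[OF lam]) simp
  finally have AE: "AE \<omega> in M. \<omega> \<in> (\<Union>k. E k)"
    by (intro AE_prob_1) (simp add: measure_def)
  have "(\<integral>\<^sup>+\<omega>. eneg (c * emeasure (N \<omega>) A) \<partial>M) = (\<integral>\<^sup>+\<omega>. (\<Sum>k. eneg c ^ k * indicator (E k) \<omega>) \<partial>M)"
  proof (rule nn_integral_cong_AE, rule AE_mp[OF AE], rule AE_I2, rule impI)
    fix \<omega> assume "\<omega> \<in> space M" "\<omega> \<in> (\<Union>k. E k)"
    then obtain k where k: "\<omega> \<in> E k" by auto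
    have "(\<Sum>j. eneg c ^ j * indicator (E j) \<omega>) = (\<Sum>j\<in>{k}. eneg c ^ j * indicator (E j) \<omega> :: ennreal)"
      using k disj by (intro suminf_finite) (auto simp: disjoint_family_on_def indicator_def)
    also have "\<dots> = eneg (c * emeasure (N \<omega>) A)"
      using k by (simp add: E_def eneg_of_nat_mult[symmetric] mult.commute)
    finally show "eneg (c * emeasure (N \<omega>) A) = (\<Sum>k. eneg c ^ k * indicator (E k) \<omega>)" ..
  qed
  also have "\<dots> = (\<Sum>k. eneg c ^ k * ennreal (p k))"
    by (subst nn_integral_suminf) (auto simp: nn_integral_cmult_indicator pE)
  also have "\<dots> = eneg ((1 - eneg c) * emeasure \<nu> A)"
    unfolding p_def nuA by (rule poisson_generating_function[OF lam])
  finally show ?thesis .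
qed

text \<open>The integral is a linear combination of the counts of the level sets of
  \<open>\<phi>\<close>, which are disjoint; independence makes the Laplace transform
  factorise.\<close>

lemma laplace_simple:
  assumes \<phi>: "simple_function \<nu> \<phi>"
  shows "(\<integral>\<^sup>+\<omega>. eneg (pint \<phi> \<omega>) \<partial>M) = eneg (\<integral>\<^sup>+x. 1 - eneg (\<phi> x) \<partial>\<nu>)"
proof -
  define F where "F = \<phi> ` space \<nu>"
  have "finite F" using \<phi> by (simp add: F_def simple_functionD)
  \<comment> \<open>Independence is part of the definition for families indexed by
    \<open>nat\<close>, so the finitely many values of \<open>\<phi>\<close> are numbered by
    \<open>b\<close>.\<close>
  then obtain b where b: "bij_betw b {0..<card F} F"
    using ex_bij_betw_nat_finite by blast
  define A where "A i = \<phi> -` {b i} \<inter> space \<nu>" for i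
  define J where "J = {0..<card F}"
  have A[measurable]: "A i \<in> sets \<nu>" for i
    using \<phi> by (simp add: A_def simple_functionD)
  have disj: "disjoint_family_on A J"
    using inj_on_eq_iff[OF bij_betw_imp_inj_on[OF b]]
    by (fastforce simp: disjoint_family_on_def A_def J_def)
  have indep: "indep_vars (\<lambda>_. borel) (\<lambda>i \<omega>. emeasure (N \<omega>) (A i)) J"
    using prm A disj by (auto simp: poisson_random_measure_def J_def)
  have sum: "(\<Sum>c\<in>F. H c * emeasure \<mu> (\<phi> -` {c} \<inter> space \<nu>)) = (\<Sum>i\<in>J. H (b i) * emeasure \<mu> (A i))"
    for \<mu> :: "'a measure" and H :: "ennreal \<Rightarrow> ennreal"
    unfolding A_def J_def by (rule sum.reindex_bij_betw[OF b, symmetric])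
  have "pint \<phi> \<omega> = (\<Sum>i\<in>J. b i * emeasure (N \<omega>) (A i))" if \<omega>: "\<omega> \<in> space M" for \<omega>
  proof -
    have "simple_function (N \<omega>) \<phi>"
      using \<phi> \<omega> by (simp add: simple_function_def space_N sets_N)
    then show ?thesis
      using nn_integral_comp_simple[of "N \<omega>" \<phi> "\<lambda>x. x"] sum[of "\<lambda>x. x" "N \<omega>"] \<omega>
      by (simp add: pint_def space_N F_def)
  qed
  then have "(\<integral>\<^sup>+\<omega>. eneg (pint \<phi> \<omega>) \<partial>M) = (\<integral>\<^sup>+\<omega>. (\<Prod>i\<in>J. eneg (b i * emeasure (N \<omega>) (A i))) \<partial>M)"
    by (intro nn_integral_cong) (simp add: eneg_sum J_def)
  also have "\<dots> = (\<Prod>i\<in>J. \<integral>\<^sup>+\<omega>. eneg (b i * emeasure (N \<omega>) (A i)) \<partial>M)"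
    by (intro indep_vars_nn_integral indep_vars_compose2[OF indep]) (auto simp: J_def)
  also have "\<dots> = eneg (\<Sum>i\<in>J. (1 - eneg (b i)) * emeasure \<nu> (A i))"
    by (simp add: laplace_indicator eneg_sum J_def)
  also have "(\<Sum>i\<in>J. (1 - eneg (b i)) * emeasure \<nu> (A i)) = (\<integral>\<^sup>+x. 1 - eneg (\<phi> x) \<partial>\<nu>)"
    using nn_integral_comp_simple[OF \<phi>, of "\<lambda>c. 1 - eneg c"] sum[of "\<lambda>c. 1 - eneg c" \<nu>]
    by (simp add: F_def)
  finally show ?thesis .
qed

text \<open>Simple functions increase to \<open>\<phi>\<close>, so the exponentials decrease;
  convergence from above is legitimate because every exponential is bounded by 1 on a probability
  space.\<close>

theorem laplace_functional:
  assumes \<phi>: "\<phi> \<in> borel_measurable \<nu>"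
  shows "(\<integral>\<^sup>+\<omega>. eneg (pint \<phi> \<omega>) \<partial>M) = eneg (\<integral>\<^sup>+x. 1 - eneg (\<phi> x) \<partial>\<nu>)"
proof -
  obtain f where f: "\<And>i. simple_function \<nu> (f i)" "incseq f" "\<And>x. (SUP i. f i x) = \<phi> x"
    using borel_measurable_implies_simple_function_sequence'[OF \<phi>] by metis
  have fm [measurable]: "f i \<in> borel_measurable \<nu>" for i
    using f(1) by (rule borel_measurable_simple_function)
  have inc: "incseq (\<lambda>i. f i x)" for x
    using f(2) by (auto simp: incseq_def le_fun_def)
  have "(\<integral>\<^sup>+\<omega>. eneg (pint \<phi> \<omega>) \<partial>M) = (\<integral>\<^sup>+\<omega>. (INF i. eneg (pint (f i) \<omega>)) \<partial>M)"
  proof (rule nn_integral_cong)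
    fix \<omega> assume "\<omega> \<in> space M"
    then have "pint \<phi> \<omega> = (SUP i. pint (f i) \<omega>)"
      using pint_SUP[of f \<omega>] inc by (simp add: f(3))
    then show "eneg (pint \<phi> \<omega>) = (INF i. eneg (pint (f i) \<omega>))"
      by (simp add: eneg_SUP incseq_pint inc)
  qed
  also have "\<dots> = (INF i. \<integral>\<^sup>+\<omega>. eneg (pint (f i) \<omega>) \<partial>M)"
  proof (rule nn_integral_monotone_convergence_INF_decseq)
    show "decseq (\<lambda>i \<omega>. eneg (pint (f i) \<omega>))"
      using inc by (auto simp: monotone_on_def le_fun_def intro!: eneg_antimono pint_mono)
    have "(\<integral>\<^sup>+\<omega>. eneg (pint (f 0) \<omega>) \<partial>M) \<le> (\<integral>\<^sup>+\<omega>. 1 \<partial>M)"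
      by (intro nn_integral_mono) simp
    then show "(\<integral>\<^sup>+\<omega>. eneg (pint (f 0) \<omega>) \<partial>M) < \<infinity>"
      by (rule le_less_trans) (simp add: emeasure_space_1)
  qed simp
  also have "\<dots> = (INF i. eneg (\<integral>\<^sup>+x. 1 - eneg (f i x) \<partial>\<nu>))"
    by (simp add: laplace_simple f(1))
  also have "\<dots> = eneg (SUP i. \<integral>\<^sup>+x. 1 - eneg (f i x) \<partial>\<nu>)"
    using inc by (intro eneg_SUP[symmetric])
      (auto simp: incseq_def intro!: nn_integral_mono ennreal_minus_mono eneg_antimono)
  also have "(SUP i. \<integral>\<^sup>+x. 1 - eneg (f i x) \<partial>\<nu>) = (\<integral>\<^sup>+x. (SUP i. 1 - eneg (f i x)) \<partial>\<nu>)"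
    using inc by (intro nn_integral_monotone_convergence_SUP[symmetric])
      (auto simp: incseq_def le_fun_def intro!: ennreal_minus_mono eneg_antimono)
  also have "\<dots> = (\<integral>\<^sup>+x. 1 - eneg (\<phi> x) \<partial>\<nu>)"
    by (intro nn_integral_cong) (simp add: SUP_const_minus_ennreal eneg_SUP[symmetric] inc f(3))
  finally show ?thesis .
qed

lemma expectation_eneg_le_1: "(\<integral>\<^sup>+\<omega>. eneg (X \<omega>) \<partial>M) \<le> 1"
proof -
  have "(\<integral>\<^sup>+\<omega>. eneg (X \<omega>) \<partial>M) \<le> (\<integral>\<^sup>+\<omega>. 1 \<partial>M)"
    by (intro nn_integral_mono) simp
  then show ?thesis by (simp add: emeasure_space_1)
qed

text \<open>The expectation of \<open>dquot k (pint f) * eneg (pint \<phi>)\<close> is a scaled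
  difference of the Laplace functionals at \<open>\<phi>\<close> and
  \<open>\<phi> + f / (k + 1)\<close>, whose ratio is explicit; then \<open>k\<close> tends to
  infinity. Monotone convergence lets both sides be \<open>\<top>\<close>.\<close>

theorem mecke_exponential:
  assumes [measurable]: "f \<in> borel_measurable \<nu>" "\<phi> \<in> borel_measurable \<nu>"
  shows "(\<integral>\<^sup>+\<omega>. pint f \<omega> * eneg (pint \<phi> \<omega>) \<partial>M)
    = (\<integral>\<^sup>+x. f x * eneg (\<phi> x) \<partial>\<nu>) * (\<integral>\<^sup>+\<omega>. eneg (pint \<phi> \<omega>) \<partial>M)"
proof -
  define L where "L = (\<integral>\<^sup>+\<omega>. eneg (pint \<phi> \<omega>) \<partial>M)"
  define fk where "fk k x = f x / of_nat (Suc k)" for k x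
  \<comment> \<open>\<open>a k\<close> is the increment of the Laplace exponent from
    \<open>\<phi>\<close> to \<open>\<phi> + f / (k + 1)\<close>, and \<open>b k\<close> is this
    increment divided by the step, which increases to the integral of
    \<open>f * eneg \<phi>\<close>.\<close>
  define a where "a k = (\<integral>\<^sup>+x. eneg (\<phi> x) * (1 - eneg (fk k x)) \<partial>\<nu>)" for k
  define b where "b k = of_nat (Suc k) * a k" for k
  have [measurable]: "fk k \<in> borel_measurable \<nu>" for k
    unfolding fk_def[abs_def] by measurable
  have L1: "L \<le> 1" unfolding L_def by (rule expectation_eneg_le_1)
  have b: "b k = (\<integral>\<^sup>+x. eneg (\<phi> x) * dquot k (f x) \<partial>\<nu>)" for k
    unfolding b_def a_def dquot_def fk_def
    by (subst nn_integral_cmult[symmetric]) (auto simp: ac_simps)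
  have incb: "incseq b"
    using incseq_dquot unfolding b by (auto simp: incseq_def intro!: nn_integral_mono mult_left_mono)
  have supb: "(SUP k. b k) = (\<integral>\<^sup>+x. f x * eneg (\<phi> x) \<partial>\<nu>)"
  proof -
    have "(SUP k. b k) = (\<integral>\<^sup>+x. (SUP k. eneg (\<phi> x) * dquot k (f x)) \<partial>\<nu>)"
      unfolding b using incseq_dquot
      by (intro nn_integral_monotone_convergence_SUP[symmetric])
         (auto simp: incseq_def le_fun_def intro!: mult_left_mono)
    then show ?thesis
      by (simp add: SUP_mult_left_ennreal[symmetric] SUP_dquot mult.commute)
  qed
  have shift: "(\<integral>\<^sup>+\<omega>. eneg (pint \<phi> \<omega> + pint (fk k) \<omega>) \<partial>M) = L * eneg (a k)" for k
  proof -
    have "(\<integral>\<^sup>+\<omega>. eneg (pint \<phi> \<omega> + pint (fk k) \<omega>) \<partial>M) = (\<integral>\<^sup>+\<omega>. eneg (pint (\<lambda>x. \<phi> x + fk k x) \<omega>) \<partial>M)"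
      by (intro nn_integral_cong) (simp add: pint_add)
    also have "\<dots> = eneg (\<integral>\<^sup>+x. 1 - eneg (\<phi> x + fk k x) \<partial>\<nu>)"
      by (rule laplace_functional) simp
    also have "(\<integral>\<^sup>+x. 1 - eneg (\<phi> x + fk k x) \<partial>\<nu>)
        = (\<integral>\<^sup>+x. (1 - eneg (\<phi> x)) + eneg (\<phi> x) * (1 - eneg (fk k x)) \<partial>\<nu>)"
      by (simp add: eneg_add one_minus_eneg_mult)
    also have "\<dots> = (\<integral>\<^sup>+x. 1 - eneg (\<phi> x) \<partial>\<nu>) + a k"
      unfolding a_def by (intro nn_integral_add) auto
    finally show ?thesis
      by (simp add: eneg_add L_def laplace_functional)
  qed
  have step: "(\<integral>\<^sup>+\<omega>. dquot k (pint f \<omega>) * eneg (pint \<phi> \<omega>) \<partial>M) = L * dquot k (b k)" for k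
  proof -
    have e: "dquot k (pint f \<omega>) * eneg (pint \<phi> \<omega>)
        = of_nat (Suc k) * (eneg (pint \<phi> \<omega>) - eneg (pint \<phi> \<omega> + pint (fk k) \<omega>))"
      if "\<omega> \<in> space M" for \<omega>
    proof -
      have "pint (fk k) \<omega> = pint f \<omega> / of_nat (Suc k)"
        using that pint_cmult[of f \<omega> "inverse (of_nat (Suc k))"]
        by (simp add: fk_def[abs_def] divide_ennreal_def mult.commute)
      moreover have "x - x * y = x * (1 - y)" if "x < \<top>" for x y :: ennreal
        using ennreal_right_diff_distrib[of x 1 y] that by simp
      ultimately show ?thesis
        by (simp add: dquot_def eneg_add ac_simps)
    qed
    have "(\<integral>\<^sup>+\<omega>. dquot k (pint f \<omega>) * eneg (pint \<phi> \<omega>) \<partial>M)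
        = of_nat (Suc k) * (\<integral>\<^sup>+\<omega>. eneg (pint \<phi> \<omega>) - eneg (pint \<phi> \<omega> + pint (fk k) \<omega>) \<partial>M)"
      by (subst nn_integral_cmult[symmetric]) (auto simp: e intro!: nn_integral_cong)
    also have "(\<integral>\<^sup>+\<omega>. eneg (pint \<phi> \<omega>) - eneg (pint \<phi> \<omega> + pint (fk k) \<omega>) \<partial>M) = L - L * eneg (a k)"
    proof (subst nn_integral_diff)
      show "(\<integral>\<^sup>+\<omega>. eneg (pint \<phi> \<omega> + pint (fk k) \<omega>) \<partial>M) \<noteq> \<infinity>"
        using expectation_eneg_le_1[of "\<lambda>\<omega>. pint \<phi> \<omega> + pint (fk k) \<omega>"] by (auto simp: top_unique)
      show "AE \<omega> in M. eneg (pint \<phi> \<omega> + pint (fk k) \<omega>) \<le> eneg (pint \<phi> \<omega>)"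
        by (intro AE_I2 eneg_antimono) simp
    qed (auto simp: shift L_def[symmetric])
    also have "of_nat (Suc k) * (L - L * eneg (a k)) = L * dquot k (b k)"
    proof -
      have "L < \<top>" using L1 by (rule le_less_trans) simp
      then have "L - L * eneg (a k) = L * (1 - eneg (a k))"
        using ennreal_right_diff_distrib[of L 1 "eneg (a k)"] by simp
      moreover have "b k / of_nat (Suc k) = a k"
        unfolding b_def
        by (subst mult.commute) (simp add: ennreal_mult_divide_eq del: of_nat_Suc)
      ultimately show ?thesis
        by (simp add: dquot_def ac_simps del: of_nat_Suc)
    qed
    finally show ?thesis .
  qed
  \<comment> \<open>The index occurs twice in \<open>dquot k (b k)\<close>; since the term is
    monotone in each occurrence, the double supremum equals the diagonal one.\<close>
  have dd: "(SUP k. dquot k (b k)) = (SUP k. b k)"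
  proof (rule antisym)
    show "(SUP k. dquot k (b k)) \<le> (SUP k. b k)"
      by (intro SUP_mono) (auto intro: dquot_le)
    show "(SUP k. b k) \<le> (SUP k. dquot k (b k))"
    proof (rule SUP_least)
      fix j
      have "dquot k (b j) \<le> (SUP k. dquot k (b k))" for k
      proof -
        have "dquot k (b j) \<le> dquot (max j k) (b (max j k))"
          using incseq_dquot[of "b j"] incb
          by (meson dquot_mono incseqD max.cobounded1 max.cobounded2 order_trans)
        also have "\<dots> \<le> (SUP k. dquot k (b k))" by (rule SUP_upper) simp
        finally show ?thesis .
      qed
      then have "(SUP k. dquot k (b j)) \<le> (SUP k. dquot k (b k))" by (rule SUP_least)
      then show "b j \<le> (SUP k. dquot k (b k))" by (simp add: SUP_dquot)
    qed
  qed
  have "(\<integral>\<^sup>+\<omega>. pint f \<omega> * eneg (pint \<phi> \<omega>) \<partial>M)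
      = (\<integral>\<^sup>+\<omega>. (SUP k. dquot k (pint f \<omega>) * eneg (pint \<phi> \<omega>)) \<partial>M)"
    by (simp add: SUP_mult_right_ennreal[symmetric] SUP_dquot)
  also have "\<dots> = (SUP k. \<integral>\<^sup>+\<omega>. dquot k (pint f \<omega>) * eneg (pint \<phi> \<omega>) \<partial>M)"
    using incseq_dquot by (intro nn_integral_monotone_convergence_SUP)
      (auto simp: incseq_def le_fun_def intro!: mult_right_mono)
  also have "\<dots> = L * (SUP k. b k)"
    by (simp add: step SUP_mult_left_ennreal[symmetric] dd)
  finally show ?thesis
    by (simp add: supb L_def mult.commute)
qed

end

section \<open>Mecke's formula and joint moments\<close>

text \<open>A partition of \<open>insert j J\<close> amounts to the set \<open>X\<close> of
  companions of \<open>j\<close> in its block together with a partition of the remaining points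
  \<open>J - X\<close>; the map \<open>T\<close> below realises this bijection.\<close>

lemma sum_prod_partition_on_insert:
  fixes G :: "'i set \<Rightarrow> 'r::comm_semiring_1"
  assumes "finite J" "j \<notin> J"
  shows "(\<Sum>p | partition_on (insert j J) p. \<Prod>C\<in>p. G C)
    = (\<Sum>X\<in>Pow J. G (insert j X) * (\<Sum>p | partition_on (J - X) p. \<Prod>C\<in>p. G C))"
proof -
  define S where "S = (SIGMA X:Pow J. {p. partition_on (J - X) p})"
  define T where "T = (\<lambda>(X, p). insert (insert j X) p)"
  have notin: "j \<notin> C" if "(X, p) \<in> S" "C \<in> p" for X p C
    using that assms(2) partition_onD1[of "J - X" p] by (auto simp: S_def)
  \<comment> \<open>Injectivity of \<open>T\<close>: both components can be read off from the image,
    because \<open>j\<close> lies in exactly one of its blocks.\<close>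
  have X_eq: "X = \<Union>{C \<in> T (X, p). j \<in> C} - {j}" and p_eq: "p = {C \<in> T (X, p). j \<notin> C}"
    if "(X, p) \<in> S" for X p
  proof -
    have "j \<notin> X" using that assms(2) by (auto simp: S_def)
    moreover have "{C \<in> T (X, p). j \<in> C} = {insert j X}"
      using notin[OF that] by (auto simp: T_def)
    ultimately show "X = \<Union>{C \<in> T (X, p). j \<in> C} - {j}" by auto
    show "p = {C \<in> T (X, p). j \<notin> C}"
      using notin[OF that] by (auto simp: T_def)
  qed
  have inj: "inj_on T S"
  proof (rule inj_onI, clarify)
    fix X p X' p' assume a: "(X, p) \<in> S" "(X', p') \<in> S" "T (X, p) = T (X', p')"
    show "X = X' \<and> p = p'"
      using X_eq[OF a(1)] X_eq[OF a(2)] p_eq[OF a(1)] p_eq[OF a(2)] a(3) by metis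
  qed
  have img: "T ` S = {p. partition_on (insert j J) p}"
  proof (intro equalityI subsetI)
    fix P assume "P \<in> T ` S"
    then obtain X p where X: "X \<subseteq> J" "partition_on (J - X) p" "P = insert (insert j X) p"
      by (auto simp: S_def T_def)
    have "disjnt (insert j X) (\<Union>p)"
      using X assms(2) partition_onD1[OF X(2)] by (auto simp: disjnt_def)
    moreover have "insert j J - insert j X = J - X" using assms(2) by auto
    ultimately show "P \<in> {p. partition_on (insert j J) p}"
      using X by (auto simp: partition_on_insert)
  next
    fix P assume "P \<in> {p. partition_on (insert j J) p}"
    then have P: "partition_on (insert j J) P" by simp
    then obtain C where C: "C \<in> P" "j \<in> C"
      using partition_onD1[OF P] by blast
    have d: "disjnt C (\<Union>(P - {C}))"
      using partition_onD2[OF P] C by (auto simp: disjnt_def disjoint_def)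
    have "partition_on (insert j J) (insert C (P - {C}))"
      using P C by (simp add: insert_absorb)
    then have "partition_on (insert j J - C) (P - {C})" "C \<subseteq> insert j J"
      using partition_on_insert[OF d] by auto
    moreover have "insert j J - C = J - (C - {j})"
      using C assms(2) by auto
    ultimately have "(C - {j}, P - {C}) \<in> S"
      by (auto simp: S_def)
    moreover have "T (C - {j}, P - {C}) = P"
      using C by (simp add: T_def insert_absorb)
    ultimately show "P \<in> T ` S" by (metis imageI)
  qed
  have fin: "finite p" if "(X, p) \<in> S" for X p
    using that assms(1) by (auto simp: S_def intro: finite_elements[of "J - X"])
  have "(\<Sum>p | partition_on (insert j J) p. \<Prod>C\<in>p. G C) = (\<Sum>y\<in>S. \<Prod>C\<in>T y. G C)"
    unfolding img[symmetric] by (simp add: sum.reindex[OF inj])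
  also have "\<dots> = (\<Sum>(X, p)\<in>S. G (insert j X) * (\<Prod>C\<in>p. G C))"
  proof (intro sum.cong refl, clarify)
    fix X p assume S: "(X, p) \<in> S"
    have "insert j X \<notin> p" using notin[OF S] by blast
    then show "(\<Prod>C\<in>T (X, p). G C) = G (insert j X) * (\<Prod>C\<in>p. G C)"
      using fin[OF S] by (simp add: T_def)
  qed
  also have "\<dots> = (\<Sum>X\<in>Pow J. \<Sum>p | partition_on (J - X) p. G (insert j X) * (\<Prod>C\<in>p. G C))"
    unfolding S_def using assms(1)
    by (intro sum.Sigma[symmetric]) (auto intro: finitely_many_partition_on)
  finally show ?thesis by (simp add: sum_distrib_left)
qed

context poisson_measure
begin

text \<open>Each factor \<open>1 - eneg (pint (F j))\<close> is a difference of two exponentials, so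
  the formula with \<open>j\<close> added is the difference of two instances of the induction
  hypothesis, at \<open>\<phi>\<close> and at \<open>\<phi> + F j\<close>. The case without factors
  is \<open>mecke_exponential\<close>.\<close>

lemma mecke_difference:
  assumes [measurable]: "f \<in> borel_measurable \<nu>" "\<phi> \<in> borel_measurable \<nu>" "\<And>i. F i \<in> borel_measurable \<nu>"
    and fin: "(\<integral>\<^sup>+x. f x \<partial>\<nu>) < \<infinity>" and I: "finite I"
  shows "(\<integral>\<^sup>+\<omega>. pint f \<omega> * ((\<Prod>i\<in>I. 1 - eneg (pint (F i) \<omega>)) * eneg (pint \<phi> \<omega>)) \<partial>M)
    = (\<integral>\<^sup>+x. f x * (\<integral>\<^sup>+\<omega>. (\<Prod>i\<in>I. 1 - eneg (pint (F i) \<omega> + F i x)) * eneg (pint \<phi> \<omega> + \<phi> x) \<partial>M) \<partial>\<nu>)"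
  using I assms(2)
proof (induction I arbitrary: \<phi> rule: finite_induct)
  case (empty \<phi>)
  note [measurable] = empty
  show ?case
    by (simp add: eneg_add nn_integral_multc mecke_exponential)
       (simp add: mult.left_commute[of _ "eneg (\<phi> _)"] mult.commute[of "integral\<^sup>N M _"]
          mult.assoc[symmetric] nn_integral_multc)
next
  case (insert j I \<phi>)
  note [measurable] = insert.prems
  define P where "P \<omega> = (\<Prod>i\<in>I. 1 - eneg (pint (F i) \<omega>))" for \<omega>
  define Q where "Q x \<omega> = (\<Prod>i\<in>I. 1 - eneg (pint (F i) \<omega> + F i x))" for x \<omega>
  have [measurable]: "P \<in> borel_measurable M" unfolding P_def[abs_def] by measurable
  have [measurable]: "case_prod Q \<in> borel_measurable (\<nu> \<Otimes>\<^sub>M M)" unfolding Q_def[abs_def] by measurable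
  define A where "A = (\<integral>\<^sup>+\<omega>. pint f \<omega> * (P \<omega> * eneg (pint (\<lambda>x. \<phi> x + F j x) \<omega>)) \<partial>M)"
  define B where "B = (\<integral>\<^sup>+x. f x * (\<integral>\<^sup>+\<omega>. Q x \<omega> * eneg (pint (\<lambda>x. \<phi> x + F j x) \<omega> + (\<phi> x + F j x)) \<partial>M) \<partial>\<nu>)"
  define A' where "A' = (\<integral>\<^sup>+\<omega>. pint f \<omega> * ((1 - eneg (pint (F j) \<omega>)) * P \<omega> * eneg (pint \<phi> \<omega>)) \<partial>M)"
  define B' where "B' = (\<integral>\<^sup>+x. f x * (\<integral>\<^sup>+\<omega>. (1 - eneg (pint (F j) \<omega> + F j x)) * Q x \<omega> * eneg (pint \<phi> \<omega> + \<phi> x) \<partial>M) \<partial>\<nu>)"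
  have AB: "A = B" unfolding A_def B_def P_def Q_def by (rule insert.IH) simp
  have split: "(1 - eneg x) * c * eneg y + c * eneg (y + x) = c * eneg y" for x y c
  proof -
    have "(1 - eneg x) * c * eneg y + c * eneg (y + x) = (eneg x + (1 - eneg x)) * (c * eneg y)"
      by (simp only: eneg_add distrib_right) (simp add: ac_simps)
    then show ?thesis by (simp only: eneg_plus_complement mult_1)
  qed
  have A: "A' + A = (\<integral>\<^sup>+\<omega>. pint f \<omega> * (P \<omega> * eneg (pint \<phi> \<omega>)) \<partial>M)"
    unfolding A_def A'_def
    by (subst nn_integral_add[symmetric])
       (auto intro!: nn_integral_cong simp: pint_add distrib_left[symmetric] split)
  have B: "B' + B = (\<integral>\<^sup>+x. f x * (\<integral>\<^sup>+\<omega>. Q x \<omega> * eneg (pint \<phi> \<omega> + \<phi> x) \<partial>M) \<partial>\<nu>)"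
  proof -
    have "B' + B = (\<integral>\<^sup>+x. f x * (\<integral>\<^sup>+\<omega>. (1 - eneg (pint (F j) \<omega> + F j x)) * Q x \<omega> * eneg (pint \<phi> \<omega> + \<phi> x) \<partial>M)
        + f x * (\<integral>\<^sup>+\<omega>. Q x \<omega> * eneg (pint (\<lambda>x. \<phi> x + F j x) \<omega> + (\<phi> x + F j x)) \<partial>M) \<partial>\<nu>)"
      unfolding B_def B'_def by (subst nn_integral_add) auto
    also have "\<dots> = (\<integral>\<^sup>+x. f x * (\<integral>\<^sup>+\<omega>. Q x \<omega> * eneg (pint \<phi> \<omega> + \<phi> x) \<partial>M) \<partial>\<nu>)"
    proof (intro nn_integral_cong)
      fix x assume x[measurable]: "x \<in> space \<nu>"
      have "(\<integral>\<^sup>+\<omega>. (1 - eneg (pint (F j) \<omega> + F j x)) * Q x \<omega> * eneg (pint \<phi> \<omega> + \<phi> x) \<partial>M)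
          + (\<integral>\<^sup>+\<omega>. Q x \<omega> * eneg (pint (\<lambda>x. \<phi> x + F j x) \<omega> + (\<phi> x + F j x)) \<partial>M)
          = (\<integral>\<^sup>+\<omega>. (1 - eneg (pint (F j) \<omega> + F j x)) * Q x \<omega> * eneg (pint \<phi> \<omega> + \<phi> x)
              + Q x \<omega> * eneg ((pint \<phi> \<omega> + \<phi> x) + (pint (F j) \<omega> + F j x)) \<partial>M)"
        by (subst nn_integral_add[symmetric]) (auto intro!: nn_integral_cong simp: pint_add ac_simps)
      also have "\<dots> = (\<integral>\<^sup>+\<omega>. Q x \<omega> * eneg (pint \<phi> \<omega> + \<phi> x) \<partial>M)"
        by (simp add: split)
      finally show "f x * (\<integral>\<^sup>+\<omega>. (1 - eneg (pint (F j) \<omega> + F j x)) * Q x \<omega> * eneg (pint \<phi> \<omega> + \<phi> x) \<partial>M)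
          + f x * (\<integral>\<^sup>+\<omega>. Q x \<omega> * eneg (pint (\<lambda>x. \<phi> x + F j x) \<omega> + (\<phi> x + F j x)) \<partial>M)
          = f x * (\<integral>\<^sup>+\<omega>. Q x \<omega> * eneg (pint \<phi> \<omega> + \<phi> x) \<partial>M)"
        by (simp add: distrib_left[symmetric])
    qed
    finally show ?thesis .
  qed
  have "A' + A = B' + B"
    unfolding A B P_def Q_def by (rule insert.IH) simp
  \<comment> \<open>Cancelling a summand requires it to be finite; this is where integrability of
    \<open>f\<close> enters, all other factors being at most 1.\<close>
  moreover have "B \<noteq> \<top>"
  proof -
    have "B \<le> (\<integral>\<^sup>+x. f x * 1 \<partial>\<nu>)"
      unfolding B_def
    proof (intro nn_integral_mono mult_left_mono)
      fix x
      have "(\<integral>\<^sup>+\<omega>. Q x \<omega> * eneg (pint (\<lambda>x. \<phi> x + F j x) \<omega> + (\<phi> x + F j x)) \<partial>M) \<le> (\<integral>\<^sup>+\<omega>. 1 \<partial>M)"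
      proof (intro nn_integral_mono)
        fix \<omega>
        have "Q x \<omega> \<le> (\<Prod>i\<in>I. 1)"
          unfolding Q_def by (intro prod_mono_ennreal) (rule diff_le_self_ennreal)
        then have "Q x \<omega> * eneg y \<le> 1 * 1" for y
          by (intro mult_mono) auto
        then show "Q x \<omega> * eneg (pint (\<lambda>x. \<phi> x + F j x) \<omega> + (\<phi> x + F j x)) \<le> 1" by simp
      qed
      then show "(\<integral>\<^sup>+\<omega>. Q x \<omega> * eneg (pint (\<lambda>x. \<phi> x + F j x) \<omega> + (\<phi> x + F j x)) \<partial>M) \<le> 1"
        by (simp add: emeasure_space_1)
    qed simp
    then show ?thesis using fin by (auto simp: top_unique)
  qed
  ultimately have "A' = B'"
    by (simp add: AB add.commute ennreal_add_left_cancel)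
  then show ?case
    using insert.hyps by (simp add: A'_def B'_def P_def Q_def)
qed

text \<open>Rescaling the factors of \<open>mecke_difference\<close> by \<open>k + 1\<close> gives
  \<open>dquot k (pint (F i))\<close>, which increases to \<open>pint (F i)\<close>. At the same
  time \<open>f\<close> is replaced by \<open>dquot k f\<close>, which is integrable because of
  \<open>fin\<close> and increases to \<open>f\<close>.\<close>

theorem mecke_product:
  assumes [measurable]: "f \<in> borel_measurable \<nu>" "\<phi> \<in> borel_measurable \<nu>" "\<And>i. F i \<in> borel_measurable \<nu>"
    and fin: "(\<integral>\<^sup>+x. 1 - eneg (f x) \<partial>\<nu>) < \<infinity>" and I: "finite I"
  shows "(\<integral>\<^sup>+\<omega>. pint f \<omega> * ((\<Prod>i\<in>I. pint (F i) \<omega>) * eneg (pint \<phi> \<omega>)) \<partial>M)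
    = (\<integral>\<^sup>+x. f x * (\<integral>\<^sup>+\<omega>. (\<Prod>i\<in>I. pint (F i) \<omega> + F i x) * eneg (pint \<phi> \<omega> + \<phi> x) \<partial>M) \<partial>\<nu>)"
proof -
  define U where "U k \<omega> = pint (\<lambda>x. dquot k (f x)) \<omega> * ((\<Prod>i\<in>I. dquot k (pint (F i) \<omega>)) * eneg (pint \<phi> \<omega>))"
    for k \<omega>
  define V where "V k x \<omega> = (\<Prod>i\<in>I. dquot k (pint (F i) \<omega> + F i x)) * eneg (pint \<phi> \<omega> + \<phi> x)" for k x \<omega>
  have [measurable]: "U k \<in> borel_measurable M" for k unfolding U_def[abs_def] by measurable
  have [measurable]: "case_prod (V k) \<in> borel_measurable (\<nu> \<Otimes>\<^sub>M M)" for k unfolding V_def[abs_def] by measurable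
  have eq: "(\<integral>\<^sup>+\<omega>. U k \<omega> \<partial>M) = (\<integral>\<^sup>+x. dquot k (f x) * (\<integral>\<^sup>+\<omega>. V k x \<omega> \<partial>M) \<partial>\<nu>)" for k
  proof -
    define K where "K = (of_nat (Suc k) :: ennreal)"
    define G where "G i x = F i x / K" for i x
    have [measurable]: "G i \<in> borel_measurable \<nu>" for i unfolding G_def[abs_def] by measurable
    have pG: "pint (G i) \<omega> = pint (F i) \<omega> / K" if "\<omega> \<in> space M" for i \<omega>
      using that pint_cmult[of "F i" \<omega> "inverse K"]
      by (simp add: G_def[abs_def] divide_ennreal_def mult.commute)
    have prodK: "(\<Prod>i\<in>I. dquot k (a i)) = K ^ card I * (\<Prod>i\<in>I. 1 - eneg (a i / K))" for a
      by (simp add: dquot_def prod.distrib K_def)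
    \<comment> \<open>Pointwise \<open>dquot k (f x) \<le> (k + 1) * (1 - eneg (f x))\<close>,
      because \<open>f x / (k + 1) \<le> f x\<close>.\<close>
    have "(\<integral>\<^sup>+x. dquot k (f x) \<partial>\<nu>) < \<infinity>"
    proof -
      have "(\<integral>\<^sup>+x. dquot k (f x) \<partial>\<nu>) \<le> (\<integral>\<^sup>+x. K * (1 - eneg (f x)) \<partial>\<nu>)"
        unfolding dquot_def K_def
      proof (intro nn_integral_mono mult_left_mono ennreal_minus_mono eneg_antimono)
        fix x
        show "f x / of_nat (Suc k) \<le> f x"
          using mult_left_mono[of "inverse (of_nat (Suc k))" 1 "f x"]
          by (simp add: divide_ennreal_def ennreal_of_nat_eq_real_of_nat inverse_ennreal
              ennreal_le_1 inverse_le_1_iff del: of_nat_Suc)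
      qed auto
      also have "\<dots> = K * (\<integral>\<^sup>+x. 1 - eneg (f x) \<partial>\<nu>)" by (rule nn_integral_cmult) simp
      also have "\<dots> < \<infinity>" using fin of_nat_less_top[of "Suc k"] by (simp add: ennreal_mult_less_top K_def del: of_nat_Suc)
      finally show ?thesis .
    qed
    then have m: "(\<integral>\<^sup>+\<omega>. pint (\<lambda>x. dquot k (f x)) \<omega> * ((\<Prod>i\<in>I. 1 - eneg (pint (G i) \<omega>)) * eneg (pint \<phi> \<omega>)) \<partial>M)
      = (\<integral>\<^sup>+x. dquot k (f x) * (\<integral>\<^sup>+\<omega>. (\<Prod>i\<in>I. 1 - eneg (pint (G i) \<omega> + G i x)) * eneg (pint \<phi> \<omega> + \<phi> x) \<partial>M) \<partial>\<nu>)"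
      by (intro mecke_difference I) auto
    have "(\<integral>\<^sup>+\<omega>. U k \<omega> \<partial>M) = K ^ card I *
        (\<integral>\<^sup>+\<omega>. pint (\<lambda>x. dquot k (f x)) \<omega> * ((\<Prod>i\<in>I. 1 - eneg (pint (G i) \<omega>)) * eneg (pint \<phi> \<omega>)) \<partial>M)"
      unfolding U_def by (subst nn_integral_cmult[symmetric])
        (auto intro!: nn_integral_cong simp: prodK pG ac_simps)
    also have "\<dots> = (\<integral>\<^sup>+x. dquot k (f x) * (\<integral>\<^sup>+\<omega>. V k x \<omega> \<partial>M) \<partial>\<nu>)"
      unfolding m
    proof (subst nn_integral_cmult[symmetric], measurable, intro nn_integral_cong)
      fix x assume [measurable]: "x \<in> space \<nu>"
      have "(\<integral>\<^sup>+\<omega>. V k x \<omega> \<partial>M) = K ^ card I *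
          (\<integral>\<^sup>+\<omega>. (\<Prod>i\<in>I. 1 - eneg (pint (G i) \<omega> + G i x)) * eneg (pint \<phi> \<omega> + \<phi> x) \<partial>M)"
        unfolding V_def by (subst nn_integral_cmult[symmetric])
          (auto intro!: nn_integral_cong simp: prodK pG G_def add_divide_distrib_ennreal ac_simps)
      then show "K ^ card I * (dquot k (f x) * (\<integral>\<^sup>+\<omega>. (\<Prod>i\<in>I. 1 - eneg (pint (G i) \<omega> + G i x)) * eneg (pint \<phi> \<omega> + \<phi> x) \<partial>M))
        = dquot k (f x) * (\<integral>\<^sup>+\<omega>. V k x \<omega> \<partial>M)"
        by (simp add: ac_simps)
    qed
    finally show ?thesis .
  qed
  have incP: "incseq (\<lambda>k. \<Prod>i\<in>I. dquot k (a i))" for a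
    by (intro incseq_prod_ennreal incseq_dquot)
  have supP: "(SUP k. \<Prod>i\<in>I. dquot k (a i)) = (\<Prod>i\<in>I. a i)" for a
    by (subst SUP_prod_incseq) (auto simp: I incseq_dquot SUP_dquot)
  have incU: "incseq (\<lambda>k. U k \<omega>)" for \<omega>
    unfolding U_def by (intro incseq_mult_ennreal incP incseq_pint incseq_dquot) (simp add: incseq_def)
  have incV: "incseq (\<lambda>k. V k x \<omega>)" for x \<omega>
    unfolding V_def by (intro incseq_mult_ennreal incP) (simp add: incseq_def)
  have incVI: "incseq (\<lambda>k. \<integral>\<^sup>+\<omega>. V k x \<omega> \<partial>M)" for x
    using incV by (auto simp: incseq_def intro!: nn_integral_mono)
  have "(\<integral>\<^sup>+\<omega>. pint f \<omega> * ((\<Prod>i\<in>I. pint (F i) \<omega>) * eneg (pint \<phi> \<omega>)) \<partial>M) = (\<integral>\<^sup>+\<omega>. (SUP k. U k \<omega>) \<partial>M)"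
  proof (rule nn_integral_cong)
    fix \<omega> assume \<omega>: "\<omega> \<in> space M"
    have "pint f \<omega> = (SUP k. pint (\<lambda>x. dquot k (f x)) \<omega>)"
      using pint_SUP[of "\<lambda>k x. dquot k (f x)" \<omega>] \<omega> by (simp add: incseq_dquot SUP_dquot)
    then show "pint f \<omega> * ((\<Prod>i\<in>I. pint (F i) \<omega>) * eneg (pint \<phi> \<omega>)) = (SUP k. U k \<omega>)"
      unfolding U_def
      by (subst SUP_mult_incseq)
        (auto simp: supP SUP_mult_right_ennreal[symmetric] incseq_dquot
          intro!: incseq_pint incseq_mult_ennreal incP)
  qed
  also have "\<dots> = (SUP k. \<integral>\<^sup>+\<omega>. U k \<omega> \<partial>M)"
    using incU by (intro nn_integral_monotone_convergence_SUP) (auto simp: incseq_def le_fun_def)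
  also have "\<dots> = (SUP k. \<integral>\<^sup>+x. dquot k (f x) * (\<integral>\<^sup>+\<omega>. V k x \<omega> \<partial>M) \<partial>\<nu>)"
    by (simp add: eq)
  also have "\<dots> = (\<integral>\<^sup>+x. (SUP k. dquot k (f x) * (\<integral>\<^sup>+\<omega>. V k x \<omega> \<partial>M)) \<partial>\<nu>)"
    using incseq_mult_ennreal[OF incseq_dquot incVI]
    by (intro nn_integral_monotone_convergence_SUP[symmetric]) (auto simp: incseq_def le_fun_def)
  also have "\<dots> = (\<integral>\<^sup>+x. f x * (\<integral>\<^sup>+\<omega>. (\<Prod>i\<in>I. pint (F i) \<omega> + F i x) * eneg (pint \<phi> \<omega> + \<phi> x) \<partial>M) \<partial>\<nu>)"
  proof (intro nn_integral_cong)
    fix x assume [measurable]: "x \<in> space \<nu>"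
    have "(SUP k. \<integral>\<^sup>+\<omega>. V k x \<omega> \<partial>M) = (\<integral>\<^sup>+\<omega>. (SUP k. V k x \<omega>) \<partial>M)"
      using incV by (intro nn_integral_monotone_convergence_SUP[symmetric]) (auto simp: incseq_def le_fun_def)
    also have "\<dots> = (\<integral>\<^sup>+\<omega>. (\<Prod>i\<in>I. pint (F i) \<omega> + F i x) * eneg (pint \<phi> \<omega> + \<phi> x) \<partial>M)"
      unfolding V_def by (simp add: SUP_mult_right_ennreal[symmetric] supP)
    finally show "(SUP k. dquot k (f x) * (\<integral>\<^sup>+\<omega>. V k x \<omega> \<partial>M))
      = f x * (\<integral>\<^sup>+\<omega>. (\<Prod>i\<in>I. pint (F i) \<omega> + F i x) * eneg (pint \<phi> \<omega> + \<phi> x) \<partial>M)"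
      by (simp add: SUP_mult_incseq incseq_dquot incVI SUP_dquot)
  qed
  finally show ?thesis .
qed

text \<open>Mecke's formula applied to one factor \<open>F j\<close> adds the contribution of an
  atom \<open>x\<close> to every other factor. In the expanded product, \<open>X\<close> is the set
  of indices served by this same atom; they join \<open>j\<close> in a block, and the indices
  \<open>J - X\<close> are left to the induction hypothesis.\<close>

theorem product_moment:
  assumes [measurable]: "\<phi> \<in> borel_measurable \<nu>" "\<And>i. F i \<in> borel_measurable \<nu>"
    and fin: "\<And>i. (\<integral>\<^sup>+x. 1 - eneg (F i x) \<partial>\<nu>) < \<infinity>" and I: "finite I"
  shows "(\<integral>\<^sup>+\<omega>. (\<Prod>i\<in>I. pint (F i) \<omega>) * eneg (pint \<phi> \<omega>) \<partial>M)
    = (\<Sum>p | partition_on I p. \<Prod>C\<in>p. \<integral>\<^sup>+x. (\<Prod>i\<in>C. F i x) * eneg (\<phi> x) \<partial>\<nu>)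
      * (\<integral>\<^sup>+\<omega>. eneg (pint \<phi> \<omega>) \<partial>M)"
  using I
proof (induction I rule: finite_psubset_induct)
  case (psubset I)
  define L where "L = (\<integral>\<^sup>+\<omega>. eneg (pint \<phi> \<omega>) \<partial>M)"
  define G where "G C = (\<integral>\<^sup>+x. (\<Prod>i\<in>C. F i x) * eneg (\<phi> x) \<partial>\<nu>)" for C
  show ?case
  proof (cases "I = {}")
    case True
    then show ?thesis by (simp add: partition_on_empty)
  next
    case False
    then obtain j where j: "j \<in> I" by auto
    define J where "J = I - {j}"
    have J: "I = insert j J" "j \<notin> J" "finite J" using j psubset.hyps by (auto simp: J_def)
    have "(\<integral>\<^sup>+\<omega>. (\<Prod>i\<in>I. pint (F i) \<omega>) * eneg (pint \<phi> \<omega>) \<partial>M)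
        = (\<integral>\<^sup>+\<omega>. pint (F j) \<omega> * ((\<Prod>i\<in>J. pint (F i) \<omega>) * eneg (pint \<phi> \<omega>)) \<partial>M)"
      using J by (simp add: mult.assoc)
    also have "\<dots> = (\<integral>\<^sup>+x. F j x * (\<integral>\<^sup>+\<omega>. (\<Prod>i\<in>J. pint (F i) \<omega> + F i x) * eneg (pint \<phi> \<omega> + \<phi> x) \<partial>M) \<partial>\<nu>)"
      by (intro mecke_product fin J) auto
    also have "\<dots> = (\<integral>\<^sup>+x. (\<Sum>X\<in>Pow J. (\<Prod>i\<in>insert j X. F i x) * eneg (\<phi> x)
        * (\<integral>\<^sup>+\<omega>. (\<Prod>i\<in>J - X. pint (F i) \<omega>) * eneg (pint \<phi> \<omega>) \<partial>M)) \<partial>\<nu>)"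
    proof (intro nn_integral_cong)
      fix x assume [measurable]: "x \<in> space \<nu>"
      have "(\<integral>\<^sup>+\<omega>. (\<Prod>i\<in>J. pint (F i) \<omega> + F i x) * eneg (pint \<phi> \<omega> + \<phi> x) \<partial>M)
          = (\<integral>\<^sup>+\<omega>. (\<Sum>X\<in>Pow J. ((\<Prod>i\<in>X. F i x) * eneg (\<phi> x)) * ((\<Prod>i\<in>J - X. pint (F i) \<omega>) * eneg (pint \<phi> \<omega>))) \<partial>M)"
        by (subst add.commute, subst prod_add[OF J(3)], unfold eneg_add sum_distrib_right)
           (simp add: ac_simps)
      also have "\<dots> = (\<Sum>X\<in>Pow J. ((\<Prod>i\<in>X. F i x) * eneg (\<phi> x)) * (\<integral>\<^sup>+\<omega>. (\<Prod>i\<in>J - X. pint (F i) \<omega>) * eneg (pint \<phi> \<omega>) \<partial>M))"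
        by (subst nn_integral_sum) (auto intro!: sum.cong nn_integral_cmult)
      finally have e: "(\<integral>\<^sup>+\<omega>. (\<Prod>i\<in>J. pint (F i) \<omega> + F i x) * eneg (pint \<phi> \<omega> + \<phi> x) \<partial>M) = \<dots>" .
      have "(\<Prod>i\<in>insert j X. F i x) = F j x * (\<Prod>i\<in>X. F i x)" if "X \<in> Pow J" for X
        using that J finite_subset[of X J] by (subst prod.insert) auto
      then show "F j x * (\<integral>\<^sup>+\<omega>. (\<Prod>i\<in>J. pint (F i) \<omega> + F i x) * eneg (pint \<phi> \<omega> + \<phi> x) \<partial>M)
          = (\<Sum>X\<in>Pow J. (\<Prod>i\<in>insert j X. F i x) * eneg (\<phi> x)
            * (\<integral>\<^sup>+\<omega>. (\<Prod>i\<in>J - X. pint (F i) \<omega>) * eneg (pint \<phi> \<omega>) \<partial>M))"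
        unfolding e sum_distrib_left by (intro sum.cong) (auto simp: mult.assoc)
    qed
    also have "\<dots> = (\<Sum>X\<in>Pow J. G (insert j X) * (\<integral>\<^sup>+\<omega>. (\<Prod>i\<in>J - X. pint (F i) \<omega>) * eneg (pint \<phi> \<omega>) \<partial>M))"
      unfolding G_def by (subst nn_integral_sum) (auto simp: nn_integral_multc)
    also have "\<dots> = (\<Sum>X\<in>Pow J. G (insert j X) * ((\<Sum>p | partition_on (J - X) p. \<Prod>C\<in>p. G C) * L))"
    proof (intro sum.cong refl arg_cong2[where f="(*)"])
      fix X assume "X \<in> Pow J"
      then have "J - X \<subset> I" using J by auto
      then show "(\<integral>\<^sup>+\<omega>. (\<Prod>i\<in>J - X. pint (F i) \<omega>) * eneg (pint \<phi> \<omega>) \<partial>M)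
          = (\<Sum>p | partition_on (J - X) p. \<Prod>C\<in>p. G C) * L"
        unfolding G_def L_def by (rule psubset.IH)
    qed
    also have "\<dots> = (\<Sum>p | partition_on I p. \<Prod>C\<in>p. G C) * L"
      unfolding J(1) sum_prod_partition_on_insert[OF J(3,2)] sum_distrib_right[of _ "Pow J"]
      by (simp add: mult.assoc)
    finally show ?thesis unfolding G_def L_def .
  qed
qed

end

section \<open>Jump kernels and normalized random measures\<close>

text \<open>Sampling from a random \<open>P\<close> requires the power measure to depend measurably
  on \<open>P\<close>. On boxes, which generate the product and are stable under intersection, it is
  a finite product of evaluations of \<open>P\<close>.\<close>

lemma measurable_PiM_subprob:
  assumes I: "finite I"
  shows "(\<lambda>P. PiM I (\<lambda>_. P)) \<in> subprob_algebra X \<rightarrow>\<^sub>M subprob_algebra (PiM I (\<lambda>_. X))"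
proof (rule measurable_subprob_algebra_generated[where \<Omega>="\<Pi>\<^sub>E i\<in>I. space X" and G="prod_algebra I (\<lambda>_. X)"])
  show "sets (PiM I (\<lambda>_. X)) = sigma_sets (\<Pi>\<^sub>E i\<in>I. space X) (prod_algebra I (\<lambda>_. X))"
    by (rule sets_PiM)
  show "Int_stable (prod_algebra I (\<lambda>_. X))" by (rule Int_stable_prod_algebra)
  show "prod_algebra I (\<lambda>_. X) \<subseteq> Pow (\<Pi>\<^sub>E i\<in>I. space X)" by (rule prod_algebra_sets_into_space)
  have box: "emeasure (PiM I (\<lambda>_. P)) (Pi\<^sub>E I E) = (\<Prod>i\<in>I. emeasure P (E i))"
    if P: "P \<in> space (subprob_algebra X)" and E: "\<And>i. i \<in> I \<Longrightarrow> E i \<in> sets X" for P E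
  proof -
    interpret P: subprob_space P using P by (simp add: space_subprob_algebra)
    interpret product_sigma_finite "\<lambda>_. P"
      by standard
    have "sets P = sets X" using P by (simp add: space_subprob_algebra)
    then show ?thesis using E I by (intro emeasure_PiM) simp_all
  qed
  show "sets (PiM I (\<lambda>_. P)) = sets (PiM I (\<lambda>_. X))" if "P \<in> space (subprob_algebra X)" for P
    using that by (intro sets_PiM_cong) (auto simp: space_subprob_algebra)
  show "subprob_space (PiM I (\<lambda>_. P))" if P: "P \<in> space (subprob_algebra X)" for P
  proof
    interpret P: subprob_space P using P by (simp add: space_subprob_algebra)
    have sX: "space P = space X" using P by (intro sets_eq_imp_space_eq) (simp add: space_subprob_algebra)
    have "emeasure (PiM I (\<lambda>_. P)) (space (PiM I (\<lambda>_. P))) = (\<Prod>i\<in>I. emeasure P (space P))"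
      unfolding space_PiM using box[OF P, of "\<lambda>_. space X"] by (simp add: sX)
    also have "\<dots> \<le> (\<Prod>i\<in>I. 1)"
      by (intro prod_mono_ennreal P.emeasure_space_le_1)
    finally show "emeasure (PiM I (\<lambda>_. P)) (space (PiM I (\<lambda>_. P))) \<le> 1" by simp
    show "space (PiM I (\<lambda>_. P)) \<noteq> {}"
      using P.subprob_not_empty by (simp add: space_PiM PiE_eq_empty_iff)
  qed
  show "(\<lambda>P. emeasure (PiM I (\<lambda>_. P)) A) \<in> borel_measurable (subprob_algebra X)"
    if "A \<in> prod_algebra I (\<lambda>_. X)" for A
  proof -
    have "\<exists>E. A = Pi\<^sub>E I E \<and> E \<in> (\<Pi> i\<in>I. sets X)"
      using that unfolding prod_algebra_eq_finite[OF I] mem_Collect_eq .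
    then obtain E where A: "A = Pi\<^sub>E I E" and E: "\<And>i. i \<in> I \<Longrightarrow> E i \<in> sets X"
      by (metis Pi_mem)
    have "(\<lambda>P. \<Prod>i\<in>I. emeasure P (E i)) \<in> borel_measurable (subprob_algebra X)"
      using E by (intro borel_measurable_prod_ennreal measurable_emeasure_subprob_algebra)
    moreover have "emeasure (PiM I (\<lambda>_. P)) A = (\<Prod>i\<in>I. emeasure P (E i))"
      if "P \<in> space (subprob_algebra X)" for P
      unfolding A by (rule box[OF that E])
    ultimately show ?thesis
      by (simp only: cong: measurable_cong)
  qed
  show "(\<lambda>P. emeasure (PiM I (\<lambda>_. P)) (\<Pi>\<^sub>E i\<in>I. space X)) \<in> borel_measurable (subprob_algebra X)"
  proof -
    have "(\<lambda>P. \<Prod>i\<in>I. emeasure P (space X)) \<in> borel_measurable (subprob_algebra X)"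
      by (intro borel_measurable_prod_ennreal measurable_emeasure_subprob_algebra) auto
    moreover have "emeasure (PiM I (\<lambda>_. P)) (\<Pi>\<^sub>E i\<in>I. space X) = (\<Prod>i\<in>I. emeasure P (space X))"
      if "P \<in> space (subprob_algebra X)" for P
      by (rule box[OF that]) simp
    ultimately show ?thesis
      by (simp only: cong: measurable_cong)
  qed
qed

locale levy_setting =
  fixes h :: "'s::polish_space \<Rightarrow> real" and \<rho> :: "'y::polish_space \<Rightarrow> 's measure" and \<eta> :: "'y measure"
  assumes sets_eta [measurable_cong]: "sets \<eta> = sets borel"
    and sigma_finite_eta: "sigma_finite_measure \<eta>"
    and h_meas [measurable]: "h \<in> borel_measurable borel"
    and h_pos: "\<And>s. h s > 0"
    and levy: "levy_kernel h \<rho>"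
begin

lemma sets_rho [measurable_cong]: "sets (\<rho> y) = sets borel"
  using levy by (simp add: levy_kernel_def)

lemma space_rho: "space (\<rho> y) = UNIV"
  using sets_eq_imp_space_eq[OF sets_rho] by simp

lemma space_eta: "space \<eta> = UNIV"
  using sets_eq_imp_space_eq[OF sets_eta] by simp

lemma measurable_nn_integral_rho_const:
  assumes "f \<in> borel_measurable borel"
  shows "(\<lambda>y. \<integral>\<^sup>+s. f s \<partial>\<rho> y) \<in> borel_measurable borel"
  using levy by (intro borel_measurable_nn_integral_family[OF assms]) (auto simp: sets_rho levy_kernel_def)

lemma min_h_finite: "(\<integral>\<^sup>+s. min 1 (ennreal (h s)) \<partial>\<rho> y) < \<infinity>"
  using levy by (simp add: levy_kernel_def)

text \<open>Each \<open>\<rho> y\<close> may be infinite, while \<open>F\<close> depends jointly on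
  \<open>x\<close> and \<open>s\<close>. Weighting \<open>\<rho> y\<close> by \<open>min 1 h\<close>
  and dividing by a constant produces a subprobability kernel, which admits joint integrands; the
  weight is undone inside the integral.\<close>

lemma measurable_nn_integral_rho [measurable (raw)]:
  assumes F [measurable]: "case_prod F \<in> borel_measurable (X \<Otimes>\<^sub>M borel)"
    and Y [measurable]: "Y \<in> X \<rightarrow>\<^sub>M borel"
  shows "(\<lambda>x. \<integral>\<^sup>+s. F x s \<partial>\<rho> (Y x)) \<in> borel_measurable X"
proof -
  \<comment> \<open>\<open>r\<close> is strictly positive and finite because \<open>h\<close> is
    positive, and \<open>c y\<close> exceeds the integral of \<open>r\<close> under
    \<open>\<rho> y\<close>; the summand 1 keeps \<open>c y\<close> nonzero where
    \<open>\<rho> y\<close> is null.\<close>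
  define r where "r s = min 1 (ennreal (h s))" for s
  define c where "c y = 1 + (\<integral>\<^sup>+s. r s \<partial>\<rho> y)" for y
  have r_meas [measurable]: "r \<in> borel_measurable borel" unfolding r_def[abs_def] by measurable
  have c_meas [measurable]: "c \<in> borel_measurable borel"
    unfolding c_def[abs_def] by (intro borel_measurable_add measurable_nn_integral_rho_const) auto
  have c: "c y \<noteq> 0" "c y < \<top>" for y
    using min_h_finite[of y] by (auto simp: c_def r_def)
  have r: "r s \<noteq> 0" "r s < \<top>" for s
    using h_pos[of s] by (auto simp: r_def min_def)
  define \<kappa> where "\<kappa> y = density (\<rho> y) (\<lambda>s. r s / c y)" for y
  have em: "emeasure (\<kappa> y) A = (\<integral>\<^sup>+s. r s * indicator A s \<partial>\<rho> y) / c y" if [measurable]: "A \<in> sets borel" for A y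
  proof -
    have "emeasure (\<kappa> y) A = (\<integral>\<^sup>+s. r s / c y * indicator A s \<partial>\<rho> y)"
      unfolding \<kappa>_def by (rule emeasure_density) auto
    also have "\<dots> = (\<integral>\<^sup>+s. (r s * indicator A s) / c y \<partial>\<rho> y)"
      by (intro nn_integral_cong) (simp add: divide_ennreal_def ac_simps)
    also have "\<dots> = (\<integral>\<^sup>+s. r s * indicator A s \<partial>\<rho> y) / c y"
      by (rule nn_integral_divide) measurable
    finally show ?thesis .
  qed
  have \<kappa> [measurable]: "\<kappa> \<in> borel \<rightarrow>\<^sub>M subprob_algebra borel"
  proof (rule measurable_subprob_algebra)
    show "sets (\<kappa> y) = sets borel" for y by (simp add: \<kappa>_def sets_rho)
    show "subprob_space (\<kappa> y)" for y
    proof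
      show "space (\<kappa> y) \<noteq> {}" by (simp add: \<kappa>_def space_rho)
      have "(\<integral>\<^sup>+s. r s \<partial>\<rho> y) / c y \<le> c y / c y"
        unfolding c_def by (intro divide_right_mono_ennreal) simp
      also have "\<dots> = 1" using c by (simp add: ennreal_divide_self)
      finally show "emeasure (\<kappa> y) (space (\<kappa> y)) \<le> 1"
        using em[of UNIV y] by (simp add: \<kappa>_def space_rho)
    qed
    show "(\<lambda>y. emeasure (\<kappa> y) A) \<in> borel_measurable borel" if A[measurable]: "A \<in> sets borel" for A
    proof -
      have [measurable]: "(\<lambda>y. \<integral>\<^sup>+s. r s * indicator A s \<partial>\<rho> y) \<in> borel_measurable borel"
        by (rule measurable_nn_integral_rho_const) measurable
      show ?thesis unfolding em[OF A] by measurable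
    qed
  qed
  have "(\<lambda>x. \<integral>\<^sup>+s. F x s * (c (Y x) / r s) \<partial>\<kappa> (Y x)) \<in> borel_measurable X"
    by (rule nn_integral_measurable_subprob_algebra2[where N=borel]) measurable
  moreover have "(\<integral>\<^sup>+s. F x s * (c (Y x) / r s) \<partial>\<kappa> (Y x)) = (\<integral>\<^sup>+s. F x s \<partial>\<rho> (Y x))"
    if [measurable]: "x \<in> space X" for x
  proof -
    have "(\<integral>\<^sup>+s. F x s * (c (Y x) / r s) \<partial>\<kappa> (Y x))
        = (\<integral>\<^sup>+s. r s / c (Y x) * (F x s * (c (Y x) / r s)) \<partial>\<rho> (Y x))"
      unfolding \<kappa>_def by (rule nn_integral_density) measurable
    also have "\<dots> = (\<integral>\<^sup>+s. F x s \<partial>\<rho> (Y x))"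
    proof (intro nn_integral_cong)
      fix s
      have "r s / c (Y x) * (F x s * (c (Y x) / r s)) = F x s * (r s / r s) * (c (Y x) / c (Y x))"
        by (simp add: divide_ennreal_def ac_simps)
      then show "r s / c (Y x) * (F x s * (c (Y x) / r s)) = F x s"
        using r[of s] c[of "Y x"] by (simp add: ennreal_divide_self)
    qed
    finally show ?thesis .
  qed
  ultimately show ?thesis
    by (simp cong: measurable_cong)
qed

lemma sets_intensity [measurable_cong]: "sets (intensity \<rho> \<eta>) = sets (borel \<Otimes>\<^sub>M borel)"
proof -
  have "sigma_algebra UNIV (sets (borel \<Otimes>\<^sub>M borel :: ('s \<times> 'y) measure))"
    using sets.sigma_algebra_axioms[of "borel \<Otimes>\<^sub>M borel :: ('s \<times> 'y) measure"]
    by (simp add: space_pair_measure)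
  then show ?thesis
    by (simp add: intensity_def sigma_algebra.sigma_sets_eq)
qed

lemma emeasure_rho_section:
  assumes [measurable]: "A \<in> sets (borel \<Otimes>\<^sub>M borel)"
  shows "emeasure (\<rho> y) {s. (s, y) \<in> A} = (\<integral>\<^sup>+s. indicator A (s, y) \<partial>\<rho> y)"
proof -
  have m: "{s. (s, y) \<in> A} \<in> sets (\<rho> y)"
  proof -
    have "(\<lambda>s. (s, y)) -` A \<inter> space borel \<in> sets borel"
      by (rule measurable_sets[of _ borel "borel \<Otimes>\<^sub>M borel"]) auto
    then show ?thesis by (simp add: sets_rho vimage_def)
  qed
  then have "emeasure (\<rho> y) {s. (s, y) \<in> A} = (\<integral>\<^sup>+s. indicator {s. (s, y) \<in> A} s \<partial>\<rho> y)"
    by simp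
  also have "\<dots> = (\<integral>\<^sup>+s. indicator A (s, y) \<partial>\<rho> y)"
    by (intro nn_integral_cong) (auto simp: indicator_def)
  finally show ?thesis .
qed

text \<open>\<open>measure_of\<close> returns the set function in the definition of
  \<open>intensity\<close> only if that is countably additive; it is, by exchanging the series over
  a disjoint family with both integrals.\<close>

lemma emeasure_intensity:
  assumes A: "A \<in> sets (borel \<Otimes>\<^sub>M borel)"
  shows "emeasure (intensity \<rho> \<eta>) A = (\<integral>\<^sup>+y. \<integral>\<^sup>+s. indicator A (s, y) \<partial>\<rho> y \<partial>\<eta>)"
proof -
  let ?B = "borel \<Otimes>\<^sub>M borel :: ('s \<times> 'y) measure"
  have sa: "sigma_algebra UNIV (sets ?B)"
    using sets.sigma_algebra_axioms[of ?B] by (simp add: space_pair_measure)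
  have "emeasure (intensity \<rho> \<eta>) A = (\<integral>\<^sup>+y. emeasure (\<rho> y) {s. (s, y) \<in> A} \<partial>\<eta>)"
    unfolding intensity_def
  proof (rule emeasure_measure_of_sigma[OF sa _ _ A])
    show "positive (sets ?B) (\<lambda>A. \<integral>\<^sup>+y. emeasure (\<rho> y) {s. (s, y) \<in> A} \<partial>\<eta>)"
      by (simp add: positive_def)
    show "countably_additive (sets ?B) (\<lambda>A. \<integral>\<^sup>+y. emeasure (\<rho> y) {s. (s, y) \<in> A} \<partial>\<eta>)"
    proof (rule countably_additiveI)
      fix F :: "nat \<Rightarrow> ('s \<times> 'y) set"
      assume F: "range F \<subseteq> sets ?B" "disjoint_family F" "(\<Union>i. F i) \<in> sets ?B"
      have [measurable]: "F i \<in> sets ?B" for i using F by auto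
      have "(\<Sum>i. \<integral>\<^sup>+y. emeasure (\<rho> y) {s. (s, y) \<in> F i} \<partial>\<eta>)
          = (\<Sum>i. \<integral>\<^sup>+y. \<integral>\<^sup>+s. indicator (F i) (s, y) \<partial>\<rho> y \<partial>\<eta>)"
        by (simp add: emeasure_rho_section)
      also have "\<dots> = (\<integral>\<^sup>+y. (\<Sum>i. \<integral>\<^sup>+s. indicator (F i) (s, y) \<partial>\<rho> y) \<partial>\<eta>)"
        by (rule nn_integral_suminf[symmetric]) measurable
      also have "\<dots> = (\<integral>\<^sup>+y. \<integral>\<^sup>+s. (\<Sum>i. indicator (F i) (s, y)) \<partial>\<rho> y \<partial>\<eta>)"
        by (intro nn_integral_cong nn_integral_suminf[symmetric]) measurable
      also have "\<dots> = (\<integral>\<^sup>+y. \<integral>\<^sup>+s. indicator (\<Union>i. F i) (s, y) \<partial>\<rho> y \<partial>\<eta>)"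
        by (intro nn_integral_cong suminf_indicator F)
      finally show "(\<Sum>i. \<integral>\<^sup>+y. emeasure (\<rho> y) {s. (s, y) \<in> F i} \<partial>\<eta>)
          = (\<integral>\<^sup>+y. emeasure (\<rho> y) {s. (s, y) \<in> (\<Union>i. F i)} \<partial>\<eta>)"
        using F(3) by (simp only: emeasure_rho_section)
    qed
  qed
  then show ?thesis using A by (simp only: emeasure_rho_section)
qed

lemma nn_integral_intensity:
  assumes f: "f \<in> borel_measurable (borel \<Otimes>\<^sub>M borel)"
  shows "(\<integral>\<^sup>+x. f x \<partial>intensity \<rho> \<eta>) = (\<integral>\<^sup>+y. \<integral>\<^sup>+s. f (s, y) \<partial>\<rho> y \<partial>\<eta>)"
  using f
proof induct
  case (cong u v)
  then have "u = v" by (auto simp: fun_eq_iff space_pair_measure)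
  with cong show ?case by simp
next
  case (set A)
  then show ?case by (simp add: sets_intensity emeasure_intensity)
next
  case (mult u c)
  note [measurable] = mult(2)
  show ?case using mult by (simp add: nn_integral_cmult)
next
  case (add u v)
  note [measurable] = add(1,4)
  show ?case using add by (simp add: nn_integral_add)
next
  case (seq U)
  note [measurable] = seq(1)
  have SUP_U: "(SUP i. U i) = (\<lambda>x. SUP i. U i x)"
    by (rule ext) (rule SUP_apply)
  have inc: "incseq (\<lambda>i s. U i (s, y))" for y
    using seq(4) by (auto simp: incseq_def le_fun_def)
  have "(\<integral>\<^sup>+x. (SUP i. U i x) \<partial>intensity \<rho> \<eta>) = (SUP i. \<integral>\<^sup>+x. U i x \<partial>intensity \<rho> \<eta>)"
    using seq(4) by (intro nn_integral_monotone_convergence_SUP) auto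
  also have "\<dots> = (SUP i. \<integral>\<^sup>+y. \<integral>\<^sup>+s. U i (s, y) \<partial>\<rho> y \<partial>\<eta>)"
    using seq(3) by simp
  also have "\<dots> = (\<integral>\<^sup>+y. (SUP i. \<integral>\<^sup>+s. U i (s, y) \<partial>\<rho> y) \<partial>\<eta>)"
    using inc by (intro nn_integral_monotone_convergence_SUP[symmetric])
      (auto simp: incseq_def le_fun_def intro!: nn_integral_mono)
  also have "\<dots> = (\<integral>\<^sup>+y. \<integral>\<^sup>+s. (SUP i. U i (s, y)) \<partial>\<rho> y \<partial>\<eta>)"
    using inc by (intro nn_integral_cong nn_integral_monotone_convergence_SUP[symmetric]) auto
  finally show ?case unfolding SUP_U .
qed

end

section \<open>The random measure, its total mass and its normalisation\<close>

locale crm_setting = levy_setting h \<rho> \<eta> + poisson_measure M N "intensity \<rho> \<eta>"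
  for h :: "'s::polish_space \<Rightarrow> real" and \<rho> :: "'y::polish_space \<Rightarrow> 's measure" and \<eta> :: "'y measure"
    and M :: "'w measure" and N :: "'w \<Rightarrow> ('s \<times> 'y) measure" +
  assumes T_pos_finite: "AE \<omega> in M. 0 < total_mass h (N \<omega>) \<and> total_mass h (N \<omega>) < \<infinity>"
begin

text \<open>Integrating \<open>jump f\<close> against \<open>N \<omega>\<close> is integrating
  \<open>f\<close> against the random measure \<open>crm h (N \<omega>)\<close>; linear functionals
  of the latter thereby become Poisson integrals.\<close>

definition jump :: "('y \<Rightarrow> ennreal) \<Rightarrow> 's \<times> 'y \<Rightarrow> ennreal" where
  "jump f x = ennreal (h (fst x)) * f (snd x)"

lemma measurable_intensity: "measurable (intensity \<rho> \<eta>) X = measurable (borel \<Otimes>\<^sub>M borel) X"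
  by (intro measurable_cong_sets sets_intensity refl)

lemma measurable_jump [measurable]:
  assumes [measurable]: "f \<in> borel_measurable borel"
  shows "jump f \<in> borel_measurable (borel \<Otimes>\<^sub>M borel)"
  unfolding jump_def[abs_def] by measurable

lemma sets_N_borel: "\<omega> \<in> space M \<Longrightarrow> sets (N \<omega>) = sets (borel \<Otimes>\<^sub>M borel)"
  by (simp add: sets_N sets_intensity)

lemma nn_integral_crm:
  assumes \<omega>: "\<omega> \<in> space M" and f [measurable]: "f \<in> borel_measurable borel"
  shows "(\<integral>\<^sup>+y. f y \<partial>crm h (N \<omega>)) = pint (jump f) \<omega>"
proof -
  note [measurable_cong] = sets_N_borel[OF \<omega>]
  show ?thesis
    unfolding crm_def pint_def jump_def
    by (simp add: nn_integral_distr nn_integral_density split_beta)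
qed

lemma emeasure_crm:
  assumes \<omega>: "\<omega> \<in> space M" and A [measurable]: "A \<in> sets borel"
  shows "emeasure (crm h (N \<omega>)) A = pint (jump (indicator A)) \<omega>"
  using nn_integral_crm[OF \<omega>, of "indicator A"] by (simp add: crm_def)

abbreviation mass :: "'w \<Rightarrow> ennreal" where
  "mass \<omega> \<equiv> pint (jump (\<lambda>_. 1)) \<omega>"

lemma total_mass_eq: "\<omega> \<in> space M \<Longrightarrow> total_mass h (N \<omega>) = mass \<omega>"
  using emeasure_crm[of \<omega> UNIV] by (simp add: total_mass_def indicator_def[abs_def])

lemma AE_mass: "AE \<omega> in M. 0 < mass \<omega> \<and> mass \<omega> < \<top>"
  using T_pos_finite AE_space by eventually_elim (simp add: total_mass_eq)

lemma sets_crm [simp, measurable_cong]: "sets (crm h n) = sets borel"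
  by (simp add: crm_def)

lemma sets_nrm [simp, measurable_cong]: "sets (nrm h n) = sets borel"
  by (simp add: nrm_def)

lemma nn_integral_nrm:
  assumes "\<omega> \<in> space M" "f \<in> borel_measurable borel"
  shows "(\<integral>\<^sup>+y. f y \<partial>nrm h (N \<omega>)) = pint (jump f) \<omega> / mass \<omega>"
  unfolding nrm_def using assms
  by (subst nn_integral_scale_measure)
     (auto simp: nn_integral_crm total_mass_eq divide_ennreal_def mult.commute
           cong: measurable_cong_sets)

lemma emeasure_nrm:
  assumes "\<omega> \<in> space M" "A \<in> sets borel"
  shows "emeasure (nrm h (N \<omega>)) A = pint (jump (indicator A)) \<omega> / mass \<omega>"
  using nn_integral_nrm[of \<omega> "indicator A"] assms by simp

lemma measurable_pint_jump [measurable]: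
  "f \<in> borel_measurable borel \<Longrightarrow> pint (jump f) \<in> borel_measurable M"
  by (intro measurable_pint) (simp add: measurable_intensity)

lemma measurable_nrm [measurable]: "(\<lambda>\<omega>. nrm h (N \<omega>)) \<in> M \<rightarrow>\<^sub>M subprob_algebra borel"
proof (rule measurable_subprob_algebra)
  show "subprob_space (nrm h (N \<omega>))" if "\<omega> \<in> space M" for \<omega>
  proof
    show "space (nrm h (N \<omega>)) \<noteq> {}"
      using sets_eq_imp_space_eq[OF sets_nrm, of "N \<omega>"] by simp
    have "mass \<omega> / mass \<omega> \<le> 1"
      by (cases "mass \<omega> = 0 \<or> mass \<omega> = \<top>") (auto simp: ennreal_divide_self less_top)
    then show "emeasure (nrm h (N \<omega>)) (space (nrm h (N \<omega>))) \<le> 1"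
      using emeasure_nrm[OF that, of UNIV] sets_eq_imp_space_eq[OF sets_nrm, of "N \<omega>"]
      by (simp add: indicator_def[abs_def])
  qed
  show "(\<lambda>\<omega>. emeasure (nrm h (N \<omega>)) A) \<in> borel_measurable M" if [measurable]: "A \<in> sets borel" for A
  proof -
    have "(\<lambda>\<omega>. pint (jump (indicator A)) \<omega> / mass \<omega>) \<in> borel_measurable M" by measurable
    then show ?thesis
      by (rule measurable_cong[THEN iffD1, rotated]) (simp add: emeasure_nrm)
  qed
qed simp

lemma AE_prob_nrm: "AE \<omega> in M. prob_space (nrm h (N \<omega>))"
  using AE_mass AE_space
proof eventually_elim
  case (elim \<omega>)
  then have "mass \<omega> / mass \<omega> = 1"
    by (intro ennreal_divide_self) (simp_all add: zero_less_iff_neq_zero)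
  moreover have "emeasure (nrm h (N \<omega>)) UNIV = mass \<omega> / mass \<omega>"
    using emeasure_nrm[OF elim(2), of UNIV] by (simp add: indicator_def[abs_def])
  moreover have "space (nrm h (N \<omega>)) = UNIV"
    using sets_eq_imp_space_eq[OF sets_nrm, of "N \<omega>"] by simp
  ultimately show ?case
    by (intro prob_spaceI) (simp only:)
qed

text \<open>If the Laplace exponent of \<open>f\<close> were infinite, the expectation of
  \<open>eneg (pint f)\<close> would be 0 and \<open>pint f\<close> almost surely infinite. For
  integrals dominated by the total mass this supplies the hypothesis \<open>fin\<close> of the
  moment formulas.\<close>

lemma finite_pint_imp:
  assumes [measurable]: "f \<in> borel_measurable (borel \<Otimes>\<^sub>M borel)"
    and "AE \<omega> in M. pint f \<omega> < \<top>"
  shows "(\<integral>\<^sup>+x. 1 - eneg (f x) \<partial>intensity \<rho> \<eta>) < \<top>"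
proof (rule ccontr)
  have [measurable]: "pint f \<in> borel_measurable M"
    by (rule measurable_pint) (simp add: measurable_intensity)
  assume "\<not> ?thesis"
  then have top: "(\<integral>\<^sup>+x. 1 - eneg (f x) \<partial>intensity \<rho> \<eta>) = \<top>"
    by (simp only: not_less top_unique)
  have "(\<integral>\<^sup>+\<omega>. eneg (pint f \<omega>) \<partial>M) = 0"
    by (subst laplace_functional) (simp_all add: top measurable_intensity)
  then have "AE \<omega> in M. eneg (pint f \<omega>) = 0"
    using nn_integral_0_iff_AE[of "\<lambda>\<omega>. eneg (pint f \<omega>)" M] by simp
  with assms(2) have "AE \<omega> in M. False" by eventually_elim simp
  then show False by simp
qed

end

section \<open>The joint law of the sample\<close>

text \<open>Otherwise \<open>{1..n}\<close> is rewritten to \<open>{Suc 0..n}\<close> and no longer matches \<^const>\<open>sample_space\<close>.\<close>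

declare One_nat_def [simp del]

lemma eneg_divide_Suc:
  assumes "0 \<le> r"
  shows "eneg (ennreal r / of_nat (Suc k)) = ennreal (exp (- (r * inverse (real (Suc k)))))"
proof -
  have "ennreal r / of_nat (Suc k) = ennreal (r * inverse (real (Suc k)))"
    unfolding ennreal_of_nat_eq_real_of_nat using assms
    by (subst divide_ennreal) (auto simp: divide_inverse)
  then show ?thesis using assms by (simp del: of_nat_Suc)
qed

lemma incseq_eneg_divide_Suc: "incseq (\<lambda>k. eneg (b / of_nat (Suc k)))"
proof (cases b)
  case (real r)
  then show ?thesis
    unfolding incseq_def
    by (auto simp: eneg_divide_Suc intro!: ennreal_leI mult_left_mono le_imp_inverse_le
        simp del: of_nat_Suc)
next
  case top
  then show ?thesis by (simp add: incseq_def ennreal_top_divide del: of_nat_Suc)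
qed

lemma SUP_eneg_divide_Suc:
  assumes "b < \<top>"
  shows "(SUP k. eneg (b / of_nat (Suc k))) = 1"
proof -
  obtain r where r: "b = ennreal r" "0 \<le> r"
    using assms by (cases b) auto
  have "(\<lambda>k. exp (- (r * inverse (real (Suc k))))) \<longlonglongrightarrow> exp (- (r * 0))"
    by (intro tendsto_exp tendsto_minus tendsto_mult tendsto_const LIMSEQ_inverse_real_of_nat)
  then have "(\<lambda>k. eneg (b / of_nat (Suc k))) \<longlonglongrightarrow> ennreal (exp (- (r * 0)))"
    unfolding r(1) eneg_divide_Suc[OF r(2)] by (rule tendsto_ennrealI)
  moreover have "(\<lambda>k. eneg (b / of_nat (Suc k))) \<longlonglongrightarrow> (SUP k. eneg (b / of_nat (Suc k)))"
    by (rule LIMSEQ_SUP[OF incseq_eneg_divide_Suc])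
  ultimately show ?thesis using LIMSEQ_unique by force
qed

text \<open>A bound independent of \<open>x\<close>, from \<open>t \<le> exp t\<close> at
  \<open>t = \<delta> * x\<close>; it lets a damping exponential control powers of the total
  mass.\<close>

lemma mult_eneg_le:
  assumes "0 < \<delta>"
  shows "x * eneg (ennreal \<delta> * x) \<le> ennreal (1 / \<delta>)"
proof (cases x)
  case (real r)
  have "1 + \<delta> * r \<le> exp (\<delta> * r)" by (rule exp_ge_add_one_self)
  then have "\<delta> * r \<le> exp (\<delta> * r)" by linarith
  then have "r * exp (- (\<delta> * r)) \<le> 1 / \<delta>"
    using assms by (simp add: exp_minus field_simps)
  then show ?thesis
    using real assms by (simp add: ennreal_mult[symmetric])
qed (use assms in \<open>simp add: ennreal_mult_top\<close>)

text \<open>Inverse of the encoding by \<^const>\<open>ties\<close> and \<^const>\<open>distinct_values\<close> for values \<open>Ys\<close> that differ between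
  blocks; the description is meaningless unless \<open>p\<close> partitions \<open>{1..n}\<close>.\<close>

definition unties :: "nat \<Rightarrow> nat set set \<Rightarrow> (nat set \<Rightarrow> 'y) \<Rightarrow> nat \<Rightarrow> 'y" where
  "unties n p Ys = (\<lambda>i\<in>{1..n}. Ys (THE C. C \<in> p \<and> i \<in> C))"

lemma partition_block:
  assumes "partition_on A p" "C \<in> p" "i \<in> C"
  shows "(THE C. C \<in> p \<and> i \<in> C) = C"
  using assms partition_onD2[OF assms(1)] by (intro the_equality) (auto simp: disjoint_def)

lemma unties_block:
  assumes "partition_on {1..n} p" "C \<in> p" "i \<in> C"
  shows "unties n p Ys i = Ys C"
proof -
  have "i \<in> {1..n}" using assms partition_onD1[OF assms(1)] by auto
  then show ?thesis by (simp only: unties_def restrict_apply if_True partition_block[OF assms])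
qed

lemma measurable_unties:
  assumes p: "partition_on {1..n} p"
  shows "unties n p \<in> PiM p (\<lambda>_. X) \<rightarrow>\<^sub>M PiM {1..n} (\<lambda>_. X)"
  unfolding unties_def[abs_def]
proof (rule measurable_restrict)
  fix i assume "i \<in> {1..n}"
  then obtain C where "C \<in> p" "i \<in> C" using partition_onD1[OF p] by auto
  then show "(\<lambda>Ys. Ys (THE C. C \<in> p \<and> i \<in> C)) \<in> PiM p (\<lambda>_. X) \<rightarrow>\<^sub>M X"
    using partition_block[OF p] by simp
qed

lemma prod_partition_on:
  assumes "partition_on A p" "finite A"
  shows "(\<Prod>i\<in>A. f i) = (\<Prod>C\<in>p. \<Prod>i\<in>C. f i)"
proof -
  have "(\<Prod>i\<in>\<Union>p. f i) = (\<Prod>C\<in>p. \<Prod>i\<in>C. f i)"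
    using partition_onD1[OF assms(1)] partition_onD2[OF assms(1)] assms(2)
    by (subst prod.Union_disjoint) (auto simp: disjoint_def intro: finite_subset)
  then show ?thesis using partition_onD1[OF assms(1)] by simp
qed

context levy_setting
begin

definition kfun :: "nat \<Rightarrow> ('y \<Rightarrow> ennreal) \<Rightarrow> 'y \<Rightarrow> ennreal" where
  "kfun m w y = (\<integral>\<^sup>+s. ennreal (h s) ^ m * eneg (ennreal (h s) * w y) \<partial>\<rho> y)"

lemma measurable_kfun [measurable]:
  assumes [measurable]: "w \<in> borel_measurable borel"
  shows "kfun m w \<in> borel_measurable borel"
  unfolding kfun_def[abs_def] by measurable

lemma product_eta: "product_sigma_finite (\<lambda>_. \<eta>)"
  using sigma_finite_eta by (simp add: product_sigma_finite_def)

lemma sets_PiM_eta [measurable_cong]: "sets (PiM p (\<lambda>_. \<eta>)) = sets (PiM p (\<lambda>_. borel))"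
  by (intro sets_PiM_cong refl sets_eta)

lemma measurable_unties_eta [measurable]:
  "partition_on {1..n} p \<Longrightarrow> unties n p \<in> PiM p (\<lambda>_. \<eta>) \<rightarrow>\<^sub>M sample_space n"
  using measurable_unties[of n p borel] measurable_cong_sets[OF sets_PiM_eta refl] by blast

end

section \<open>The Mecke formula for powers of the random measure\<close>

context crm_setting
begin

lemma measurable_PiM_nrm [measurable]:
  "(\<lambda>\<omega>. PiM {1..n} (\<lambda>_. nrm h (N \<omega>))) \<in> M \<rightarrow>\<^sub>M subprob_algebra (sample_space n)"
  by (rule measurable_compose[OF measurable_nrm measurable_PiM_subprob]) simp

text \<open>The power of \<open>mass\<close> undoes the normalisation coordinate by coordinate,
  which is possible where \<open>0 < mass < \<top>\<close>, hence almost surely.\<close>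

lemma AE_box:
  assumes B: "\<And>i. i \<in> {1..n} \<Longrightarrow> B i \<in> sets borel"
  shows "AE \<omega> in M. mass \<omega> ^ n * emeasure (PiM {1..n} (\<lambda>_. nrm h (N \<omega>))) (Pi\<^sub>E {1..n} B)
    = (\<Prod>i\<in>{1..n}. pint (jump (indicator (B i))) \<omega>)"
  using AE_mass AE_prob_nrm AE_space
proof eventually_elim
  case (elim \<omega>)
  interpret P: prob_space "nrm h (N \<omega>)" by (rule elim)
  interpret product_sigma_finite "\<lambda>_. nrm h (N \<omega>)" by standard
  have "emeasure (PiM {1..n} (\<lambda>_. nrm h (N \<omega>))) (Pi\<^sub>E {1..n} B) = (\<Prod>i\<in>{1..n}. emeasure (nrm h (N \<omega>)) (B i))"
    using B by (intro emeasure_PiM) auto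
  also have "\<dots> = (\<Prod>i\<in>{1..n}. pint (jump (indicator (B i))) \<omega> / mass \<omega>)"
    using B elim(3) by (intro prod.cong refl emeasure_nrm) auto
  finally have e: "emeasure (PiM {1..n} (\<lambda>_. nrm h (N \<omega>))) (Pi\<^sub>E {1..n} B) = \<dots>" .
  have "mass \<omega> ^ n = (\<Prod>i\<in>{1..n}. mass \<omega>)" by simp
  then have "mass \<omega> ^ n * emeasure (PiM {1..n} (\<lambda>_. nrm h (N \<omega>))) (Pi\<^sub>E {1..n} B)
      = (\<Prod>i\<in>{1..n}. mass \<omega> * (pint (jump (indicator (B i))) \<omega> / mass \<omega>))"
    unfolding e by (simp only: prod.distrib)
  also have "\<dots> = (\<Prod>i\<in>{1..n}. pint (jump (indicator (B i))) \<omega>)"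
  proof (intro prod.cong refl)
    fix i
    have "mass \<omega> / mass \<omega> = 1"
      using elim(1) by (intro ennreal_divide_self) (simp_all add: zero_less_iff_neq_zero)
    then show "mass \<omega> * (pint (jump (indicator (B i))) \<omega> / mass \<omega>) = pint (jump (indicator (B i))) \<omega>"
      by (simp add: divide_ennreal_def mult.left_commute[of "mass \<omega>"])
  qed
  finally show ?case .
qed

text \<open>In \<open>product_moment\<close> all indices of a block \<open>C\<close> share one atom,
  which contributes \<open>h\<close> to the power \<open>card C\<close> and must lie in every
  \<open>B i\<close> with \<open>i\<close> in \<open>C\<close>. The product over the blocks is one
  integral over a product space, where \<open>unties\<close> spreads the block values over the
  indices.\<close>

lemma multivariate_mecke_box:
  assumes w [measurable]: "w \<in> borel_measurable borel"
    and B: "\<And>i. i \<in> {1..n} \<Longrightarrow> B i \<in> sets borel"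
  shows "(\<integral>\<^sup>+\<omega>. mass \<omega> ^ n * emeasure (PiM {1..n} (\<lambda>_. nrm h (N \<omega>))) (Pi\<^sub>E {1..n} B) * eneg (pint (jump w) \<omega>) \<partial>M)
    = (\<Sum>p | partition_on {1..n} p. \<integral>\<^sup>+Ys. (\<Prod>C\<in>p. kfun (card C) w (Ys C)) * indicator (Pi\<^sub>E {1..n} B) (unties n p Ys) \<partial>PiM p (\<lambda>_. \<eta>))
      * (\<integral>\<^sup>+\<omega>. eneg (pint (jump w) \<omega>) \<partial>M)"
proof -
  \<comment> \<open>\<open>product_moment\<close> speaks of a factor at every natural number;
    outside \<open>{1..n}\<close> the empty set is substituted.\<close>
  define D where "D i = (if i \<in> {1..n} then B i else {})" for i
  define F where "F i = jump (indicator (D i))" for i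
  have [measurable]: "D i \<in> sets borel" for i using B by (simp add: D_def)
  have [measurable]: "F i \<in> borel_measurable (borel \<Otimes>\<^sub>M borel)" for i unfolding F_def by measurable
  have "(\<integral>\<^sup>+\<omega>. mass \<omega> ^ n * emeasure (PiM {1..n} (\<lambda>_. nrm h (N \<omega>))) (Pi\<^sub>E {1..n} B) * eneg (pint (jump w) \<omega>) \<partial>M)
      = (\<integral>\<^sup>+\<omega>. (\<Prod>i\<in>{1..n}. pint (F i) \<omega>) * eneg (pint (jump w) \<omega>) \<partial>M)"
  proof (rule nn_integral_cong_AE)
    have "AE \<omega> in M. mass \<omega> ^ n * emeasure (PiM {1..n} (\<lambda>_. nrm h (N \<omega>))) (Pi\<^sub>E {1..n} B)
        = (\<Prod>i\<in>{1..n}. pint (jump (indicator (B i))) \<omega>)"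
      using B by (rule AE_box)
    then show "AE \<omega> in M. mass \<omega> ^ n * emeasure (PiM {1..n} (\<lambda>_. nrm h (N \<omega>))) (Pi\<^sub>E {1..n} B) * eneg (pint (jump w) \<omega>)
        = (\<Prod>i\<in>{1..n}. pint (F i) \<omega>) * eneg (pint (jump w) \<omega>)"
      by eventually_elim (simp add: F_def D_def)
  qed
  also have "\<dots> = (\<Sum>p | partition_on {1..n} p. \<Prod>C\<in>p. \<integral>\<^sup>+x. (\<Prod>i\<in>C. F i x) * eneg (jump w x) \<partial>intensity \<rho> \<eta>)
      * (\<integral>\<^sup>+\<omega>. eneg (pint (jump w) \<omega>) \<partial>M)"
  proof (rule product_moment)
    show "(\<integral>\<^sup>+x. 1 - eneg (F i x) \<partial>intensity \<rho> \<eta>) < \<infinity>" for i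
    proof -
      have "AE \<omega> in M. pint (F i) \<omega> < \<top>"
        using AE_mass
      proof eventually_elim
        case (elim \<omega>)
        have "pint (F i) \<omega> \<le> mass \<omega>"
          unfolding F_def by (intro pint_mono) (auto simp: jump_def indicator_def)
        then show ?case using elim by (auto intro: le_less_trans)
      qed
      then show ?thesis using finite_pint_imp[of "F i"] by simp
    qed
  qed (simp_all add: measurable_intensity)
  also have "(\<Sum>p | partition_on {1..n} p. \<Prod>C\<in>p. \<integral>\<^sup>+x. (\<Prod>i\<in>C. F i x) * eneg (jump w x) \<partial>intensity \<rho> \<eta>)
      = (\<Sum>p | partition_on {1..n} p. \<integral>\<^sup>+Ys. (\<Prod>C\<in>p. kfun (card C) w (Ys C)) * indicator (Pi\<^sub>E {1..n} B) (unties n p Ys) \<partial>PiM p (\<lambda>_. \<eta>))"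
  proof (intro sum.cong refl)
    fix p assume "p \<in> {p. partition_on {1..n} p}"
    then have p: "partition_on {1..n} p" by simp
    have fin: "finite p" using finite_elements[OF _ p] by simp
    have int: "(\<integral>\<^sup>+x. (\<Prod>i\<in>C. F i x) * eneg (jump w x) \<partial>intensity \<rho> \<eta>)
        = (\<integral>\<^sup>+y. kfun (card C) w y * (\<Prod>i\<in>C. indicator (D i) y) \<partial>\<eta>)" for C
    proof (subst nn_integral_intensity)
      show "(\<lambda>x. (\<Prod>i\<in>C. F i x) * eneg (jump w x)) \<in> borel_measurable (borel \<Otimes>\<^sub>M borel)" by measurable
      show "(\<integral>\<^sup>+y. \<integral>\<^sup>+s. (\<Prod>i\<in>C. F i (s, y)) * eneg (jump w (s, y)) \<partial>\<rho> y \<partial>\<eta>)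
          = (\<integral>\<^sup>+y. kfun (card C) w y * (\<Prod>i\<in>C. indicator (D i) y) \<partial>\<eta>)"
      proof (intro nn_integral_cong)
        fix y
        have "(\<integral>\<^sup>+s. (\<Prod>i\<in>C. F i (s, y)) * eneg (jump w (s, y)) \<partial>\<rho> y)
            = (\<integral>\<^sup>+s. (ennreal (h s) ^ card C * eneg (ennreal (h s) * w y)) * (\<Prod>i\<in>C. indicator (D i) y) \<partial>\<rho> y)"
          by (intro nn_integral_cong) (simp add: F_def jump_def prod.distrib ac_simps)
        also have "\<dots> = kfun (card C) w y * (\<Prod>i\<in>C. indicator (D i) y)"
          unfolding kfun_def by (rule nn_integral_multc) measurable
        finally show "(\<integral>\<^sup>+s. (\<Prod>i\<in>C. F i (s, y)) * eneg (jump w (s, y)) \<partial>\<rho> y)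
            = kfun (card C) w y * (\<Prod>i\<in>C. indicator (D i) y)" .
      qed
    qed
    have "(\<Prod>C\<in>p. \<integral>\<^sup>+x. (\<Prod>i\<in>C. F i x) * eneg (jump w x) \<partial>intensity \<rho> \<eta>)
        = (\<Prod>C\<in>p. \<integral>\<^sup>+y. kfun (card C) w y * (\<Prod>i\<in>C. indicator (D i) y) \<partial>\<eta>)"
      by (simp add: int)
    also have "\<dots> = (\<integral>\<^sup>+Ys. (\<Prod>C\<in>p. kfun (card C) w (Ys C) * (\<Prod>i\<in>C. indicator (D i) (Ys C))) \<partial>PiM p (\<lambda>_. \<eta>))"
      by (subst product_sigma_finite.product_nn_integral_prod[OF product_eta fin]) auto
    also have "\<dots> = (\<integral>\<^sup>+Ys. (\<Prod>C\<in>p. kfun (card C) w (Ys C)) * indicator (Pi\<^sub>E {1..n} B) (unties n p Ys) \<partial>PiM p (\<lambda>_. \<eta>))"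
    proof (intro nn_integral_cong)
      fix Ys
      have "indicator (Pi\<^sub>E {1..n} B) (unties n p Ys) = (\<Prod>i\<in>{1..n}. indicator (D i) (unties n p Ys i) :: ennreal)"
      proof (cases "unties n p Ys \<in> Pi\<^sub>E {1..n} B")
        case True
        then have "indicator (D i) (unties n p Ys i) = (1::ennreal)" if "i \<in> {1..n}" for i
          using that by (simp add: D_def PiE_mem)
        with True show ?thesis by simp
      next
        case False
        then obtain i where "i \<in> {1..n}" "unties n p Ys i \<notin> B i"
          by (auto simp: PiE_iff unties_def)
        then have "(\<Prod>i\<in>{1..n}. indicator (D i) (unties n p Ys i)) = (0::ennreal)"
          by (intro prod_zero bexI[of _ i]) (auto simp: D_def)
        with False show ?thesis by simp
      qed
      also have "\<dots> = (\<Prod>C\<in>p. \<Prod>i\<in>C. indicator (D i) (Ys C))"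
        unfolding prod_partition_on[OF p finite_atLeastAtMost]
        by (intro prod.cong refl) (simp add: unties_block[OF p])
      finally show "(\<Prod>C\<in>p. kfun (card C) w (Ys C) * (\<Prod>i\<in>C. indicator (D i) (Ys C)))
          = (\<Prod>C\<in>p. kfun (card C) w (Ys C)) * indicator (Pi\<^sub>E {1..n} B) (unties n p Ys)"
        by (simp add: prod.distrib)
    qed
    finally show "(\<Prod>C\<in>p. \<integral>\<^sup>+x. (\<Prod>i\<in>C. F i x) * eneg (jump w x) \<partial>intensity \<rho> \<eta>)
        = (\<integral>\<^sup>+Ys. (\<Prod>C\<in>p. kfun (card C) w (Ys C)) * indicator (Pi\<^sub>E {1..n} B) (unties n p Ys) \<partial>PiM p (\<lambda>_. \<eta>))" .
  qed
  finally show ?thesis .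
qed

text \<open>The lower bound on \<open>w\<close> makes both sides finite measures in \<open>B\<close>, so that it suffices to
  compare them on boxes.\<close>

lemma multivariate_mecke_bounded_below:
  assumes w [measurable]: "w \<in> borel_measurable borel"
    and \<delta>: "0 < \<delta>" and lower: "\<And>y. of_nat n * ennreal \<delta> \<le> w y"
    and B [measurable]: "B \<in> sets (sample_space n)"
  shows "(\<integral>\<^sup>+\<omega>. mass \<omega> ^ n * emeasure (PiM {1..n} (\<lambda>_. nrm h (N \<omega>))) B * eneg (pint (jump w) \<omega>) \<partial>M)
    = (\<Sum>p | partition_on {1..n} p. \<integral>\<^sup>+Ys. (\<Prod>C\<in>p. kfun (card C) w (Ys C)) * indicator B (unties n p Ys) \<partial>PiM p (\<lambda>_. \<eta>))
      * (\<integral>\<^sup>+\<omega>. eneg (pint (jump w) \<omega>) \<partial>M)"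
proof -
  define L where "L = (\<integral>\<^sup>+\<omega>. eneg (pint (jump w) \<omega>) \<partial>M)"
  define PN where "PN \<omega> = PiM {1..n} (\<lambda>_. nrm h (N \<omega>))" for \<omega>
  define parts where "parts = {p. partition_on {1..n} p}"
  define \<alpha> where "\<alpha> = density M (\<lambda>\<omega>. mass \<omega> ^ n * eneg (pint (jump w) \<omega>)) \<bind> PN"
  define Q where "Q p = distr (density (PiM p (\<lambda>_. \<eta>)) (\<lambda>Ys. (\<Prod>C\<in>p. kfun (card C) w (Ys C)) * L))
      (sample_space n) (unties n p)" for p
  have finparts: "finite parts" unfolding parts_def by (intro finitely_many_partition_on) simp
  have PN [measurable]: "PN \<in> M \<rightarrow>\<^sub>M subprob_algebra (sample_space n)"
    unfolding PN_def[abs_def] by measurable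
  have PN': "PN \<in> density M (\<lambda>\<omega>. mass \<omega> ^ n * eneg (pint (jump w) \<omega>)) \<rightarrow>\<^sub>M subprob_algebra (sample_space n)"
    by measurable
  have sets_\<alpha>: "sets \<alpha> = sets (sample_space n)"
    unfolding \<alpha>_def using PN' not_empty by (intro sets_bind_measurable) auto
  have em_\<alpha>: "emeasure \<alpha> A = (\<integral>\<^sup>+\<omega>. mass \<omega> ^ n * emeasure (PN \<omega>) A * eneg (pint (jump w) \<omega>) \<partial>M)"
    if [measurable]: "A \<in> sets (sample_space n)" for A
  proof -
    have "emeasure \<alpha> A = (\<integral>\<^sup>+\<omega>. emeasure (PN \<omega>) A \<partial>density M (\<lambda>\<omega>. mass \<omega> ^ n * eneg (pint (jump w) \<omega>)))"
      unfolding \<alpha>_def using not_empty by (intro emeasure_bind[OF _ PN']) auto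
    also have "\<dots> = (\<integral>\<^sup>+\<omega>. mass \<omega> ^ n * eneg (pint (jump w) \<omega>) * emeasure (PN \<omega>) A \<partial>M)"
      by (intro nn_integral_density) measurable
    finally show ?thesis by (simp add: ac_simps)
  qed
  have em_Q: "emeasure (Q p) A
      = (\<integral>\<^sup>+Ys. (\<Prod>C\<in>p. kfun (card C) w (Ys C)) * indicator A (unties n p Ys) \<partial>PiM p (\<lambda>_. \<eta>)) * L"
    if p: "p \<in> parts" and [measurable]: "A \<in> sets (sample_space n)" for p A
  proof -
    have [measurable]: "unties n p \<in> PiM p (\<lambda>_. \<eta>) \<rightarrow>\<^sub>M sample_space n"
      using p by (simp add: parts_def measurable_unties_eta)
    have km [measurable]: "(\<lambda>Ys. \<Prod>C\<in>p. kfun (card C) w (Ys C)) \<in> borel_measurable (PiM p (\<lambda>_. \<eta>))"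
      by measurable
    have "emeasure (Q p) A = (\<integral>\<^sup>+Ys. indicator A Ys \<partial>Q p)"
      by (simp add: Q_def)
    also have "\<dots> = (\<integral>\<^sup>+Ys. indicator A (unties n p Ys) \<partial>density (PiM p (\<lambda>_. \<eta>)) (\<lambda>Ys. (\<Prod>C\<in>p. kfun (card C) w (Ys C)) * L))"
      unfolding Q_def by (rule nn_integral_distr) measurable
    also have "\<dots> = (\<integral>\<^sup>+Ys. (\<Prod>C\<in>p. kfun (card C) w (Ys C)) * L * indicator A (unties n p Ys) \<partial>PiM p (\<lambda>_. \<eta>))"
      by (rule nn_integral_density) measurable
    also have "\<dots> = (\<integral>\<^sup>+Ys. (\<Prod>C\<in>p. kfun (card C) w (Ys C)) * indicator A (unties n p Ys) \<partial>PiM p (\<lambda>_. \<eta>)) * L"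
      by (subst nn_integral_multc[symmetric]) (simp_all add: ac_simps)
    finally show ?thesis .
  qed
  obtain R where R: "sets R = sets (sample_space n)"
    "\<And>A. A \<in> sets (sample_space n) \<Longrightarrow> emeasure R A = (\<Sum>p\<in>parts. emeasure (Q p) A)"
    using ex_sum_of_measures[OF finparts, of Q "sample_space n"] by (auto simp: Q_def)
  have "\<alpha> = R"
  proof (rule measure_eqI_PiM_finite[OF _ sets_\<alpha> R(1)])
    fix A :: "nat \<Rightarrow> 'y set" assume A: "\<And>i. i \<in> {1..n} \<Longrightarrow> A i \<in> sets borel"
    then have [measurable]: "Pi\<^sub>E {1..n} A \<in> sets (sample_space n)" by (intro sets_PiM_I_finite) auto
    show "emeasure \<alpha> (Pi\<^sub>E {1..n} A) = emeasure R (Pi\<^sub>E {1..n} A)"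
      using multivariate_mecke_box[OF w, of n A] A
      by (simp add: em_\<alpha> R(2) em_Q PN_def L_def parts_def sum_distrib_right)
  next
    show "range (\<lambda>_::nat. space (sample_space n)) \<subseteq> prod_algebra {1..n} (\<lambda>_. borel)"
      unfolding space_PiM by (intro image_subsetI prod_algebraI_finite) auto
    have "emeasure \<alpha> (space (sample_space n)) \<le> (\<integral>\<^sup>+\<omega>. ennreal (1 / \<delta>) ^ n \<partial>M)"
    proof (subst em_\<alpha>, simp, rule nn_integral_mono)
      fix \<omega> assume \<omega>: "\<omega> \<in> space M"
      have "emeasure (PN \<omega>) (space (sample_space n)) \<le> 1"
        using measurable_space[OF PN \<omega>]
        by (auto simp: space_subprob_algebra intro: subprob_space.subprob_emeasure_le_1)
      \<comment> \<open>The lower bound on \<open>w\<close> is \<open>n\<close> times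
        \<open>\<delta>\<close>, so each of the \<open>n\<close> factors of \<open>mass\<close>
        receives its own damping factor.\<close>
      moreover have "eneg (pint (jump w) \<omega>) \<le> eneg (ennreal \<delta> * mass \<omega>) ^ n"
      proof -
        have "of_nat n * (ennreal \<delta> * mass \<omega>) = pint (\<lambda>x. of_nat n * ennreal \<delta> * jump (\<lambda>_. 1) x) \<omega>"
          using \<omega> by (subst pint_cmult) (simp_all add: measurable_intensity mult.assoc)
        also have "\<dots> \<le> pint (jump w) \<omega>"
        proof (rule pint_mono)
          fix x
          have "of_nat n * ennreal \<delta> * ennreal (h (fst x)) \<le> w (snd x) * ennreal (h (fst x))"
            by (intro mult_right_mono lower) simp
          then show "of_nat n * ennreal \<delta> * jump (\<lambda>_. 1) x \<le> jump w x"
            by (simp add: jump_def mult.commute)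
        qed
        finally show ?thesis
          by (simp add: eneg_of_nat_mult[symmetric] eneg_antimono)
      qed
      ultimately have "mass \<omega> ^ n * emeasure (PN \<omega>) (space (sample_space n)) * eneg (pint (jump w) \<omega>)
          \<le> mass \<omega> ^ n * 1 * eneg (ennreal \<delta> * mass \<omega>) ^ n"
        by (intro mult_mono) auto
      also have "\<dots> = (mass \<omega> * eneg (ennreal \<delta> * mass \<omega>)) ^ n"
        by (simp add: power_mult_distrib)
      also have "\<dots> \<le> ennreal (1 / \<delta>) ^ n"
        by (intro power_mono mult_eneg_le \<delta>) simp
      finally show "mass \<omega> ^ n * emeasure (PN \<omega>) (space (sample_space n)) * eneg (pint (jump w) \<omega>)
          \<le> ennreal (1 / \<delta>) ^ n" .
    qed
    also have "\<dots> < \<top>" by (simp add: emeasure_space_1 power_less_top_ennreal)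
    finally show "emeasure \<alpha> (space (sample_space n)) \<noteq> \<infinity>" by simp
  qed auto
  then show ?thesis
    using R(2)[OF B] em_\<alpha>[OF B]
    by (simp add: em_Q B PN_def L_def parts_def sum_distrib_right)
qed


lemma pint_jump_add:
  "f \<in> borel_measurable borel \<Longrightarrow> g \<in> borel_measurable borel \<Longrightarrow> \<omega> \<in> space M
    \<Longrightarrow> pint (jump (\<lambda>y. f y + g y)) \<omega> = pint (jump f) \<omega> + pint (jump g) \<omega>"
  using pint_add[of "jump f" "jump g" \<omega>]
  by (simp add: measurable_intensity jump_def[abs_def] distrib_left)

lemma pint_jump_cmult:
  "f \<in> borel_measurable borel \<Longrightarrow> \<omega> \<in> space M
    \<Longrightarrow> pint (jump (\<lambda>y. c * f y)) \<omega> = c * pint (jump f) \<omega>"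
  using pint_cmult[of "jump f" \<omega> c]
  by (simp add: measurable_intensity jump_def[abs_def] mult.left_commute)

text \<open>The bound is removed by applying the previous lemma to \<open>w + n / k\<close> and letting \<open>k\<close> tend to infinity.\<close>

theorem multivariate_mecke:
  assumes w [measurable]: "w \<in> borel_measurable borel" and B [measurable]: "B \<in> sets (sample_space n)"
  shows "(\<integral>\<^sup>+\<omega>. mass \<omega> ^ n * emeasure (PiM {1..n} (\<lambda>_. nrm h (N \<omega>))) B * eneg (pint (jump w) \<omega>) \<partial>M)
    = (\<Sum>p | partition_on {1..n} p. \<integral>\<^sup>+Ys. (\<Prod>C\<in>p. kfun (card C) w (Ys C)) * indicator B (unties n p Ys) \<partial>PiM p (\<lambda>_. \<eta>))
      * (\<integral>\<^sup>+\<omega>. eneg (pint (jump w) \<omega>) \<partial>M)"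
proof -
  define parts where "parts = {p. partition_on {1..n} p}"
  \<comment> \<open>The shift is \<open>n * (1 / (k + 1))\<close>, so that the bounded-below version
    applies with \<open>1 / (k + 1)\<close> in the role of its \<open>\<delta>\<close>.\<close>
  define \<delta> :: "nat \<Rightarrow> ennreal" where "\<delta> k = of_nat n / of_nat (Suc k)" for k
  define wk where "wk k y = w y + \<delta> k" for k y
  define L where "L k = (\<integral>\<^sup>+\<omega>. eneg (pint (jump (wk k)) \<omega>) \<partial>M)" for k
  define H where "H \<omega> = mass \<omega> ^ n * emeasure (PiM {1..n} (\<lambda>_. nrm h (N \<omega>))) B" for \<omega>
  define G where "G k p Ys = (\<Prod>C\<in>p. kfun (card C) (wk k) (Ys C)) * indicator B (unties n p Ys)" for k p Ys
  have [measurable]: "(\<lambda>\<omega>. emeasure (PiM {1..n} (\<lambda>_. nrm h (N \<omega>))) B) \<in> borel_measurable M"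
    by (rule measurable_compose[OF measurable_PiM_nrm measurable_emeasure_subprob_algebra[OF B]])
  have [measurable]: "H \<in> borel_measurable M" unfolding H_def[abs_def] by measurable
  have wk_meas [measurable]: "wk k \<in> borel_measurable borel" for k unfolding wk_def[abs_def] by measurable
  have Gm: "G k p \<in> borel_measurable (PiM p (\<lambda>_. \<eta>))" if "p \<in> parts" for k p
  proof -
    have [measurable]: "unties n p \<in> PiM p (\<lambda>_. \<eta>) \<rightarrow>\<^sub>M sample_space n"
      using that by (simp add: parts_def measurable_unties_eta)
    show ?thesis unfolding G_def[abs_def] by measurable
  qed
  have scale: "a * \<delta> k = (of_nat n * a) / of_nat (Suc k)" for a k
    by (simp add: \<delta>_def divide_ennreal_def ac_simps)
  have kk: "incseq (\<lambda>k. kfun m (wk k) y)" "(SUP k. kfun m (wk k) y) = kfun m w y" for m y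
  proof -
    define f where "f k s = ennreal (h s) ^ m * eneg (ennreal (h s) * w y)
      * eneg ((of_nat n * ennreal (h s)) / of_nat (Suc k))" for k s
    have kf: "kfun m (wk k) y = (\<integral>\<^sup>+s. f k s \<partial>\<rho> y)" for k
      unfolding kfun_def f_def wk_def by (simp add: distrib_left eneg_add scale mult.assoc)
    have [measurable]: "f k \<in> borel_measurable borel" for k unfolding f_def[abs_def] by measurable
    have inc: "incseq (\<lambda>k. f k s)" for s
      unfolding f_def by (intro incseq_mult_ennreal incseq_eneg_divide_Suc) (simp_all add: incseq_def)
    then have inc': "incseq f" by (auto simp: incseq_def le_fun_def)
    show "incseq (\<lambda>k. kfun m (wk k) y)"
      unfolding kf using inc by (auto simp: incseq_def intro!: nn_integral_mono)
    have "(SUP k. kfun m (wk k) y) = (\<integral>\<^sup>+s. (SUP k. f k s) \<partial>\<rho> y)"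
      unfolding kf using inc' by (intro nn_integral_monotone_convergence_SUP[symmetric]) auto
    also have "\<dots> = kfun m w y"
      unfolding kfun_def f_def
      by (simp add: SUP_mult_left_ennreal[symmetric] SUP_eneg_divide_Suc ennreal_mult_less_top of_nat_less_top
          del: of_nat_Suc)
    finally show "(SUP k. kfun m (wk k) y) = kfun m w y" .
  qed
  have Gk: "incseq (\<lambda>k. G k p Ys)"
      "(SUP k. G k p Ys) = (\<Prod>C\<in>p. kfun (card C) w (Ys C)) * indicator B (unties n p Ys)"
    if "p \<in> parts" for p Ys
  proof -
    have fin: "finite p" using that by (auto simp: parts_def intro: finite_elements[of "{1..n}"])
    show "incseq (\<lambda>k. G k p Ys)"
      unfolding G_def by (intro incseq_mult_ennreal incseq_prod_ennreal kk) (simp add: incseq_def)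
    show "(SUP k. G k p Ys) = (\<Prod>C\<in>p. kfun (card C) w (Ys C)) * indicator B (unties n p Ys)"
      unfolding G_def by (simp add: SUP_mult_right_ennreal[symmetric] SUP_prod_incseq fin kk)
  qed
  have split: "eneg (pint (jump (wk k)) \<omega>) = eneg (pint (jump w) \<omega>) * eneg ((of_nat n * mass \<omega>) / of_nat (Suc k))"
    if "\<omega> \<in> space M" for k \<omega>
  proof -
    have "pint (jump (wk k)) \<omega> = pint (jump w) \<omega> + pint (jump (\<lambda>y. \<delta> k * 1)) \<omega>"
      unfolding wk_def[abs_def] using that by (subst pint_jump_add) simp_all
    also have "pint (jump (\<lambda>y. \<delta> k * 1)) \<omega> = mass \<omega> * \<delta> k"
      using that by (subst pint_jump_cmult) (simp_all add: mult.commute)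
    finally show ?thesis by (simp add: eneg_add scale)
  qed
  have limit: "(SUP k. \<integral>\<^sup>+\<omega>. X \<omega> * eneg (pint (jump (wk k)) \<omega>) \<partial>M) = (\<integral>\<^sup>+\<omega>. X \<omega> * eneg (pint (jump w) \<omega>) \<partial>M)"
    and limit_inc: "incseq (\<lambda>k. \<integral>\<^sup>+\<omega>. X \<omega> * eneg (pint (jump (wk k)) \<omega>) \<partial>M)"
    if [measurable]: "X \<in> borel_measurable M" for X
  proof -
    define f where "f k \<omega> = X \<omega> * eneg (pint (jump w) \<omega>) * eneg ((of_nat n * mass \<omega>) / of_nat (Suc k))" for k \<omega>
    have [measurable]: "f k \<in> borel_measurable M" for k unfolding f_def[abs_def] by measurable
    have inc: "incseq (\<lambda>k. f k \<omega>)" for \<omega>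
      unfolding f_def by (intro incseq_mult_ennreal incseq_eneg_divide_Suc) (simp_all add: incseq_def)
    then have inc': "incseq f" by (auto simp: incseq_def le_fun_def)
    have e: "(\<integral>\<^sup>+\<omega>. X \<omega> * eneg (pint (jump (wk k)) \<omega>) \<partial>M) = (\<integral>\<^sup>+\<omega>. f k \<omega> \<partial>M)" for k
      by (intro nn_integral_cong) (simp add: split f_def mult.assoc)
    show "incseq (\<lambda>k. \<integral>\<^sup>+\<omega>. X \<omega> * eneg (pint (jump (wk k)) \<omega>) \<partial>M)"
      unfolding e using inc by (auto simp: incseq_def intro!: nn_integral_mono)
    have "(SUP k. \<integral>\<^sup>+\<omega>. X \<omega> * eneg (pint (jump (wk k)) \<omega>) \<partial>M) = (\<integral>\<^sup>+\<omega>. (SUP k. f k \<omega>) \<partial>M)"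
      unfolding e using inc' by (intro nn_integral_monotone_convergence_SUP[symmetric]) auto
    also have "\<dots> = (\<integral>\<^sup>+\<omega>. X \<omega> * eneg (pint (jump w) \<omega>) \<partial>M)"
    proof (rule nn_integral_cong_AE)
      \<comment> \<open>The factors \<open>exp (- n T / (k + 1))\<close> increase to 1 because
        \<open>T\<close> is almost surely finite.\<close>
      show "AE \<omega> in M. (SUP k. f k \<omega>) = X \<omega> * eneg (pint (jump w) \<omega>)"
        using AE_mass
      proof eventually_elim
        case (elim \<omega>)
        then have "of_nat n * mass \<omega> < \<top>"
          by (simp add: ennreal_mult_less_top of_nat_less_top)
        then show ?case
          unfolding f_def by (simp add: SUP_mult_left_ennreal[symmetric] SUP_eneg_divide_Suc del: of_nat_Suc)
      qed
    qed
    finally show "(SUP k. \<integral>\<^sup>+\<omega>. X \<omega> * eneg (pint (jump (wk k)) \<omega>) \<partial>M)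
        = (\<integral>\<^sup>+\<omega>. X \<omega> * eneg (pint (jump w) \<omega>) \<partial>M)" .
  qed
  have step: "(\<integral>\<^sup>+\<omega>. H \<omega> * eneg (pint (jump (wk k)) \<omega>) \<partial>M) = (\<Sum>p\<in>parts. \<integral>\<^sup>+Ys. G k p Ys \<partial>PiM p (\<lambda>_. \<eta>)) * L k" for k
    unfolding H_def G_def parts_def L_def
  proof (rule multivariate_mecke_bounded_below[OF wk_meas _ _ B])
    show "0 < 1 / real (Suc k)" by simp
    have "ennreal (1 / real (Suc k)) = inverse (of_nat (Suc k))"
      by (simp add: ennreal_of_nat_eq_real_of_nat inverse_ennreal inverse_eq_divide del: of_nat_Suc)
    then show "of_nat n * ennreal (1 / real (Suc k)) \<le> wk k y" for y
      by (simp add: wk_def \<delta>_def divide_ennreal_def del: of_nat_Suc)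
  qed
  have incS: "incseq (\<lambda>k. \<integral>\<^sup>+Ys. G k p Ys \<partial>PiM p (\<lambda>_. \<eta>))" if "p \<in> parts" for p
    using Gk(1)[OF that] by (auto simp: incseq_def intro!: nn_integral_mono)
  have supS: "(SUP k. \<integral>\<^sup>+Ys. G k p Ys \<partial>PiM p (\<lambda>_. \<eta>))
      = (\<integral>\<^sup>+Ys. (\<Prod>C\<in>p. kfun (card C) w (Ys C)) * indicator B (unties n p Ys) \<partial>PiM p (\<lambda>_. \<eta>))"
    if "p \<in> parts" for p
  proof -
    have "incseq (\<lambda>k. G k p)" using Gk(1)[OF that] by (auto simp: incseq_def le_fun_def)
    then have "(SUP k. \<integral>\<^sup>+Ys. G k p Ys \<partial>PiM p (\<lambda>_. \<eta>)) = (\<integral>\<^sup>+Ys. (SUP k. G k p Ys) \<partial>PiM p (\<lambda>_. \<eta>))"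
      using Gm[OF that] by (intro nn_integral_monotone_convergence_SUP[symmetric])
    then show ?thesis by (simp add: Gk(2)[OF that])
  qed
  have incL: "incseq L" and supL: "(SUP k. L k) = (\<integral>\<^sup>+\<omega>. eneg (pint (jump w) \<omega>) \<partial>M)"
    using limit_inc[of "\<lambda>_. 1"] limit[of "\<lambda>_. 1"] by (simp_all add: L_def[abs_def])
  have "(\<integral>\<^sup>+\<omega>. H \<omega> * eneg (pint (jump w) \<omega>) \<partial>M)
      = (SUP k. (\<Sum>p\<in>parts. \<integral>\<^sup>+Ys. G k p Ys \<partial>PiM p (\<lambda>_. \<eta>)) * L k)"
    by (simp add: limit[symmetric] step)
  also have "\<dots> = (SUP k. \<Sum>p\<in>parts. \<integral>\<^sup>+Ys. G k p Ys \<partial>PiM p (\<lambda>_. \<eta>)) * (SUP k. L k)"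
    using incS by (intro SUP_mult_incseq incL) (auto simp: incseq_def intro!: sum_mono)
  also have "(SUP k. \<Sum>p\<in>parts. \<integral>\<^sup>+Ys. G k p Ys \<partial>PiM p (\<lambda>_. \<eta>))
      = (\<Sum>p\<in>parts. SUP k. \<integral>\<^sup>+Ys. G k p Ys \<partial>PiM p (\<lambda>_. \<eta>))"
    using incS by (intro ennreal_SUP_sum) auto
  finally show ?thesis
    by (simp add: supL supS H_def parts_def)
qed

end

section \<open>Mixing over the gamma variable\<close>

text \<open>Substitution \<open>t = r * v\<close> in Euler's integral for \<open>Gamma a\<close>,
  with \<open>r\<close> the real value of \<open>x\<close>.\<close>

lemma gamma_integral_eneg:
  assumes a: "0 < a" and x: "0 < x" "x < \<top>"
  shows "(\<integral>\<^sup>+v. indicator {0<..} v * ennreal (v powr (a - 1)) * eneg (ennreal v * x) \<partial>lborel)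
    = ennreal (Gamma a) * ennreal (enn2real x powr - a)"
proof -
  obtain r where r: "x = ennreal r" "0 < r"
    using x by (cases x) auto
  have "ennreal (Gamma a) = (\<integral>\<^sup>+t. ennreal (indicator {0..} t * t powr (a - 1) / exp t) \<partial>lborel)"
    by (rule Gamma_conv_nn_integral_real[OF a])
  also have "\<dots> = ennreal \<bar>r\<bar> * (\<integral>\<^sup>+v. ennreal (indicator {0..} (0 + r * v) * (0 + r * v) powr (a - 1) / exp (0 + r * v)) \<partial>lborel)"
    using r by (intro nn_integral_real_affine) auto
  also have "(\<integral>\<^sup>+v. ennreal (indicator {0..} (0 + r * v) * (0 + r * v) powr (a - 1) / exp (0 + r * v)) \<partial>lborel)
      = (\<integral>\<^sup>+v. ennreal (r powr (a - 1)) * (indicator {0<..} v * ennreal (v powr (a - 1)) * eneg (ennreal v * x)) \<partial>lborel)"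
  proof (intro nn_integral_cong)
    fix v :: real
    \<comment> \<open>Euler's integral runs over \<open>{0..}\<close> instead of
      \<open>{0<..}\<close>; at \<open>v = 0\<close> both integrands vanish, since
      \<open>0 powr x = 0\<close>.\<close>
    consider "v < 0" | "v = 0" | "0 < v" by linarith
    then show "ennreal (indicator {0..} (0 + r * v) * (0 + r * v) powr (a - 1) / exp (0 + r * v))
        = ennreal (r powr (a - 1)) * (indicator {0<..} v * ennreal (v powr (a - 1)) * eneg (ennreal v * x))"
    proof cases
      case 1
      then have "r * v < 0" using r by (simp add: mult_pos_neg)
      then show ?thesis using 1 by simp
    next
      case 3
      then have "0 \<le> r * v" using r by simp
      then show ?thesis using 3 r
        by (simp add: powr_mult ennreal_mult[symmetric] exp_minus divide_inverse mult.commute[of v r] mult.assoc)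
    qed simp
  qed
  also have "\<dots> = ennreal (r powr (a - 1)) * (\<integral>\<^sup>+v. indicator {0<..} v * ennreal (v powr (a - 1)) * eneg (ennreal v * x) \<partial>lborel)"
    by (rule nn_integral_cmult) measurable
  finally have G: "ennreal (Gamma a) = ennreal (r powr a) *
      (\<integral>\<^sup>+v. indicator {0<..} v * ennreal (v powr (a - 1)) * eneg (ennreal v * x) \<partial>lborel)"
    using r by (simp add: mult.assoc[symmetric] ennreal_mult[symmetric] powr_mult_base)
  have "ennreal (r powr - a) * ennreal (r powr a) = 1"
    using r by (simp add: ennreal_mult[symmetric] powr_add[symmetric])
  then have "ennreal (r powr - a) * ennreal (Gamma a)
      = (\<integral>\<^sup>+v. indicator {0<..} v * ennreal (v powr (a - 1)) * eneg (ennreal v * x) \<partial>lborel)"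
    unfolding G by (simp add: mult.assoc[symmetric])
  then show ?thesis using r by (simp add: mult.commute)
qed

text \<open>Equivalent to \<open>1 + r \<le> exp r\<close> for finite \<open>x = r\<close>; it
  provides the integrable majorant in the argument for the negative part of
  \<open>1 + g\<close>.\<close>

lemma mult_eneg_le_complement: "x * eneg x \<le> 1 - eneg x"
proof (cases x)
  case (real r)
  have "1 + r \<le> exp r" by (rule exp_ge_add_one_self)
  then have "r * exp (- r) \<le> 1 - exp (- r)"
    by (simp add: exp_minus field_simps)
  then show ?thesis
    using real by (simp add: ennreal_mult[symmetric] ennreal_1[symmetric] ennreal_minus ennreal_leI del: ennreal_1)
qed simp

text \<open>This form, which includes the default 0 for non-integrable functions, reduces
  measurability of a Bochner integral in a parameter to that of non-negative integrals.\<close>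

lemma lebesgue_integral_eq_nn_integrals:
  fixes f :: "'a \<Rightarrow> real"
  assumes "f \<in> borel_measurable M"
  shows "(LINT x|M. f x) = (if (\<integral>\<^sup>+x. ennreal \<bar>f x\<bar> \<partial>M) < \<infinity>
    then enn2real (\<integral>\<^sup>+x. ennreal (f x) \<partial>M) - enn2real (\<integral>\<^sup>+x. ennreal (- f x) \<partial>M) else 0)"
  using assms by (auto simp: integrable_iff_bounded intro!: real_lebesgue_integral_def not_integrable_integral_eq)

context levy_setting
begin

lemma measurable_kfun_scaled [measurable (raw)]:
  assumes [measurable]: "w \<in> borel_measurable borel" "V \<in> borel_measurable X" "Y \<in> X \<rightarrow>\<^sub>M borel"
  shows "(\<lambda>x. kfun m (\<lambda>y. V x * w y) (Y x)) \<in> borel_measurable X"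
  unfolding kfun_def by measurable

end

section \<open>The gamma mixture and the sign of 1 + g\<close>

context crm_setting
begin

abbreviation laplace_mass :: "('y \<Rightarrow> ennreal) \<Rightarrow> real \<Rightarrow> ennreal" where
  "laplace_mass w v \<equiv> (\<integral>\<^sup>+\<omega>. eneg (ennreal v * pint (jump w) \<omega>) \<partial>M)"

text \<open>With \<open>a = \<theta> + n\<close> and up to the constant
  \<open>Gamma a * E[T powr -\<theta>]\<close>, a density relative to a product of copies of \<eta>
  on the event that the partition is \<open>p\<close>: for \<open>w = 1\<close> that of the block
  values, for \<open>w = 1 + g\<close> the same weighted by the transform.\<close>

definition mix_density :: "('y \<Rightarrow> ennreal) \<Rightarrow> real \<Rightarrow> nat set set \<Rightarrow> (nat set \<Rightarrow> 'y) \<Rightarrow> ennreal" where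
  "mix_density w a p Ys = (\<integral>\<^sup>+v. indicator {0<..} v * ennreal (v powr (a - 1)) * laplace_mass w v
      * (\<Prod>C\<in>p. kfun (card C) (\<lambda>y. ennreal v * w y) (Ys C)) \<partial>lborel)"

lemma laplace_mass_eq:
  assumes [measurable]: "w \<in> borel_measurable borel"
  shows "laplace_mass w v = eneg (\<integral>\<^sup>+y. \<integral>\<^sup>+s. 1 - eneg (ennreal v * (ennreal (h s) * w y)) \<partial>\<rho> y \<partial>\<eta>)"
proof -
  have "laplace_mass w v = (\<integral>\<^sup>+\<omega>. eneg (pint (jump (\<lambda>y. ennreal v * w y)) \<omega>) \<partial>M)"
    by (intro nn_integral_cong) (simp add: pint_jump_cmult)
  also have "\<dots> = eneg (\<integral>\<^sup>+x. 1 - eneg (jump (\<lambda>y. ennreal v * w y) x) \<partial>intensity \<rho> \<eta>)"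
    by (intro laplace_functional) (simp add: measurable_intensity)
  also have "(\<integral>\<^sup>+x. 1 - eneg (jump (\<lambda>y. ennreal v * w y) x) \<partial>intensity \<rho> \<eta>)
      = (\<integral>\<^sup>+y. \<integral>\<^sup>+s. 1 - eneg (ennreal v * (ennreal (h s) * w y)) \<partial>\<rho> y \<partial>\<eta>)"
    by (subst nn_integral_intensity) (simp_all add: jump_def mult.left_commute)
  finally show ?thesis .
qed

text \<open>The Mecke formula is applied at the rate \<open>v * w\<close> for fixed
  \<open>v\<close>. The integral over \<open>v\<close> is exchanged first with the expectation and
  then with the product of copies of \<eta>, all integrands being non-negative.\<close>

lemma mixture_identity:
  assumes w [measurable]: "w \<in> borel_measurable borel" and B [measurable]: "B \<in> sets (sample_space n)"
    and a: "0 < a" and fin: "AE \<omega> in M. 0 < pint (jump w) \<omega> \<and> pint (jump w) \<omega> < \<top>"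
  shows "ennreal (Gamma a) * (\<integral>\<^sup>+\<omega>. ennreal (enn2real (pint (jump w) \<omega>) powr - a)
        * (mass \<omega> ^ n * emeasure (PiM {1..n} (\<lambda>_. nrm h (N \<omega>))) B) \<partial>M)
    = (\<Sum>p | partition_on {1..n} p. \<integral>\<^sup>+Ys. mix_density w a p Ys * indicator B (unties n p Ys) \<partial>PiM p (\<lambda>_. \<eta>))"
proof -
  define H where "H \<omega> = mass \<omega> ^ n * emeasure (PiM {1..n} (\<lambda>_. nrm h (N \<omega>))) B" for \<omega>
  define c where "c v = indicator {0<..} v * ennreal (v powr (a - 1))" for v :: real
  define K where "K v p Ys = (\<Prod>C\<in>p. kfun (card C) (\<lambda>y. ennreal v * w y) (Ys C))"
    for v and p :: "nat set set" and Ys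
  have [measurable]: "(\<lambda>\<omega>. emeasure (PiM {1..n} (\<lambda>_. nrm h (N \<omega>))) B) \<in> borel_measurable M"
    by (rule measurable_compose[OF measurable_PiM_nrm measurable_emeasure_subprob_algebra[OF B]])
  have [measurable]: "H \<in> borel_measurable M" unfolding H_def[abs_def] by measurable
  have [measurable]: "c \<in> borel_measurable borel" unfolding c_def[abs_def] by measurable
  have [measurable]: "case_prod (\<lambda>v Ys. K v p Ys) \<in> borel_measurable (borel \<Otimes>\<^sub>M PiM p (\<lambda>_. \<eta>))" for p
    unfolding K_def[abs_def] by measurable
  interpret P: pair_sigma_finite lborel M
    by (intro pair_sigma_finite.intro sigma_finite_lborel) (rule sigma_finite_measure_axioms)
  have "ennreal (Gamma a) * (\<integral>\<^sup>+\<omega>. ennreal (enn2real (pint (jump w) \<omega>) powr - a) * H \<omega> \<partial>M)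
      = (\<integral>\<^sup>+\<omega>. ennreal (Gamma a) * (ennreal (enn2real (pint (jump w) \<omega>) powr - a) * H \<omega>) \<partial>M)"
    by (rule nn_integral_cmult[symmetric]) measurable
  also have "\<dots> = (\<integral>\<^sup>+\<omega>. (\<integral>\<^sup>+v. c v * eneg (ennreal v * pint (jump w) \<omega>) * H \<omega> \<partial>lborel) \<partial>M)"
  proof (rule nn_integral_cong_AE)
    show "AE \<omega> in M. ennreal (Gamma a) * (ennreal (enn2real (pint (jump w) \<omega>) powr - a) * H \<omega>)
        = (\<integral>\<^sup>+v. c v * eneg (ennreal v * pint (jump w) \<omega>) * H \<omega> \<partial>lborel)"
      using fin
    proof eventually_elim
      case (elim \<omega>)
      have "(\<integral>\<^sup>+v. c v * eneg (ennreal v * pint (jump w) \<omega>) * H \<omega> \<partial>lborel)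
          = (\<integral>\<^sup>+v. c v * eneg (ennreal v * pint (jump w) \<omega>) \<partial>lborel) * H \<omega>"
        by (rule nn_integral_multc) measurable
      also have "(\<integral>\<^sup>+v. c v * eneg (ennreal v * pint (jump w) \<omega>) \<partial>lborel)
          = ennreal (Gamma a) * ennreal (enn2real (pint (jump w) \<omega>) powr - a)"
        unfolding c_def using elim by (intro gamma_integral_eneg a) auto
      finally show ?case by (simp add: mult.assoc)
    qed
  qed
  also have "\<dots> = (\<integral>\<^sup>+v. (\<integral>\<^sup>+\<omega>. c v * eneg (ennreal v * pint (jump w) \<omega>) * H \<omega> \<partial>M) \<partial>lborel)"
    by (rule P.Fubini') measurable
  also have "\<dots> = (\<integral>\<^sup>+v. (\<Sum>p | partition_on {1..n} p.
      \<integral>\<^sup>+Ys. c v * laplace_mass w v * K v p Ys * indicator B (unties n p Ys) \<partial>PiM p (\<lambda>_. \<eta>)) \<partial>lborel)"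
  proof (intro nn_integral_cong)
    fix v :: real
    have "(\<integral>\<^sup>+\<omega>. c v * eneg (ennreal v * pint (jump w) \<omega>) * H \<omega> \<partial>M)
        = c v * (\<integral>\<^sup>+\<omega>. H \<omega> * eneg (pint (jump (\<lambda>y. ennreal v * w y)) \<omega>) \<partial>M)"
      by (subst nn_integral_cmult[symmetric]) (auto intro!: nn_integral_cong simp: pint_jump_cmult ac_simps)
    also have "\<dots> = c v * ((\<Sum>p | partition_on {1..n} p. \<integral>\<^sup>+Ys. K v p Ys * indicator B (unties n p Ys) \<partial>PiM p (\<lambda>_. \<eta>))
        * laplace_mass w v)"
      unfolding H_def K_def
      by (subst multivariate_mecke) (auto intro!: arg_cong2[where f="(*)"] nn_integral_cong simp: pint_jump_cmult)
    also have "\<dots> = (\<Sum>p | partition_on {1..n} p.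
        c v * laplace_mass w v * (\<integral>\<^sup>+Ys. K v p Ys * indicator B (unties n p Ys) \<partial>PiM p (\<lambda>_. \<eta>)))"
      unfolding sum_distrib_right sum_distrib_left by (intro sum.cong refl) (simp add: ac_simps)
    also have "\<dots> = (\<Sum>p | partition_on {1..n} p.
        \<integral>\<^sup>+Ys. c v * laplace_mass w v * K v p Ys * indicator B (unties n p Ys) \<partial>PiM p (\<lambda>_. \<eta>))"
    proof (intro sum.cong refl)
      fix p assume "p \<in> {p. partition_on {1..n} p}"
      then have [measurable]: "unties n p \<in> PiM p (\<lambda>_. \<eta>) \<rightarrow>\<^sub>M sample_space n"
        by (simp add: measurable_unties_eta)
      show "c v * laplace_mass w v * (\<integral>\<^sup>+Ys. K v p Ys * indicator B (unties n p Ys) \<partial>PiM p (\<lambda>_. \<eta>))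
          = (\<integral>\<^sup>+Ys. c v * laplace_mass w v * K v p Ys * indicator B (unties n p Ys) \<partial>PiM p (\<lambda>_. \<eta>))"
        by (subst nn_integral_cmult[symmetric]) (auto simp: mult.assoc)
    qed
    finally show "(\<integral>\<^sup>+\<omega>. c v * eneg (ennreal v * pint (jump w) \<omega>) * H \<omega> \<partial>M) = \<dots>" .
  qed
  also have "\<dots> = (\<Sum>p | partition_on {1..n} p. \<integral>\<^sup>+v.
      (\<integral>\<^sup>+Ys. c v * laplace_mass w v * K v p Ys * indicator B (unties n p Ys) \<partial>PiM p (\<lambda>_. \<eta>)) \<partial>lborel)"
  proof (rule nn_integral_sum)
    fix p assume "p \<in> {p. partition_on {1..n} p}"
    then have p: "partition_on {1..n} p" by simp
    then have [measurable]: "unties n p \<in> PiM p (\<lambda>_. \<eta>) \<rightarrow>\<^sub>M sample_space n"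
      by (simp add: measurable_unties_eta)
    have "sigma_finite_measure (PiM p (\<lambda>_. \<eta>))"
      using product_sigma_finite.sigma_finite[OF product_eta] finite_elements[OF _ p] by simp
    then interpret S: sigma_finite_measure "PiM p (\<lambda>_. \<eta>)" .
    show "(\<lambda>v. \<integral>\<^sup>+Ys. c v * laplace_mass w v * K v p Ys * indicator B (unties n p Ys) \<partial>PiM p (\<lambda>_. \<eta>)) \<in> borel_measurable lborel"
      by measurable
  qed
  also have "\<dots> = (\<Sum>p | partition_on {1..n} p. \<integral>\<^sup>+Ys. mix_density w a p Ys * indicator B (unties n p Ys) \<partial>PiM p (\<lambda>_. \<eta>))"
  proof (intro sum.cong refl)
    fix p assume "p \<in> {p. partition_on {1..n} p}"
    then have p: "partition_on {1..n} p" by simp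
    then have [measurable]: "unties n p \<in> PiM p (\<lambda>_. \<eta>) \<rightarrow>\<^sub>M sample_space n"
      by (simp add: measurable_unties_eta)
    have "sigma_finite_measure (PiM p (\<lambda>_. \<eta>))"
      using product_sigma_finite.sigma_finite[OF product_eta] finite_elements[OF _ p] by simp
    then interpret Q: pair_sigma_finite "PiM p (\<lambda>_. \<eta>)" lborel
      by (intro pair_sigma_finite.intro sigma_finite_lborel)
    have "(\<integral>\<^sup>+v. (\<integral>\<^sup>+Ys. c v * laplace_mass w v * K v p Ys * indicator B (unties n p Ys) \<partial>PiM p (\<lambda>_. \<eta>)) \<partial>lborel)
        = (\<integral>\<^sup>+Ys. (\<integral>\<^sup>+v. c v * laplace_mass w v * K v p Ys * indicator B (unties n p Ys) \<partial>lborel) \<partial>PiM p (\<lambda>_. \<eta>))"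
      by (rule Q.Fubini') measurable
    also have "\<dots> = (\<integral>\<^sup>+Ys. mix_density w a p Ys * indicator B (unties n p Ys) \<partial>PiM p (\<lambda>_. \<eta>))"
    proof (intro nn_integral_cong)
      fix Ys assume [measurable]: "Ys \<in> space (PiM p (\<lambda>_. \<eta>))"
      show "(\<integral>\<^sup>+v. c v * laplace_mass w v * K v p Ys * indicator B (unties n p Ys) \<partial>lborel)
          = mix_density w a p Ys * indicator B (unties n p Ys)"
        unfolding mix_density_def c_def[symmetric] K_def[symmetric]
        by (rule nn_integral_multc) measurable
    qed
    finally show "(\<integral>\<^sup>+v. (\<integral>\<^sup>+Ys. c v * laplace_mass w v * K v p Ys * indicator B (unties n p Ys) \<partial>PiM p (\<lambda>_. \<eta>)) \<partial>lborel) = \<dots>" .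
  qed
  finally show ?thesis unfolding H_def .
qed

text \<open>For \<open>\<phi> = k * jump up\<close> the factor \<open>eneg \<phi>\<close> equals 1 wherever \<open>un\<close> does not vanish, so Mecke's formula bounds
  the intensity of \<open>un\<close> by that of \<open>up * eneg (k * up)\<close>, which tends to 0.\<close>

lemma drift_zero:
  assumes [measurable]: "up \<in> borel_measurable borel" "un \<in> borel_measurable borel"
    and disj: "\<And>y. up y = 0 \<or> un y = 0"
    and le: "AE \<omega> in M. pint (jump un) \<omega> \<le> pint (jump up) \<omega> \<and> pint (jump up) \<omega> < \<top>"
  shows "(\<integral>\<^sup>+x. jump un x \<partial>intensity \<rho> \<eta>) = 0"
proof -
  define c where "c k = ennreal (real (Suc k))" for k
  define \<phi> where "\<phi> k = jump (\<lambda>y. c k * up y)" for k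
  define b where "b k x = jump up x * eneg (\<phi> k x)" for k x
  have [measurable]: "\<phi> k \<in> borel_measurable (borel \<Otimes>\<^sub>M borel)" for k
    unfolding \<phi>_def by measurable
  have [measurable]: "b k \<in> borel_measurable (borel \<Otimes>\<^sub>M borel)" for k
    unfolding b_def[abs_def] by measurable
  have \<phi>: "\<phi> k x = c k * jump up x" for k x
    by (simp add: \<phi>_def jump_def mult.left_commute)
  have bound: "(\<integral>\<^sup>+x. jump un x \<partial>intensity \<rho> \<eta>) \<le> (\<integral>\<^sup>+x. b k x \<partial>intensity \<rho> \<eta>)" for k
  proof -
    define L where "L = (\<integral>\<^sup>+\<omega>. eneg (pint (\<phi> k) \<omega>) \<partial>M)"
    have [measurable]: "pint (\<phi> k) \<in> borel_measurable M" unfolding \<phi>_def by measurable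
    have "L < \<top>"
      unfolding L_def by (rule le_less_trans[OF expectation_eneg_le_1]) simp
    \<comment> \<open>The later division by \<open>L\<close> is possible because
      \<open>pint (jump up)\<close> is almost surely finite, so that the exponential is almost
      surely positive.\<close>
    have "L \<noteq> 0"
    proof
      assume "L = 0"
      then have "AE \<omega> in M. eneg (pint (\<phi> k) \<omega>) = 0"
        using nn_integral_0_iff_AE[of "\<lambda>\<omega>. eneg (pint (\<phi> k) \<omega>)" M] by (simp add: L_def)
      then have "AE \<omega> in M. False"
        using le AE_space
      proof eventually_elim
        case (elim \<omega>)
        have "pint (\<phi> k) \<omega> = c k * pint (jump up) \<omega>"
          using elim unfolding \<phi>_def by (intro pint_jump_cmult) auto
        with elim show ?case by (simp add: ennreal_mult_eq_top_iff c_def)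
      qed
      then show False by simp
    qed
    have "(\<integral>\<^sup>+x. jump un x \<partial>intensity \<rho> \<eta>) * L = (\<integral>\<^sup>+x. jump un x * eneg (\<phi> k x) \<partial>intensity \<rho> \<eta>) * L"
    proof (intro arg_cong2[where f="(*)"] refl nn_integral_cong)
      fix x show "jump un x = jump un x * eneg (\<phi> k x)"
        using disj[of "snd x"] by (auto simp: \<phi> jump_def)
    qed
    also have "\<dots> = (\<integral>\<^sup>+\<omega>. pint (jump un) \<omega> * eneg (pint (\<phi> k) \<omega>) \<partial>M)"
      unfolding L_def by (rule mecke_exponential[symmetric]) (simp_all add: measurable_intensity)
    also have "\<dots> \<le> (\<integral>\<^sup>+\<omega>. pint (jump up) \<omega> * eneg (pint (\<phi> k) \<omega>) \<partial>M)"
      using le by (intro nn_integral_mono_AE, eventually_elim) (auto intro: mult_right_mono)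
    also have "\<dots> = (\<integral>\<^sup>+x. b k x \<partial>intensity \<rho> \<eta>) * L"
      unfolding L_def b_def by (rule mecke_exponential) (simp_all add: measurable_intensity)
    finally have "(\<integral>\<^sup>+x. jump un x \<partial>intensity \<rho> \<eta>) * L / L \<le> (\<integral>\<^sup>+x. b k x \<partial>intensity \<rho> \<eta>) * L / L"
      by (rule divide_right_mono_ennreal)
    then show ?thesis
      using \<open>L \<noteq> 0\<close> \<open>L < \<top>\<close> by (simp add: ennreal_mult_divide_eq less_top)
  qed
  \<comment> \<open>At \<open>k = 0\<close> the factor \<open>c 0\<close> is 1, and
    \<open>x * eneg x \<le> 1 - eneg x\<close> gives the integrable majorant that a decreasing limit
    requires.\<close>
  have fin: "(\<integral>\<^sup>+x. b 0 x \<partial>intensity \<rho> \<eta>) < \<infinity>"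
  proof -
    have "(\<integral>\<^sup>+x. b 0 x \<partial>intensity \<rho> \<eta>) \<le> (\<integral>\<^sup>+x. 1 - eneg (jump up x) \<partial>intensity \<rho> \<eta>)"
      unfolding b_def \<phi> c_def by (intro nn_integral_mono) (simp add: mult_eneg_le_complement One_nat_def)
    also have "\<dots> < \<infinity>"
      using finite_pint_imp[of "jump up"] le by (auto simp: infinity_ennreal_def)
    finally show ?thesis .
  qed
  have dec: "decseq b"
    unfolding b_def \<phi> c_def
    by (auto simp: monotone_on_def le_fun_def intro!: mult_left_mono eneg_antimono mult_right_mono ennreal_leI)
  have zero: "(INF k. b k x) = 0" for x
  proof -
    have "(INF k. b k x) \<le> 0"
    proof (rule ennreal_le_epsilon)
      fix e :: real assume e: "0 < e"
      then obtain k where k: "inverse (real (Suc k)) < e" using reals_Archimedean by blast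
      have "(INF k. b k x) \<le> b k x" by (rule INF_lower) simp
      \<comment> \<open>\<open>x * exp (- c x) \<le> 1 / c\<close> with \<open>c = k + 1\<close>,
        uniformly in \<open>x\<close>.\<close>
      also have "\<dots> \<le> ennreal (1 / real (Suc k))"
        unfolding b_def \<phi> c_def by (rule mult_eneg_le) simp
      also have "\<dots> \<le> ennreal e" using k by (intro ennreal_leI) (simp add: inverse_eq_divide)
      finally show "(INF k. b k x) \<le> 0 + ennreal e" by simp
    qed
    then show ?thesis by simp
  qed
  have "(INF k. \<integral>\<^sup>+x. b k x \<partial>intensity \<rho> \<eta>) = (\<integral>\<^sup>+x. (INF k. b k x) \<partial>intensity \<rho> \<eta>)"
    by (rule nn_integral_monotone_convergence_INF_decseq[OF dec _ fin, symmetric])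
       (simp add: measurable_intensity)
  also have "\<dots> = 0" by (simp add: zero)
  finally have "(INF k. \<integral>\<^sup>+x. b k x \<partial>intensity \<rho> \<eta>) = 0" .
  moreover have "(\<integral>\<^sup>+x. jump un x \<partial>intensity \<rho> \<eta>) \<le> (INF k. \<integral>\<^sup>+x. b k x \<partial>intensity \<rho> \<eta>)"
    by (intro INF_greatest bound)
  ultimately show ?thesis by simp
qed

end

section \<open>Tilted kernels and the ratio of Laplace functionals\<close>

text \<open>Serves to compare tilted moments with the finite integral of
  \<open>1 - exp (- h)\<close>. Up to 1 the power \<open>x ^ m\<close> is at most \<open>x\<close>,
  because \<open>m \<ge> 1\<close>; beyond 1 the tilt beats the power while
  \<open>1 - exp (- x)\<close> stays above \<open>1 - exp (- 1)\<close>.\<close>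

lemma power_exp_bound:
  fixes v :: real
  assumes "0 < v" "m \<ge> 1"
  obtains c where "0 \<le> c" "\<And>x. 0 < x \<Longrightarrow> exp (- v * x) * x ^ m \<le> c * (1 - exp (- x))"
proof
  \<comment> \<open>The exponential \<open>exp (- v * x)\<close> is shared among the
    \<open>m\<close> factors of \<open>x ^ m\<close>, each receiving the rate \<open>d\<close>; the
    two entries of the maximum in \<open>c\<close> serve \<open>x \<le> 1\<close> and
    \<open>x > 1\<close>.\<close>
  define d where "d = v / real m"
  define c where "c = max (exp 1) ((1 / d) ^ m / (1 - exp (- 1)))"
  have d: "0 < d" using assms by (simp add: d_def)
  have e1: "0 < 1 - exp (- 1 :: real)" by simp
  show "0 \<le> c" by (simp add: c_def le_max_iff_disj)
  fix x :: real assume x: "0 < x"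
  show "exp (- v * x) * x ^ m \<le> c * (1 - exp (- x))"
  proof (cases "x \<le> 1")
    case True
    have "exp (- v * x) * x ^ m \<le> 1 * x ^ 1"
      using x True assms by (intro mult_mono power_decreasing) auto
    also have "\<dots> \<le> exp 1 * (x * exp (- x))"
    proof -
      have "1 \<le> exp 1 * exp (- x)" using True by (simp add: exp_add[symmetric])
      then show ?thesis using mult_left_mono[of 1 "exp 1 * exp (- x)" x] x by (simp add: ac_simps)
    qed
    also have "\<dots> \<le> exp 1 * (1 - exp (- x))"
    proof -
      have "1 + x \<le> exp x" by (rule exp_ge_add_one_self)
      then have "x * exp (- x) \<le> 1 - exp (- x)" by (simp add: exp_minus field_simps)
      then show ?thesis by simp
    qed
    also have "\<dots> \<le> c * (1 - exp (- x))"
      using x by (intro mult_right_mono) (auto simp: c_def)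
    finally show ?thesis .
  next
    case False
    have "d * x \<le> exp (d * x)" using exp_ge_add_one_self[of "d * x"] by linarith
    then have "x * exp (- (d * x)) \<le> 1 / d"
      using d by (simp add: exp_minus field_simps)
    then have "(x * exp (- (d * x))) ^ m \<le> (1 / d) ^ m"
      using x by (intro power_mono) auto
    moreover have "(x * exp (- (d * x))) ^ m = exp (- v * x) * x ^ m"
      using assms by (simp add: power_mult_distrib exp_of_nat_mult[symmetric] d_def)
    ultimately have "exp (- v * x) * x ^ m \<le> (1 / d) ^ m" by simp
    also have "\<dots> \<le> c * (1 - exp (- 1))"
    proof -
      have "(1 / d) ^ m / (1 - exp (- 1)) \<le> c" by (simp add: c_def)
      then show ?thesis using e1 by (simp add: pos_divide_le_eq)
    qed
    also have "\<dots> \<le> c * (1 - exp (- x))"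
      using False \<open>0 \<le> c\<close> by (intro mult_left_mono) auto
    finally show ?thesis .
  qed
qed

section \<open>Moments of the tilted kernels\<close>

context levy_setting
begin

lemma nn_integral_tilt:
  assumes "f \<in> borel_measurable borel"
  shows "(\<integral>\<^sup>+s. f s \<partial>tilt v h \<rho> y) = (\<integral>\<^sup>+s. ennreal (exp (- v * h s)) * f s \<partial>\<rho> y)"
  unfolding tilt_def
proof (rule nn_integral_density)
  show "(\<lambda>s. ennreal (exp (- v * h s))) \<in> borel_measurable (\<rho> y)" by measurable
  show "f \<in> borel_measurable (\<rho> y)" using assms measurable_cong_sets[OF sets_rho refl] by blast
qed

lemma sets_tilt [measurable_cong]: "sets (tilt v h \<rho> y) = sets borel"
  by (simp add: tilt_def sets_rho)

lemma measurable_nn_integral_tilt [measurable (raw)]: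
  assumes [measurable]: "case_prod F \<in> borel_measurable (X \<Otimes>\<^sub>M borel)"
    "V \<in> borel_measurable X" "Y \<in> X \<rightarrow>\<^sub>M borel"
  shows "(\<lambda>x. \<integral>\<^sup>+s. F x s \<partial>tilt (V x) h \<rho> (Y x)) \<in> borel_measurable X"
proof -
  have "(\<lambda>x. \<integral>\<^sup>+s. ennreal (exp (- V x * h s)) * F x s \<partial>\<rho> (Y x)) \<in> borel_measurable X"
    by measurable
  moreover have "(\<integral>\<^sup>+s. F x s \<partial>tilt (V x) h \<rho> (Y x)) = (\<integral>\<^sup>+s. ennreal (exp (- V x * h s)) * F x s \<partial>\<rho> (Y x))"
    if [measurable]: "x \<in> space X" for x
    by (rule nn_integral_tilt) measurable
  ultimately show ?thesis by (simp cong: measurable_cong)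
qed

lemma measurable_lebesgue_integral_tilt [measurable (raw)]:
  fixes F :: "'a \<Rightarrow> 's \<Rightarrow> real"
  assumes [measurable]: "case_prod F \<in> borel_measurable (X \<Otimes>\<^sub>M borel)"
    "V \<in> borel_measurable X" "Y \<in> X \<rightarrow>\<^sub>M borel"
  shows "(\<lambda>x. LINT s|tilt (V x) h \<rho> (Y x). F x s) \<in> borel_measurable X"
proof -
  have "(\<lambda>x. if (\<integral>\<^sup>+s. ennreal \<bar>F x s\<bar> \<partial>tilt (V x) h \<rho> (Y x)) < \<infinity>
      then enn2real (\<integral>\<^sup>+s. ennreal (F x s) \<partial>tilt (V x) h \<rho> (Y x))
        - enn2real (\<integral>\<^sup>+s. ennreal (- F x s) \<partial>tilt (V x) h \<rho> (Y x)) else 0) \<in> borel_measurable X"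
    by measurable
  moreover have "F x \<in> borel_measurable (tilt (V x) h \<rho> (Y x))" if [measurable]: "x \<in> space X" for x
    by measurable
  ultimately show ?thesis by (simp add: lebesgue_integral_eq_nn_integrals cong: measurable_cong)
qed

lemma measurable_laplace [measurable]:
  assumes [measurable]: "g \<in> borel_measurable borel"
  shows "(\<lambda>v. laplace h (\<lambda>y. v * g y) (tilt v h \<rho>) \<eta>) \<in> borel_measurable borel"
proof -
  interpret sigma_finite_measure \<eta> by (rule sigma_finite_eta)
  show ?thesis unfolding laplace_def by measurable
qed

lemma measurable_kappa [measurable (raw)]:
  assumes [measurable]: "V \<in> borel_measurable X" "Y \<in> X \<rightarrow>\<^sub>M borel"
  shows "(\<lambda>x. kappa h m (tilt (V x) h \<rho>) (Y x)) \<in> borel_measurable X"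
  unfolding kappa_def by measurable

lemma measurable_kappa_total [measurable]:
  "(\<lambda>v. kappa_total h m (tilt v h \<rho>) \<eta>) \<in> borel_measurable borel"
proof -
  interpret sigma_finite_measure \<eta> by (rule sigma_finite_eta)
  show ?thesis unfolding kappa_total_def by measurable
qed

text \<open>\<open>AE s in \<rho> y. False\<close> says that \<open>\<rho> y\<close> is the null
  measure. At such \<open>y\<close> the sign of \<open>1 + g y\<close> is not controlled, and the
  ratios of moments become \<open>0 / 0\<close>.\<close>

abbreviation no_jumps :: "'y \<Rightarrow> bool" where
  "no_jumps y \<equiv> (AE s in \<rho> y. False)"

lemma no_jumps_iff: "no_jumps y \<longleftrightarrow> (\<integral>\<^sup>+s. ennreal (h s) \<partial>\<rho> y) = 0"
proof -
  have "(\<integral>\<^sup>+s. ennreal (h s) \<partial>\<rho> y) = 0 \<longleftrightarrow> (AE s in \<rho> y. ennreal (h s) = 0)"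
    by (rule nn_integral_0_iff_AE) measurable
  moreover have "ennreal (h s) \<noteq> 0" for s using h_pos[of s] by simp
  ultimately show ?thesis by simp
qed

lemma nn_integral_no_jumps: "no_jumps y \<Longrightarrow> (\<integral>\<^sup>+s. f s \<partial>\<rho> y) = 0"
  using nn_integral_cong_AE[of f "\<lambda>_. 0" "\<rho> y"] by (simp add: eventually_mono)

lemma nn_integral_complement_finite: "(\<integral>\<^sup>+s. ennreal (1 - exp (- h s)) \<partial>\<rho> y) < \<top>"
proof (rule le_less_trans[OF nn_integral_mono])
  fix s
  have "1 - exp (- h s) \<le> min 1 (h s)"
    using exp_ge_add_one_self[of "- h s"] by simp
  then show "ennreal (1 - exp (- h s)) \<le> min 1 (ennreal (h s))"
    using h_pos[of s] by (auto simp: min_def ennreal_leI ennreal_le_1 split: if_splits)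
qed (use min_h_finite[of y] in simp)

text \<open>The constant does not depend on \<open>y\<close>, so that the bound can also be
  integrated over \<eta>.\<close>

lemma kappa_tilt_bound:
  assumes "0 < v" "m \<ge> 1"
  obtains c where "0 \<le> c"
    "\<And>y. kappa h m (tilt v h \<rho>) y \<le> ennreal c * (\<integral>\<^sup>+s. ennreal (1 - exp (- h s)) \<partial>\<rho> y)"
proof -
  obtain c where c: "0 \<le> c" "\<And>x. 0 < x \<Longrightarrow> exp (- v * x) * x ^ m \<le> c * (1 - exp (- x))"
    using power_exp_bound[OF assms] by metis
  have "kappa h m (tilt v h \<rho>) y \<le> ennreal c * (\<integral>\<^sup>+s. ennreal (1 - exp (- h s)) \<partial>\<rho> y)" for y
  proof -
    have "kappa h m (tilt v h \<rho>) y = (\<integral>\<^sup>+s. ennreal (exp (- v * h s)) * ennreal (h s ^ m) \<partial>\<rho> y)"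
      unfolding kappa_def by (rule nn_integral_tilt) measurable
    also have "\<dots> \<le> (\<integral>\<^sup>+s. ennreal c * ennreal (1 - exp (- h s)) \<partial>\<rho> y)"
    proof (intro nn_integral_mono)
      fix s
      show "ennreal (exp (- v * h s)) * ennreal (h s ^ m) \<le> ennreal c * ennreal (1 - exp (- h s))"
        using c(2)[OF h_pos[of s]] h_pos[of s] c(1)
        by (simp add: ennreal_mult[symmetric] ennreal_leI less_imp_le)
    qed
    also have "\<dots> = ennreal c * (\<integral>\<^sup>+s. ennreal (1 - exp (- h s)) \<partial>\<rho> y)"
      by (rule nn_integral_cmult) measurable
    finally show ?thesis .
  qed
  with c(1) show ?thesis by (rule that)
qed

lemma kappa_tilt_finite: "0 < v \<Longrightarrow> m \<ge> 1 \<Longrightarrow> kappa h m (tilt v h \<rho>) y < \<top>"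
  using kappa_tilt_bound[of v m] nn_integral_complement_finite[of y]
  by (metis ennreal_less_top ennreal_mult_less_top le_less_trans)

lemma kappa_tilt_eq_0_iff: "kappa h m (tilt v h \<rho>) y = 0 \<longleftrightarrow> no_jumps y"
proof -
  have "kappa h m (tilt v h \<rho>) y = (\<integral>\<^sup>+s. ennreal (exp (- v * h s)) * ennreal (h s ^ m) \<partial>\<rho> y)"
    unfolding kappa_def by (rule nn_integral_tilt) measurable
  also have "\<dots> = 0 \<longleftrightarrow> (AE s in \<rho> y. ennreal (exp (- v * h s)) * ennreal (h s ^ m) = 0)"
    by (rule nn_integral_0_iff_AE) measurable
  also have "\<dots> \<longleftrightarrow> no_jumps y"
  proof -
    have "ennreal (exp (- v * h s)) * ennreal (h s ^ m) \<noteq> 0" for s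
      using h_pos[of s] by simp
    then show ?thesis by simp
  qed
  finally show ?thesis .
qed

text \<open>The numerator in \<open>laplace_cond\<close> for the tilted kernel and
  \<open>v * g\<close>. Together with the tilt its exponent is the real number
  \<open>- v * (1 + g y) * h s\<close>, of either sign, in contrast to \<open>kfun\<close> at the
  rate \<open>v * ennreal (1 + g y)\<close>, where negative values are truncated.\<close>

definition jump_moment :: "('y \<Rightarrow> real) \<Rightarrow> real \<Rightarrow> nat \<Rightarrow> 'y \<Rightarrow> ennreal" where
  "jump_moment g v m y = (\<integral>\<^sup>+s. ennreal (exp (- (v * g y) * h s) * h s ^ m) \<partial>tilt v h \<rho> y)"

lemma measurable_jump_moment [measurable (raw)]:
  assumes [measurable]: "g \<in> borel_measurable borel" "V \<in> borel_measurable X" "Y \<in> X \<rightarrow>\<^sub>M borel"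
  shows "(\<lambda>x. jump_moment g (V x) m (Y x)) \<in> borel_measurable X"
  unfolding jump_moment_def by measurable

text \<open>The denominator is finite for \<open>v > 0\<close> and \<open>m \<ge> 1\<close>. It
  vanishes only if \<open>\<rho> y\<close> is null, and then the numerator vanishes as well, so the
  convention for division by 0 does no harm.\<close>

lemma jump_moment_cancel:
  assumes "g \<in> borel_measurable borel" "0 < v" "m \<ge> 1"
  shows "jump_moment g v m y / kappa h m (tilt v h \<rho>) y * kappa h m (tilt v h \<rho>) y = jump_moment g v m y"
proof (cases "no_jumps y")
  case True
  have "jump_moment g v m y = 0"
    unfolding jump_moment_def using assms(1) by (subst nn_integral_tilt) (auto simp: nn_integral_no_jumps[OF True])
  then show ?thesis by simp
next
  case False
  have "kappa h m (tilt v h \<rho>) y / kappa h m (tilt v h \<rho>) y = 1"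
    using False kappa_tilt_finite[OF assms(2,3)] by (intro ennreal_divide_self) (simp_all add: kappa_tilt_eq_0_iff)
  then show ?thesis
    by (simp add: divide_ennreal_def mult.assoc mult.commute[of "inverse _"])
qed

text \<open>The factors \<open>exp (- v h)\<close> and \<open>exp (- v g h)\<close> merge into the
  rate \<open>v * (1 + g)\<close>. Where \<open>1 + g y < 0\<close>, truncation by
  \<open>ennreal\<close> is harmless because \<open>\<rho> y\<close> is null and both sides are
  0.\<close>

lemma jump_moment_eq_kfun:
  assumes [measurable]: "g \<in> borel_measurable borel" and "0 < v" "0 \<le> 1 + g y \<or> no_jumps y"
  shows "jump_moment g v m y = kfun m (\<lambda>y. ennreal v * ennreal (1 + g y)) y"
  using assms(3)
proof
  assume u: "0 \<le> 1 + g y"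
  have "jump_moment g v m y = (\<integral>\<^sup>+s. ennreal (exp (- v * h s)) * ennreal (exp (- (v * g y) * h s) * h s ^ m) \<partial>\<rho> y)"
    unfolding jump_moment_def by (rule nn_integral_tilt) measurable
  also have "\<dots> = kfun m (\<lambda>y. ennreal v * ennreal (1 + g y)) y"
    unfolding kfun_def
  proof (intro nn_integral_cong)
    fix s
    have hs: "0 < h s" by (rule h_pos)
    have "ennreal (h s) * (ennreal v * ennreal (1 + g y)) = ennreal (h s * (v * (1 + g y)))"
      using hs u assms(2) by (simp add: ennreal_mult[symmetric])
    then have "eneg (ennreal (h s) * (ennreal v * ennreal (1 + g y))) = ennreal (exp (- (h s * (v * (1 + g y)))))"
      using hs u assms(2) by (simp del: ennreal_mult)
    moreover have "exp (- (h s * (v * (1 + g y)))) = exp (- v * h s) * exp (- (v * g y) * h s)"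
      by (simp add: exp_add[symmetric] algebra_simps)
    ultimately show "ennreal (exp (- v * h s)) * ennreal (exp (- (v * g y) * h s) * h s ^ m)
        = ennreal (h s) ^ m * eneg (ennreal (h s) * (ennreal v * ennreal (1 + g y)))"
      using hs by (simp add: ennreal_mult ennreal_power[symmetric] ac_simps)
  qed
  finally show ?thesis .
next
  assume n: "no_jumps y"
  show ?thesis
    unfolding jump_moment_def kfun_def by (subst nn_integral_tilt) (auto simp: nn_integral_no_jumps[OF n])
qed

lemma kappa_tilt_eq_kfun:
  assumes "0 < v"
  shows "kappa h m (tilt v h \<rho>) y = kfun m (\<lambda>y. ennreal v * 1) y"
  using jump_moment_eq_kfun[of "\<lambda>_. 0" v y m] assms by (simp add: jump_moment_def kappa_def)

end

context crm_setting
begin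

text \<open>Finite by \<open>kappa_tilt_bound\<close> and the finiteness of \<open>T\<close>. If it
  were 0, almost every \<open>\<rho> y\<close> would be null, so the mean of \<open>T\<close>, and
  then \<open>T\<close> itself, would vanish.\<close>

lemma kappa_total_pos_finite:
  assumes "0 < v" "m \<ge> 1"
  shows "kappa_total h m (tilt v h \<rho>) \<eta> \<noteq> 0" "kappa_total h m (tilt v h \<rho>) \<eta> < \<top>"
proof -
  obtain c where c: "0 \<le> c"
    "\<And>y. kappa h m (tilt v h \<rho>) y \<le> ennreal c * (\<integral>\<^sup>+s. ennreal (1 - exp (- h s)) \<partial>\<rho> y)"
    using kappa_tilt_bound[OF assms] by metis
  have "kappa_total h m (tilt v h \<rho>) \<eta> \<le> (\<integral>\<^sup>+y. ennreal c * (\<integral>\<^sup>+s. ennreal (1 - exp (- h s)) \<partial>\<rho> y) \<partial>\<eta>)"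
    unfolding kappa_total_def by (intro nn_integral_mono c)
  also have "\<dots> = ennreal c * (\<integral>\<^sup>+y. \<integral>\<^sup>+s. ennreal (1 - exp (- h s)) \<partial>\<rho> y \<partial>\<eta>)"
    by (rule nn_integral_cmult) measurable
  also have "(\<integral>\<^sup>+y. \<integral>\<^sup>+s. ennreal (1 - exp (- h s)) \<partial>\<rho> y \<partial>\<eta>) = (\<integral>\<^sup>+x. 1 - eneg (jump (\<lambda>_. 1) x) \<partial>intensity \<rho> \<eta>)"
  proof (subst nn_integral_intensity)
    show "(\<integral>\<^sup>+y. \<integral>\<^sup>+s. ennreal (1 - exp (- h s)) \<partial>\<rho> y \<partial>\<eta>)
        = (\<integral>\<^sup>+y. \<integral>\<^sup>+s. 1 - eneg (jump (\<lambda>_. 1) (s, y)) \<partial>\<rho> y \<partial>\<eta>)"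
    proof (intro nn_integral_cong)
      fix s y
      show "ennreal (1 - exp (- h s)) = 1 - eneg (jump (\<lambda>_. 1) (s, y))"
        using ennreal_minus[of "exp (- h s)" 1] h_pos[of s] by (simp add: jump_def less_imp_le)
    qed
  qed measurable
  also have "ennreal c * \<dots> < \<top>"
    using finite_pint_imp[of "jump (\<lambda>_. 1)"] AE_mass by (simp add: ennreal_mult_less_top)
  finally show "kappa_total h m (tilt v h \<rho>) \<eta> < \<top>" .
  show "kappa_total h m (tilt v h \<rho>) \<eta> \<noteq> 0"
  proof
    assume "kappa_total h m (tilt v h \<rho>) \<eta> = 0"
    moreover have [measurable]: "(\<lambda>y. kappa h m (tilt v h \<rho>) y) \<in> borel_measurable \<eta>" by measurable
    ultimately have "AE y in \<eta>. no_jumps y"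
      by (simp add: kappa_total_def nn_integral_0_iff_AE kappa_tilt_eq_0_iff)
    then have "(\<integral>\<^sup>+y. \<integral>\<^sup>+s. jump (\<lambda>_. 1) (s, y) \<partial>\<rho> y \<partial>\<eta>) = (\<integral>\<^sup>+y. 0 \<partial>\<eta>)"
      by (intro nn_integral_cong_AE) (auto elim!: eventually_mono intro: nn_integral_no_jumps)
    then have "(\<integral>\<^sup>+x. jump (\<lambda>_. 1) x \<partial>intensity \<rho> \<eta>) = 0"
      by (subst nn_integral_intensity) simp_all
    \<comment> \<open>With \<open>\<phi> = 0\<close>, Mecke's formula is Campbell's formula for the
      mean.\<close>
    then have "(\<integral>\<^sup>+\<omega>. mass \<omega> \<partial>M) = 0"
      using mecke_exponential[of "jump (\<lambda>_. 1)" "\<lambda>_. 0"] by (simp add: pint_def measurable_intensity)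
    then have "AE \<omega> in M. mass \<omega> = 0"
      by (subst (asm) nn_integral_0_iff_AE) simp_all
    then have "AE \<omega> in M. False"
      using AE_mass by eventually_elim simp
    then show False by simp
  qed
qed

lemma T_laplace_eq: "0 \<le> v \<Longrightarrow> T_laplace M N h v = laplace_mass (\<lambda>_. 1) v"
  unfolding T_laplace_def
proof (rule nn_integral_cong_AE)
  assume v: "0 \<le> v"
  show "AE \<omega> in M. ennreal (exp (- v * enn2real (total_mass h (N \<omega>)))) = eneg (ennreal v * mass \<omega>)"
    using AE_mass AE_space
  proof eventually_elim
    case (elim \<omega>)
    then obtain r where "mass \<omega> = ennreal r" "0 \<le> r" by (cases "mass \<omega>") auto
    then show ?case using v elim(2) by (simp add: total_mass_eq ennreal_mult[symmetric])
  qed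
qed

lemma measurable_T_laplace [measurable]: "T_laplace M N h \<in> borel_measurable borel"
proof -
  have e: "T_laplace M N h v = (\<integral>\<^sup>+\<omega>. ennreal (exp (- v * enn2real (mass \<omega>))) \<partial>M)" for v
    unfolding T_laplace_def by (intro nn_integral_cong) (simp add: total_mass_eq)
  have "(\<lambda>v. \<integral>\<^sup>+\<omega>. ennreal (exp (- v * enn2real (mass \<omega>))) \<partial>M) \<in> borel_measurable borel"
    by measurable
  then show ?thesis unfolding e[abs_def] .
qed

text \<open>Since \<open>exp (- v h) * (1 - exp (- v g h)) = (1 - exp (- v (1 + g) h)) - (1 - exp (-
  v h))\<close>, the exponent of \<open>laplace\<close> is the difference of the Laplace exponents
  at the rates \<open>v (1 + g)\<close> and \<open>v\<close>. Both are finite by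
  \<open>finite_pint_imp\<close>, which also yields the integrability needed to split the Bochner
  integrals.\<close>

lemma laplace_ratio:
  assumes g [measurable]: "g \<in> borel_measurable borel"
    and nonneg: "AE y in \<eta>. 0 \<le> 1 + g y \<or> no_jumps y"
    and fin: "AE \<omega> in M. pint (jump (\<lambda>y. ennreal (1 + g y))) \<omega> < \<top>"
    and v: "0 < v"
  shows "ennreal (laplace h (\<lambda>y. v * g y) (tilt v h \<rho>) \<eta>) * laplace_mass (\<lambda>_. 1) v
    = laplace_mass (\<lambda>y. ennreal (1 + g y)) v"
proof -
  define w where "w y = ennreal (1 + g y)" for y
  define A where "A u = (\<integral>\<^sup>+y. \<integral>\<^sup>+s. 1 - eneg (ennreal v * (ennreal (h s) * u y)) \<partial>\<rho> y \<partial>\<eta>)" for u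
  define a where "a u y = (\<integral>\<^sup>+s. 1 - eneg (ennreal v * (ennreal (h s) * u y)) \<partial>\<rho> y)" for u :: "'y \<Rightarrow> ennreal" and y
  define J where "J y = (LINT s|tilt v h \<rho> y. 1 - exp (- (v * g y) * h s))" for y
  have [measurable]: "w \<in> borel_measurable borel" unfolding w_def[abs_def] by measurable
  have J_meas [measurable]: "J \<in> borel_measurable borel" unfolding J_def by measurable
  have a_meas [measurable]: "a u \<in> borel_measurable borel" if [measurable]: "u \<in> borel_measurable borel" for u
    unfolding a_def by measurable
  have A_fin: "A u < \<top>" if [measurable]: "u \<in> borel_measurable borel" and "AE \<omega> in M. pint (jump u) \<omega> < \<top>" for u
  proof -
    have "AE \<omega> in M. pint (jump (\<lambda>y. ennreal v * u y)) \<omega> < \<top>"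
      using that(2) AE_space by eventually_elim (simp add: pint_jump_cmult ennreal_mult_less_top)
    then have "(\<integral>\<^sup>+x. 1 - eneg (jump (\<lambda>y. ennreal v * u y) x) \<partial>intensity \<rho> \<eta>) < \<top>"
      by (intro finite_pint_imp) auto
    then show ?thesis
      unfolding A_def by (subst (asm) nn_integral_intensity) (simp_all add: jump_def mult.left_commute)
  qed
  have A1: "A (\<lambda>_. 1) < \<top>" using AE_mass by (intro A_fin) auto
  have A2: "A w < \<top>" using fin by (intro A_fin) (auto simp: w_def[abs_def])
  have int: "integrable \<eta> (\<lambda>y. enn2real (a u y))" "(LINT y|\<eta>. enn2real (a u y)) = enn2real (A u)"
      "AE y in \<eta>. a u y < \<top>"
    if [measurable]: "u \<in> borel_measurable borel" and fin: "A u < \<top>" for u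
  proof -
    have Aa: "A u = (\<integral>\<^sup>+y. a u y \<partial>\<eta>)" by (simp add: A_def a_def)
    show AE: "AE y in \<eta>. a u y < \<top>"
      using nn_integral_PInf_AE[of "a u" \<eta>] fin by (simp add: Aa less_top)
    have e: "(\<integral>\<^sup>+y. ennreal (enn2real (a u y)) \<partial>\<eta>) = A u"
      unfolding Aa using AE by (intro nn_integral_cong_AE) (auto elim!: eventually_mono)
    show "integrable \<eta> (\<lambda>y. enn2real (a u y))"
      using fin by (intro integrableI_nonneg) (auto simp: e)
    show "(LINT y|\<eta>. enn2real (a u y)) = enn2real (A u)"
      by (subst integral_eq_nn_integral) (auto simp: e)
  qed
  have "AE y in \<eta>. J y = enn2real (a w y) - enn2real (a (\<lambda>_. 1) y)"
    using nonneg int(3)[OF \<open>w \<in> borel_measurable borel\<close> A2] int(3)[OF borel_measurable_const A1]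
  proof eventually_elim
    case (elim y)
    note fin = elim(2,3)
    have J: "J y = (LINT s|\<rho> y. exp (- v * h s) *\<^sub>R (1 - exp (- (v * g y) * h s)))"
      unfolding J_def tilt_def by (rule integral_density) auto
    show ?case
    proof (cases "no_jumps y")
      case True
      then have "AE s in \<rho> y. exp (- v * h s) *\<^sub>R (1 - exp (- (v * g y) * h s)) = 0"
        by eventually_elim simp
      then have "J y = 0"
        unfolding J by (rule integral_eq_zero_AE)
      then show ?thesis using nn_integral_no_jumps[OF True] by (simp add: a_def)
    next
      case False
      then have u: "0 \<le> 1 + g y" using elim by simp
      define e where "e r s = 1 - exp (- (v * (h s * r)))" for r s
      have e_nonneg: "0 \<le> e r s" if "0 \<le> r" for r s
        using that v h_pos[of s] by (simp add: e_def)
      have ae: "1 - eneg (ennreal v * (ennreal (h s) * ennreal r)) = ennreal (e r s)" if "0 \<le> r" for r s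
        using that v h_pos[of s]
        by (simp add: e_def ennreal_mult[symmetric] less_imp_le ennreal_1[symmetric] ennreal_minus del: ennreal_1)
      have aw: "a w y = (\<integral>\<^sup>+s. ennreal (e (1 + g y) s) \<partial>\<rho> y)"
        unfolding a_def w_def by (simp only: ae[OF u])
      have a1: "a (\<lambda>_. 1) y = (\<integral>\<^sup>+s. ennreal (e 1 s) \<partial>\<rho> y)"
        unfolding a_def using ae[of 1] by simp
      have i: "integrable (\<rho> y) (e (1 + g y))" "integrable (\<rho> y) (e 1)"
        using fin u unfolding aw a1 by (auto intro!: integrableI_nonneg simp: e_nonneg) (auto simp: e_def[abs_def])
      have "J y = (LINT s|\<rho> y. e (1 + g y) s - e 1 s)"
        unfolding J e_def by (intro Bochner_Integration.integral_cong refl)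
          (simp add: algebra_simps exp_add[symmetric])
      also have "\<dots> = (LINT s|\<rho> y. e (1 + g y) s) - (LINT s|\<rho> y. e 1 s)"
        by (intro Bochner_Integration.integral_diff i)
      also have "(LINT s|\<rho> y. e (1 + g y) s) = enn2real (a w y)"
        unfolding aw using u by (intro integral_eq_nn_integral) (auto simp: e_nonneg intro: borel_measurable_integrable i)
      also have "(LINT s|\<rho> y. e 1 s) = enn2real (a (\<lambda>_. 1) y)"
        unfolding a1 by (intro integral_eq_nn_integral) (auto simp: e_nonneg intro: borel_measurable_integrable i)
      finally show ?thesis .
    qed
  qed
  then have "(LINT y|\<eta>. J y) = (LINT y|\<eta>. enn2real (a w y) - enn2real (a (\<lambda>_. 1) y))"
    by (intro integral_cong_AE) auto
  also have "\<dots> = enn2real (A w) - enn2real (A (\<lambda>_. 1))"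
    using int[of w] int[of "\<lambda>_. 1"] A1 A2 by simp
  finally have "laplace h (\<lambda>y. v * g y) (tilt v h \<rho>) \<eta> = exp (- (enn2real (A w) - enn2real (A (\<lambda>_. 1))))"
    by (simp add: laplace_def J_def)
  moreover have "laplace_mass (\<lambda>_. 1) v = ennreal (exp (- enn2real (A (\<lambda>_. 1))))"
    using laplace_mass_eq[OF borel_measurable_const, of v 1] eneg_finite[OF A1] unfolding A_def by (rule trans)
  moreover have "laplace_mass w v = ennreal (exp (- enn2real (A w)))"
    using laplace_mass_eq[OF \<open>w \<in> borel_measurable borel\<close>, of v] eneg_finite[OF A2] unfolding A_def by (rule trans)
  ultimately show ?thesis
    by (simp add: w_def[abs_def] ennreal_mult[symmetric] exp_add[symmetric])
qed

end

section \<open>Partitions and tied samples\<close>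

lemma partition_on_ties: "partition_on {1..n} (ties n Y)"
  by (rule partition_onI) (auto simp: ties_def disjnt_def)

lemma same_block_ties:
  assumes "i \<in> {1..n}" "j \<in> {1..n}"
  shows "(\<exists>C\<in>ties n Y. i \<in> C \<and> j \<in> C) \<longleftrightarrow> Y i = Y j"
proof
  assume "\<exists>C\<in>ties n Y. i \<in> C \<and> j \<in> C"
  then show "Y i = Y j" by (auto simp: ties_def)
next
  assume "Y i = Y j"
  then have "i \<in> {k\<in>{1..n}. Y k = Y i}" "j \<in> {k\<in>{1..n}. Y k = Y i}"
    using assms by simp_all
  moreover have "{k\<in>{1..n}. Y k = Y i} \<in> ties n Y"
    unfolding ties_def using assms(1) by (rule imageI)
  ultimately show "\<exists>C\<in>ties n Y. i \<in> C \<and> j \<in> C" by (intro bexI conjI)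
qed

lemma block_eq:
  assumes "partition_on A p" "C \<in> p" "i \<in> C"
  shows "{j\<in>A. \<exists>C\<in>p. i \<in> C \<and> j \<in> C} = C"
proof -
  have "C' = C" if "C' \<in> p" "i \<in> C'" for C'
    using partition_onD2[OF assms(1)] assms(2,3) that by (auto simp: disjoint_def)
  then show ?thesis using assms partition_onD1[OF assms(1)] by blast
qed

lemma partition_eq_blocks:
  assumes "partition_on A p"
  shows "p = (\<lambda>i. {j\<in>A. \<exists>C\<in>p. i \<in> C \<and> j \<in> C}) ` A"
proof (intro equalityI subsetI)
  fix C assume C: "C \<in> p"
  then have "C \<noteq> {}" using partition_onD3[OF assms] by metis
  then obtain i where i: "i \<in> C" by blast
  then have "i \<in> A" using C partition_onD1[OF assms] by auto
  then show "C \<in> (\<lambda>i. {j\<in>A. \<exists>C\<in>p. i \<in> C \<and> j \<in> C}) ` A"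
    using block_eq[OF assms C i] by (intro image_eqI[of _ _ i]) simp_all
next
  fix C assume "C \<in> (\<lambda>i. {j\<in>A. \<exists>C\<in>p. i \<in> C \<and> j \<in> C}) ` A"
  then obtain i where i: "i \<in> A" "C = {j\<in>A. \<exists>C\<in>p. i \<in> C \<and> j \<in> C}" by (rule imageE)
  then obtain C' where C': "C' \<in> p" "i \<in> C'" using partition_onD1[OF assms] by blast
  show "C \<in> p" using block_eq[OF assms C'] C' i by (simp only:)
qed

text \<open>Reduces the event of a given partition to finitely many equalities between coordinates
  and their negations, which makes it measurable.\<close>

lemma ties_eq_iff:
  assumes p: "partition_on {1..n} p"
  shows "ties n Y = p \<longleftrightarrow> (\<forall>i\<in>{1..n}. \<forall>j\<in>{1..n}. Y i = Y j \<longleftrightarrow> (\<exists>C\<in>p. i \<in> C \<and> j \<in> C))"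
    (is "_ \<longleftrightarrow> ?R")
proof (rule iffI)
  assume eq: "ties n Y = p"
  show ?R
    using same_block_ties[of _ n _ Y, symmetric] unfolding eq by (intro ballI)
next
  assume R: ?R
  have "{j\<in>{1..n}. Y j = Y i} = {j\<in>{1..n}. \<exists>C\<in>p. i \<in> C \<and> j \<in> C}" if "i \<in> {1..n}" for i
  proof (rule Collect_cong, rule conj_cong[OF refl])
    fix j assume "j \<in> {1..n}"
    then show "(Y j = Y i) = (\<exists>C\<in>p. i \<in> C \<and> j \<in> C)"
      using R[rule_format, OF that, of j] by (simp only: eq_commute)
  qed
  then have "ties n Y = (\<lambda>i. {j\<in>{1..n}. \<exists>C\<in>p. i \<in> C \<and> j \<in> C}) ` {1..n}"
    unfolding ties_def by (rule image_cong[OF refl])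
  then show "ties n Y = p" by (simp only: partition_eq_blocks[OF p, symmetric])
qed

text \<open>Injectivity prevents different blocks from merging into one class of equal
  values.\<close>

lemma ties_unties:
  assumes p: "partition_on {1..n} p" and inj: "inj_on Ys p"
  shows "ties n (unties n p Ys) = p"
proof -
  have "unties n p Ys i = unties n p Ys j \<longleftrightarrow> (\<exists>C\<in>p. i \<in> C \<and> j \<in> C)"
    if "i \<in> {1..n}" "j \<in> {1..n}" for i j
  proof -
    obtain C C' where C: "C \<in> p" "i \<in> C" "C' \<in> p" "j \<in> C'"
      using partition_onD1[OF p] \<open>i \<in> {1..n}\<close> \<open>j \<in> {1..n}\<close> by blast
    have "unties n p Ys i = unties n p Ys j \<longleftrightarrow> C = C'"
      using C inj by (simp add: unties_block[OF p] inj_on_eq_iff)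
    also have "\<dots> \<longleftrightarrow> (\<exists>C\<in>p. i \<in> C \<and> j \<in> C)"
    proof
      assume "\<exists>C\<in>p. i \<in> C \<and> j \<in> C"
      then obtain C0 where C0: "C0 \<in> p" "i \<in> C0" "j \<in> C0" by auto
      have "C = C0"
        using partition_block[OF p C(1,2)] partition_block[OF p C0(1,2)] by (rule trans[OF sym])
      moreover have "C' = C0"
        using partition_block[OF p C(3,4)] partition_block[OF p C0(1,3)] by (rule trans[OF sym])
      ultimately show "C = C'" by simp
    next
      assume "C = C'"
      then show "\<exists>C\<in>p. i \<in> C \<and> j \<in> C" using C by blast
    qed
    finally show ?thesis .
  qed
  then show ?thesis unfolding ties_eq_iff[OF p] by (intro ballI)
qed

lemma Min_in_block:
  assumes p: "partition_on {1..n::nat} p" and C: "C \<in> p"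
  shows "Min C \<in> C"
proof -
  have "C \<subseteq> {1..n}" "C \<noteq> {}" using partition_onD1[OF p] partition_onD3[OF p] C by auto
  then show ?thesis by (intro Min_in) (auto intro: finite_subset)
qed

lemma card_block:
  assumes p: "partition_on {1..n::nat} p" and C: "C \<in> p"
  shows "card C \<ge> 1"
proof -
  have "C \<subseteq> {1..n}" "C \<noteq> {}" using partition_onD1[OF p] partition_onD3[OF p] C by auto
  then have "card C > 0" by (auto simp: card_gt_0_iff intro: finite_subset)
  then show ?thesis by simp
qed

lemma distinct_values_unties:
  assumes p: "partition_on {1..n} p" and inj: "inj_on Ys p" and ext: "Ys \<in> extensional p"
  shows "distinct_values n (unties n p Ys) = Ys"
proof
  fix C
  show "distinct_values n (unties n p Ys) C = Ys C"
  proof (cases "C \<in> p")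
    case True
    then show ?thesis
      unfolding distinct_values_def ties_unties[OF p inj]
      using unties_block[OF p True Min_in_block[OF p True], of Ys] by simp
  next
    case False
    then show ?thesis
      unfolding distinct_values_def ties_unties[OF p inj]
      using extensional_arb[OF ext False] by simp
  qed
qed

lemma sets_ties:
  assumes p: "partition_on {1..n} p"
  shows "{Y \<in> space (sample_space n :: (nat \<Rightarrow> 'y::polish_space) measure). ties n Y = p} \<in> sets (sample_space n)"
proof -
  have [measurable]: "Measurable.pred (sample_space n) (\<lambda>Y :: nat \<Rightarrow> 'y. Y i = Y j)"
    if "i \<in> {1..n}" "j \<in> {1..n}" for i j
  proof -
    have [measurable]: "(\<lambda>Y. Y k) \<in> sample_space n \<rightarrow>\<^sub>M (borel :: 'y measure)" if "k \<in> {1..n}" for k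
      using that by (rule measurable_component_singleton)
    \<comment> \<open>Equality in a metric space is the vanishing of the distance, a Borel function
      of the two coordinates.\<close>
    have "Measurable.pred (sample_space n) (\<lambda>Y :: nat \<Rightarrow> 'y. dist (Y i) (Y j) = 0)"
      using that by measurable
    then show ?thesis by simp
  qed
  have "{Y \<in> space (sample_space n :: (nat \<Rightarrow> 'y) measure). ties n Y = p}
      = {Y \<in> space (sample_space n). \<forall>i\<in>{1..n}. \<forall>j\<in>{1..n}. (Y i = Y j) = (\<exists>C\<in>p. i \<in> C \<and> j \<in> C)}"
    using ties_eq_iff[OF p] by blast
  also have "\<dots> \<in> sets (sample_space n)"
    by measurable
  finally show ?thesis .
qed

lemma nonatomic_singleton:
  assumes "nonatomic \<eta>" "{y} \<in> sets \<eta>"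
  shows "emeasure \<eta> {y} = 0"
proof (rule ccontr)
  assume "emeasure \<eta> {y} \<noteq> 0"
  then have "emeasure \<eta> {y} > 0" by (simp add: zero_less_iff_neq_zero)
  then obtain B where B: "B \<in> sets \<eta>" "B \<subseteq> {y}" "0 < emeasure \<eta> B" "emeasure \<eta> B < emeasure \<eta> {y}"
    using assms unfolding nonatomic_def by metis
  then have "B = {} \<or> B = {y}" by blast
  then show False using B by auto
qed

section \<open>Almost everywhere statements for products of \<eta>\<close>

context levy_setting
begin

text \<open>By Fubini's theorem, with the coordinate of \<open>C\<close> integrated first, a tie
  with \<open>C'\<close> has the \<eta>-mass of a singleton, which is 0 for a non-atomic
  measure.\<close>

lemma AE_inj_on:
  fixes p :: "'i set"
  assumes na: "nonatomic \<eta>" and fin: "finite p"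
  shows "AE Ys in PiM p (\<lambda>_. \<eta>). inj_on Ys p"
proof -
  have [measurable]: "(\<lambda>x. dist (x C) (x C')) \<in> borel_measurable (PiM p (\<lambda>_. \<eta>))" if "C \<in> p" "C' \<in> p" for C C'
  proof -
    have [measurable]: "(\<lambda>x. x C) \<in> PiM p (\<lambda>_. \<eta>) \<rightarrow>\<^sub>M borel" if "C \<in> p" for C
      using measurable_component_singleton[OF that, of "\<lambda>_. \<eta>"] measurable_cong_sets[OF refl sets_eta] by blast
    show ?thesis using that by measurable
  qed
  have "AE Ys in PiM p (\<lambda>_. \<eta>). Ys C \<noteq> Ys C'" if C: "C \<in> p" "C' \<in> p" "C \<noteq> C'" for C C'
  proof -
    define q where "q = p - {C}"
    have q: "p = insert C q" "C \<notin> q" "finite q" "C' \<in> q" using C fin by (auto simp: q_def)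
    define f where "f x = (if dist (x C) (x C') = 0 then 1 else 0 :: ennreal)" for x :: "'i \<Rightarrow> 'y"
    have f_meas [measurable]: "f \<in> borel_measurable (PiM p (\<lambda>_. \<eta>))"
      unfolding f_def[abs_def] using C by measurable
    have "(\<integral>\<^sup>+x. f x \<partial>PiM p (\<lambda>_. \<eta>)) = (\<integral>\<^sup>+x. (\<integral>\<^sup>+y. f (x(C := y)) \<partial>\<eta>) \<partial>PiM q (\<lambda>_. \<eta>))"
      using f_meas unfolding q(1)
      by (intro product_sigma_finite.product_nn_integral_insert[OF product_eta] q)
    also have "\<dots> = (\<integral>\<^sup>+x. (\<integral>\<^sup>+y. indicator {x C'} y \<partial>\<eta>) \<partial>PiM q (\<lambda>_. \<eta>))"
      using C by (intro nn_integral_cong) (auto simp: f_def indicator_def)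
    also have "\<dots> = 0"
      using nonatomic_singleton[OF na] by (simp add: sets_eta)
    finally have "AE x in PiM p (\<lambda>_. \<eta>). f x = 0"
      by (subst (asm) nn_integral_0_iff_AE) auto
    then show ?thesis by eventually_elim (auto simp: f_def split: if_splits)
  qed
  then have "AE Ys in PiM p (\<lambda>_. \<eta>). \<forall>C\<in>p. \<forall>C'\<in>p. C \<noteq> C' \<longrightarrow> Ys C \<noteq> Ys C'"
    using fin by (auto intro!: AE_finite_allI)
  then show ?thesis by eventually_elim (auto simp: inj_on_def)
qed

text \<open>The factors need not be probability measures, so null sets are lifted by integrating the
  coordinate of \<open>C\<close> first. A measurable null set \<open>Z\<close> stands in for the
  failure set of \<open>R\<close>, which need not be measurable.\<close>

lemma AE_component:
  assumes fin: "finite p" and AE: "AE y in \<eta>. R y"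
  shows "AE Ys in PiM p (\<lambda>_. \<eta>). \<forall>C\<in>p. R (Ys C)"
proof -
  obtain Z where Z: "Z \<in> null_sets \<eta>" "{y \<in> space \<eta>. \<not> R y} \<subseteq> Z"
    using AE unfolding eventually_ae_filter by auto
  have [measurable]: "Z \<in> sets \<eta>" using Z by auto
  have "AE Ys in PiM p (\<lambda>_. \<eta>). R (Ys C)" if C: "C \<in> p" for C
  proof -
    define q where "q = p - {C}"
    have q: "p = insert C q" "C \<notin> q" "finite q" using C fin by (auto simp: q_def)
    have f_meas [measurable]: "(\<lambda>x. indicator Z (x C) :: ennreal) \<in> borel_measurable (PiM p (\<lambda>_. \<eta>))"
      using C by measurable
    have "(\<integral>\<^sup>+x. indicator Z (x C) \<partial>PiM p (\<lambda>_. \<eta>)) = (\<integral>\<^sup>+x. (\<integral>\<^sup>+y. indicator Z ((x(C := y)) C) \<partial>\<eta>) \<partial>PiM q (\<lambda>_. \<eta>))"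
      using f_meas unfolding q(1)
      by (intro product_sigma_finite.product_nn_integral_insert[OF product_eta] q)
    also have "\<dots> = 0" using null_setsD1[OF Z(1)] by simp
    finally have "AE x in PiM p (\<lambda>_. \<eta>). indicator Z (x C) = (0::ennreal)"
      by (subst (asm) nn_integral_0_iff_AE) auto
    then show ?thesis
    proof eventually_elim
      case (elim Ys)
      then have "Ys C \<notin> Z" by (auto simp: indicator_def split: if_splits)
      then show ?case using Z(2) by (auto simp: space_eta)
    qed
  qed
  then show ?thesis using fin by (intro AE_finite_allI) auto
qed

end

section \<open>The tilted law and the law of the sample\<close>

text \<open>\<open>S P\<close> stands for the sum of the \<open>z l * P (f l)\<close>. Away from the
  realised measures \<open>nrm h (N \<omega>)\<close> it may differ from the integral of
  \<open>g\<close>, since Bochner integrals of non-integrable functions are 0; hence it is a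
  parameter with measurability, almost sure agreement and positivity of \<open>1 + S\<close> as its
  properties.\<close>

locale stieltjes_setting = crm_setting h \<rho> \<eta> M N
  for h :: "'s::polish_space \<Rightarrow> real" and \<rho> :: "'y::polish_space \<Rightarrow> 's measure" and \<eta> :: "'y measure"
    and M :: "'w measure" and N :: "'w \<Rightarrow> ('s \<times> 'y) measure" +
  fixes n :: nat and \<theta> :: real and g :: "'y \<Rightarrow> real" and S :: "'y measure \<Rightarrow> real"
  assumes na: "nonatomic \<eta>"
    and shape_pos: "0 < \<theta> + real n"
    and moment_finite: "T_moment M N h (- \<theta>) < \<top>"
    and g_meas [measurable]: "g \<in> borel_measurable borel"
    and S_meas [measurable]: "S \<in> borel_measurable (subprob_algebra borel)"
    and S_eq: "AE \<omega> in M. integrable (nrm h (N \<omega>)) g \<and> S (nrm h (N \<omega>)) = (LINT y|nrm h (N \<omega>). g y)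
      \<and> 0 < 1 + S (nrm h (N \<omega>))"
begin

abbreviation w :: "'y \<Rightarrow> ennreal" where "w y \<equiv> ennreal (1 + g y)"
abbreviation a :: real where "a \<equiv> \<theta> + real n"
abbreviation E0 :: ennreal where "E0 \<equiv> T_moment M N h (- \<theta>)"
abbreviation D :: ennreal where "D \<equiv> ennreal (Gamma a) * E0"
abbreviation Q :: "'y measure measure" where "Q \<equiv> P_tilde M N h \<theta>"
abbreviation G :: "'y measure \<Rightarrow> ennreal" where "G P \<equiv> ennreal ((1 + S P) powr (- a))"
abbreviation unit_density :: "nat set set \<Rightarrow> (nat set \<Rightarrow> 'y) \<Rightarrow> ennreal" where
  "unit_density \<equiv> mix_density (\<lambda>_. 1) a"

lemma total_mass_measurable [measurable]: "(\<lambda>\<omega>. total_mass h (N \<omega>)) \<in> borel_measurable M"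
  by (rule measurable_cong[THEN iffD1, OF total_mass_eq[symmetric] measurable_pint_jump]) simp_all

lemma E0_pos: "E0 \<noteq> 0"
proof
  assume "E0 = 0"
  then have "AE \<omega> in M. ennreal (enn2real (total_mass h (N \<omega>)) powr (- \<theta>)) = 0"
    unfolding T_moment_def by (subst (asm) nn_integral_0_iff_AE) measurable
  then have "AE \<omega> in M. False"
    using T_pos_finite
  proof eventually_elim
    case (elim \<omega>)
    then have "0 < enn2real (total_mass h (N \<omega>))"
      by (cases "total_mass h (N \<omega>)") auto
    then have "0 < enn2real (total_mass h (N \<omega>)) powr (- \<theta>)" by simp
    with elim show ?case by (simp add: ennreal_eq_0_iff)
  qed
  then show False by simp
qed

lemma Gamma_pos: "0 < Gamma a"
  using shape_pos by (rule Gamma_real_pos)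

lemma D_pos: "D \<noteq> 0" and D_finite: "D < \<top>"
  using E0_pos moment_finite Gamma_pos by (simp_all add: ennreal_mult_less_top)

text \<open>Let \<open>X\<close> and \<open>X'\<close> be the integrals of the positive and negative
  parts of \<open>1 + g\<close> against the random measure. Then \<open>1 + S = (X - X') / T\<close>
  is positive, so \<open>X' \<le> X\<close> almost surely, and \<open>drift_zero\<close> shows that
  the negative part meets no jumps. This is the first claim, and it gives \<open>X' = 0\<close>
  almost surely for the second.\<close>

lemma
  shows AE_nonneg: "AE y in \<eta>. 0 \<le> 1 + g y \<or> no_jumps y"
    and AE_w: "AE \<omega> in M. 0 < pint (jump w) \<omega> \<and> pint (jump w) \<omega> < \<top>
      \<and> 1 + S (nrm h (N \<omega>)) = enn2real (pint (jump w) \<omega>) / enn2real (mass \<omega>)"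
proof -
  define wn where "wn y = ennreal (- (1 + g y))" for y
  have [measurable]: "wn \<in> borel_measurable borel" unfolding wn_def[abs_def] by measurable
  have both: "AE \<omega> in M. (pint (jump w) \<omega> < \<top> \<and> pint (jump wn) \<omega> < \<top>) \<and> 0 < 1 + S (nrm h (N \<omega>))
      \<and> 1 + S (nrm h (N \<omega>)) = enn2real (pint (jump w) \<omega>) / enn2real (mass \<omega>)
        - enn2real (pint (jump wn) \<omega>) / enn2real (mass \<omega>)"
    using AE_mass AE_prob_nrm S_eq AE_space
  proof eventually_elim
    case (elim \<omega>)
    interpret P: prob_space "nrm h (N \<omega>)" by (rule elim)
    have i: "integrable (nrm h (N \<omega>)) (\<lambda>y. 1 + g y)" using elim by simp
    have p: "(\<integral>\<^sup>+y. w y \<partial>nrm h (N \<omega>)) = pint (jump w) \<omega> / mass \<omega>"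
      "(\<integral>\<^sup>+y. wn y \<partial>nrm h (N \<omega>)) = pint (jump wn) \<omega> / mass \<omega>"
      using elim(4) by (intro nn_integral_nrm, simp_all)+
    have cancel: "x < \<top>" if "x / mass \<omega> < \<top>" for x
    proof -
      have "mass \<omega> / mass \<omega> = 1" using elim(1) by (intro ennreal_divide_self) (simp_all add: zero_less_iff_neq_zero)
      then have "x = x / mass \<omega> * mass \<omega>"
        by (simp add: divide_ennreal_def mult.assoc mult.commute[of "inverse _"])
      also have "\<dots> < \<top>" using that elim(1) by (simp add: ennreal_mult_less_top)
      finally show ?thesis .
    qed
    have "(\<integral>\<^sup>+y. w y \<partial>nrm h (N \<omega>)) \<le> (\<integral>\<^sup>+y. ennreal (norm (1 + g y)) \<partial>nrm h (N \<omega>))"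
      "(\<integral>\<^sup>+y. wn y \<partial>nrm h (N \<omega>)) \<le> (\<integral>\<^sup>+y. ennreal (norm (1 + g y)) \<partial>nrm h (N \<omega>))"
      by (auto intro!: nn_integral_mono ennreal_leI simp: wn_def)
    moreover have "(\<integral>\<^sup>+y. ennreal (norm (1 + g y)) \<partial>nrm h (N \<omega>)) < \<top>"
      using i by (simp add: integrable_iff_bounded)
    ultimately have fin: "(\<integral>\<^sup>+y. w y \<partial>nrm h (N \<omega>)) < \<top>" "(\<integral>\<^sup>+y. wn y \<partial>nrm h (N \<omega>)) < \<top>"
      by (meson le_less_trans)+
    have "1 + S (nrm h (N \<omega>)) = (LINT y|nrm h (N \<omega>). 1 + g y)"
      using elim by (simp add: P.prob_space)
    also have "\<dots> = enn2real (\<integral>\<^sup>+y. w y \<partial>nrm h (N \<omega>)) - enn2real (\<integral>\<^sup>+y. wn y \<partial>nrm h (N \<omega>))"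
      unfolding wn_def by (rule real_lebesgue_integral_def[OF i])
    also have "\<dots> = enn2real (pint (jump w) \<omega>) / enn2real (mass \<omega>) - enn2real (pint (jump wn) \<omega>) / enn2real (mass \<omega>)"
    proof -
      obtain m where m: "mass \<omega> = ennreal m" "0 < m" using elim(1) by (cases "mass \<omega>") auto
      have "enn2real (x / mass \<omega>) = enn2real x / enn2real (mass \<omega>)" for x
        using m by (cases x) (simp_all add: divide_ennreal ennreal_top_divide)
      then show ?thesis unfolding p by simp
    qed
    finally show ?case
      using elim(3) cancel[OF fin(1)[unfolded p]] cancel[OF fin(2)[unfolded p]] by simp
  qed
  have "(\<integral>\<^sup>+x. jump wn x \<partial>intensity \<rho> \<eta>) = 0"
  proof (rule drift_zero)
    show "w y = 0 \<or> wn y = 0" for y by (auto simp: wn_def ennreal_eq_0_iff)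
    show "AE \<omega> in M. pint (jump wn) \<omega> \<le> pint (jump w) \<omega> \<and> pint (jump w) \<omega> < \<top>"
      using both AE_mass
    proof eventually_elim
      case (elim \<omega>)
      then have "0 < enn2real (mass \<omega>)" by (cases "mass \<omega>") auto
      moreover have "enn2real (pint (jump wn) \<omega>) / enn2real (mass \<omega>) < enn2real (pint (jump w) \<omega>) / enn2real (mass \<omega>)"
        using elim by linarith
      ultimately have "enn2real (pint (jump wn) \<omega>) \<le> enn2real (pint (jump w) \<omega>)"
        by (simp add: divide_less_cancel)
      then show ?case using elim by (metis ennreal_enn2real ennreal_leI)
    qed
  qed simp_all
  note zero = this
  have "(\<integral>\<^sup>+\<omega>. pint (jump wn) \<omega> \<partial>M) = 0"
    using mecke_exponential[of "jump wn" "\<lambda>_. 0"] zero by (simp add: pint_def measurable_intensity)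
  then have n0: "AE \<omega> in M. pint (jump wn) \<omega> = 0"
    by (subst (asm) nn_integral_0_iff_AE) simp_all
  show "AE \<omega> in M. 0 < pint (jump w) \<omega> \<and> pint (jump w) \<omega> < \<top>
      \<and> 1 + S (nrm h (N \<omega>)) = enn2real (pint (jump w) \<omega>) / enn2real (mass \<omega>)"
    using both n0
  proof eventually_elim
    case (elim \<omega>)
    then have e: "1 + S (nrm h (N \<omega>)) = enn2real (pint (jump w) \<omega>) / enn2real (mass \<omega>)" by simp
    have "pint (jump w) \<omega> \<noteq> 0"
    proof
      assume "pint (jump w) \<omega> = 0"
      then have "enn2real (pint (jump w) \<omega>) / enn2real (mass \<omega>) = 0" by simp
      moreover have "0 < 1 + S (nrm h (N \<omega>))" using elim by blast
      ultimately show False using e by linarith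
    qed
    then show ?case using elim e by (simp add: zero_less_iff_neq_zero)
  qed
  have "(\<integral>\<^sup>+y. (\<integral>\<^sup>+s. jump wn (s, y) \<partial>\<rho> y) \<partial>\<eta>) = 0"
    using zero by (subst (asm) nn_integral_intensity) simp_all
  moreover have "(\<integral>\<^sup>+s. jump wn (s, y) \<partial>\<rho> y) = (\<integral>\<^sup>+s. ennreal (h s) \<partial>\<rho> y) * wn y" for y
    unfolding jump_def by (simp add: nn_integral_multc)
  ultimately have "(\<integral>\<^sup>+y. (\<integral>\<^sup>+s. ennreal (h s) \<partial>\<rho> y) * wn y \<partial>\<eta>) = 0" by simp
  then have "AE y in \<eta>. (\<integral>\<^sup>+s. ennreal (h s) \<partial>\<rho> y) * wn y = 0"
    by (subst (asm) nn_integral_0_iff_AE) measurable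
  then show "AE y in \<eta>. 0 \<le> 1 + g y \<or> no_jumps y"
    unfolding no_jumps_iff by eventually_elim (auto simp: wn_def ennreal_eq_0_iff)
qed

lemma nn_integral_P_tilde:
  assumes [measurable]: "F \<in> borel_measurable (subprob_algebra borel)"
  shows "(\<integral>\<^sup>+P. F P \<partial>Q) = (\<integral>\<^sup>+\<omega>. ennreal (enn2real (total_mass h (N \<omega>)) powr (- \<theta>)) / E0 * F (nrm h (N \<omega>)) \<partial>M)"
  unfolding P_tilde_def
  by (subst nn_integral_distr) (simp_all add: nn_integral_density)

lemma sets_Q [measurable_cong]: "sets Q = sets (subprob_algebra borel)"
  by (simp add: P_tilde_def)

lemma measurable_emeasure_PiM [measurable]:
  assumes B: "B \<in> sets (sample_space k)"
  shows "(\<lambda>P. emeasure (PiM {1..k} (\<lambda>_. P)) B) \<in> borel_measurable (subprob_algebra (borel :: 'y measure))"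
  by (rule measurable_compose[OF measurable_PiM_subprob measurable_emeasure_subprob_algebra[OF B]]) simp

text \<open>Pointwise, \<open>T powr -\<theta> * (X / T) powr -(\<theta> + n) = X powr -(\<theta> +
  n) * T ^ n\<close>, which turns the tilted expectation into the left side of
  \<open>mixture_identity\<close>. The pair \<open>R\<close>, \<open>u\<close> is kept general:
  \<open>S\<close>, \<open>1 + g\<close> gives the transform, and \<open>0\<close>, \<open>1\<close>
  the law of the sample.\<close>

lemma tilde_identity:
  fixes u :: "'y \<Rightarrow> ennreal"
  assumes R [measurable]: "R \<in> borel_measurable (subprob_algebra borel)"
    and u [measurable]: "u \<in> borel_measurable borel"
    and AE_u: "AE \<omega> in M. 0 < pint (jump u) \<omega> \<and> pint (jump u) \<omega> < \<top>
      \<and> 1 + R (nrm h (N \<omega>)) = enn2real (pint (jump u) \<omega>) / enn2real (mass \<omega>)"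
    and B [measurable]: "B \<in> sets (sample_space n)"
  shows "D * (\<integral>\<^sup>+P. ennreal ((1 + R P) powr (- a)) * emeasure (PiM {1..n} (\<lambda>_. P)) B \<partial>Q)
    = (\<Sum>p | partition_on {1..n} p. \<integral>\<^sup>+Ys. mix_density u a p Ys * indicator B (unties n p Ys) \<partial>PiM p (\<lambda>_. \<eta>))"
proof -
  have [measurable]: "(\<lambda>\<omega>. emeasure (PiM {1..n} (\<lambda>_. nrm h (N \<omega>))) B) \<in> borel_measurable M"
    by (rule measurable_compose[OF measurable_nrm measurable_emeasure_PiM[OF B]])
  have "(\<integral>\<^sup>+P. ennreal ((1 + R P) powr (- a)) * emeasure (PiM {1..n} (\<lambda>_. P)) B \<partial>Q)
      = (\<integral>\<^sup>+\<omega>. ennreal (enn2real (total_mass h (N \<omega>)) powr (- \<theta>)) / E0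
          * (ennreal ((1 + R (nrm h (N \<omega>))) powr (- a)) * emeasure (PiM {1..n} (\<lambda>_. nrm h (N \<omega>))) B) \<partial>M)"
    by (rule nn_integral_P_tilde) measurable
  also have "\<dots> = (\<integral>\<^sup>+\<omega>. (ennreal (enn2real (pint (jump u) \<omega>) powr - a)
        * (mass \<omega> ^ n * emeasure (PiM {1..n} (\<lambda>_. nrm h (N \<omega>))) B)) / E0 \<partial>M)"
  proof (rule nn_integral_cong_AE)
    show "AE \<omega> in M. ennreal (enn2real (total_mass h (N \<omega>)) powr (- \<theta>)) / E0
          * (ennreal ((1 + R (nrm h (N \<omega>))) powr (- a)) * emeasure (PiM {1..n} (\<lambda>_. nrm h (N \<omega>))) B)
        = (ennreal (enn2real (pint (jump u) \<omega>) powr - a)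
        * (mass \<omega> ^ n * emeasure (PiM {1..n} (\<lambda>_. nrm h (N \<omega>))) B)) / E0"
      using AE_mass AE_u AE_space
    proof eventually_elim
      case (elim \<omega>)
      obtain m where m: "mass \<omega> = ennreal m" "0 < m"
        using elim(1) by (cases "mass \<omega>") auto
      obtain x where x: "pint (jump u) \<omega> = ennreal x" "0 < x"
        using elim(2) by (cases "pint (jump u) \<omega>") auto
      have "(x / m) powr (- b) = x powr (- b) * m powr b" for b
        using m(2) x(2) by (simp add: powr_divide powr_minus field_simps)
      then have "m powr (- \<theta>) * (x / m) powr (- a) = x powr (- a) * (m powr (- \<theta>) * m powr a)"
        by (simp only: mult.left_commute)
      also have "m powr (- \<theta>) * m powr a = m ^ n"
        using m(2) by (simp add: powr_add[symmetric] powr_realpow)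
      finally have "ennreal (m powr (- \<theta>)) * ennreal ((x / m) powr (- a)) = ennreal (x powr (- a)) * ennreal m ^ n"
        using m(2) by (simp add: ennreal_mult[symmetric] ennreal_power)
      then have "ennreal (m powr (- \<theta>)) * (ennreal ((x / m) powr (- a)) * c) = ennreal (x powr (- a)) * (ennreal m ^ n * c)" for c
        by (simp only: mult.assoc[symmetric])
      moreover have "b / E0 * c = b * c / E0" for b c
        by (simp add: divide_ennreal_def ac_simps)
      ultimately show ?case
        using m x elim by (simp add: total_mass_eq less_imp_le)
    qed
  qed
  also have "\<dots> = (\<integral>\<^sup>+\<omega>. ennreal (enn2real (pint (jump u) \<omega>) powr - a)
        * (mass \<omega> ^ n * emeasure (PiM {1..n} (\<lambda>_. nrm h (N \<omega>))) B) \<partial>M) / E0"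
    by (rule nn_integral_divide) measurable
  finally have e: "(\<integral>\<^sup>+P. ennreal ((1 + R P) powr (- a)) * emeasure (PiM {1..n} (\<lambda>_. P)) B \<partial>Q) = \<dots>" .
  have "E0 * (x / E0) = x" for x
    using ennreal_divide_self[OF E0_pos moment_finite]
    by (simp add: divide_ennreal_def mult.left_commute[of E0])
  then have "D * (\<integral>\<^sup>+P. ennreal ((1 + R P) powr (- a)) * emeasure (PiM {1..n} (\<lambda>_. P)) B \<partial>Q)
      = ennreal (Gamma a) * (\<integral>\<^sup>+\<omega>. ennreal (enn2real (pint (jump u) \<omega>) powr - a)
        * (mass \<omega> ^ n * emeasure (PiM {1..n} (\<lambda>_. nrm h (N \<omega>))) B) \<partial>M)"
    unfolding e by (simp add: mult.assoc)
  also have "\<dots> = (\<Sum>p | partition_on {1..n} p. \<integral>\<^sup>+Ys. mix_density u a p Ys * indicator B (unties n p Ys) \<partial>PiM p (\<lambda>_. \<eta>))"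
  proof (rule mixture_identity[OF u B shape_pos])
    show "AE \<omega> in M. 0 < pint (jump u) \<omega> \<and> pint (jump u) \<omega> < \<top>"
      using AE_u by eventually_elim simp
  qed
  finally show ?thesis .
qed

lemma transform_identity:
  assumes "B \<in> sets (sample_space n)"
  shows "D * (\<integral>\<^sup>+P. G P * emeasure (PiM {1..n} (\<lambda>_. P)) B \<partial>Q)
    = (\<Sum>p | partition_on {1..n} p. \<integral>\<^sup>+Ys. mix_density w a p Ys * indicator B (unties n p Ys) \<partial>PiM p (\<lambda>_. \<eta>))"
  by (rule tilde_identity[OF S_meas _ AE_w assms]) measurable

section \<open>Joint and marginal law of the random measure and the sample\<close>

lemma measurable_joint_kernel:
  "(\<lambda>p. distr (PiM {1..n} (\<lambda>_. p)) (subprob_algebra borel \<Otimes>\<^sub>M sample_space n) (Pair p))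
    \<in> subprob_algebra (borel :: 'y measure) \<rightarrow>\<^sub>M subprob_algebra (subprob_algebra borel \<Otimes>\<^sub>M sample_space n)"
  by (rule measurable_distr2[OF _ measurable_PiM_subprob]) simp_all

lemma space_Q: "space Q = space (subprob_algebra borel)"
  using sets_Q by (rule sets_eq_imp_space_eq)

lemma Q_nonempty: "space Q \<noteq> {}"
proof -
  obtain \<omega> where "\<omega> \<in> space M" using not_empty by blast
  then have "nrm h (N \<omega>) \<in> space Q" using measurable_space[OF measurable_nrm] by (simp add: space_Q)
  then show ?thesis by blast
qed

lemma measurable_joint_kernel_Q:
  "(\<lambda>p. distr (PiM {1..n} (\<lambda>_. p)) (subprob_algebra borel \<Otimes>\<^sub>M sample_space n) (Pair p))
    \<in> Q \<rightarrow>\<^sub>M subprob_algebra (subprob_algebra borel \<Otimes>\<^sub>M sample_space n)"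
  using measurable_joint_kernel measurable_cong_sets[OF sets_Q refl] by blast

lemma sets_joint: "sets (joint_law n Q) = sets (subprob_algebra borel \<Otimes>\<^sub>M sample_space n)"
  unfolding joint_law_def by (rule sets_bind_measurable[OF measurable_joint_kernel_Q Q_nonempty])

lemma emeasure_joint:
  assumes A [measurable]: "A \<in> sets (subprob_algebra borel)" and B [measurable]: "B \<in> sets (sample_space n)"
  shows "emeasure (joint_law n Q) (A \<times> B) = (\<integral>\<^sup>+P. indicator A P * emeasure (PiM {1..n} (\<lambda>_. P)) B \<partial>Q)"
proof -
  have "emeasure (joint_law n Q) (A \<times> B) = (\<integral>\<^sup>+P. emeasure (distr (PiM {1..n} (\<lambda>_. P))
      (subprob_algebra borel \<Otimes>\<^sub>M sample_space n) (Pair P)) (A \<times> B) \<partial>Q)"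
    unfolding joint_law_def by (rule emeasure_bind[OF Q_nonempty measurable_joint_kernel_Q]) measurable
  also have "\<dots> = (\<integral>\<^sup>+P. indicator A P * emeasure (PiM {1..n} (\<lambda>_. P)) B \<partial>Q)"
  proof (rule nn_integral_cong)
    fix P assume "P \<in> space Q"
    then have P: "P \<in> space (subprob_algebra borel)" by (simp add: space_Q)
    then have s: "sets (PiM {1..n} (\<lambda>_. P)) = sets (sample_space n)"
      by (intro sets_PiM_cong) (auto simp: space_subprob_algebra)
    note [measurable_cong] = s
    have [measurable]: "Pair P \<in> PiM {1..n} (\<lambda>_. P) \<rightarrow>\<^sub>M subprob_algebra borel \<Otimes>\<^sub>M sample_space n"
      using P by measurable
    have "Pair P -` (A \<times> B) \<inter> space (PiM {1..n} (\<lambda>_. P)) = (if P \<in> A then B else {})"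
      using sets.sets_into_space[OF B] sets_eq_imp_space_eq[OF s] by auto
    then show "emeasure (distr (PiM {1..n} (\<lambda>_. P)) (subprob_algebra borel \<Otimes>\<^sub>M sample_space n) (Pair P)) (A \<times> B)
        = indicator A P * emeasure (PiM {1..n} (\<lambda>_. P)) B"
      by (subst emeasure_distr) auto
  qed
  finally show ?thesis .
qed

lemma sets_marginal [measurable_cong]: "sets (marginal_law n Q) = sets (sample_space n)"
  by (simp add: marginal_law_def)

lemma emeasure_marginal:
  assumes B [measurable]: "B \<in> sets (sample_space n)"
  shows "emeasure (marginal_law n Q) B = (\<integral>\<^sup>+P. emeasure (PiM {1..n} (\<lambda>_. P)) B \<partial>Q)"
proof -
  have [measurable]: "snd \<in> joint_law n Q \<rightarrow>\<^sub>M sample_space n"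
    using measurable_snd measurable_cong_sets[OF sets_joint refl] by blast
  have "emeasure (marginal_law n Q) B = emeasure (joint_law n Q) (space (subprob_algebra borel) \<times> B)"
    unfolding marginal_law_def
    using sets.sets_into_space[OF B] sets_eq_imp_space_eq[OF sets_joint]
    by (subst emeasure_distr) (auto simp: space_pair_measure intro!: arg_cong2[where f=emeasure])
  also have "\<dots> = (\<integral>\<^sup>+P. emeasure (PiM {1..n} (\<lambda>_. P)) B \<partial>Q)"
    by (subst emeasure_joint) (auto simp: space_Q intro!: nn_integral_cong)
  finally show ?thesis .
qed

end

section \<open>Conditional and unconditional mixing densities\<close>

context stieltjes_setting
begin

lemma AE_mass_ratio: "AE \<omega> in M. 0 < mass \<omega> \<and> mass \<omega> < \<top> \<and> 1 + (0::real) = enn2real (mass \<omega>) / enn2real (mass \<omega>)"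
  using AE_mass
proof eventually_elim
  case (elim \<omega>)
  then have "0 < enn2real (mass \<omega>)" by (cases "mass \<omega>") auto
  with elim show ?case by simp
qed

lemma marginal_identity:
  assumes "B \<in> sets (sample_space n)"
  shows "D * emeasure (marginal_law n Q) B
    = (\<Sum>p | partition_on {1..n} p. \<integral>\<^sup>+Ys. unit_density p Ys * indicator B (unties n p Ys) \<partial>PiM p (\<lambda>_. \<eta>))"
proof -
  have "D * (\<integral>\<^sup>+P. ennreal ((1 + 0) powr (- a)) * emeasure (PiM {1..n} (\<lambda>_. P)) B \<partial>Q)
    = (\<Sum>p | partition_on {1..n} p. \<integral>\<^sup>+Ys. unit_density p Ys * indicator B (unties n p Ys) \<partial>PiM p (\<lambda>_. \<eta>))"
    by (rule tilde_identity[OF _ _ AE_mass_ratio assms]) measurable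
  then show ?thesis by (simp add: emeasure_marginal[OF assms])
qed

lemma D_divide: "D * x / D = x"
  using ennreal_mult_divide_eq[OF D_pos, of x] D_finite by (simp add: mult.commute less_imp_neq)

lemma measurable_mix_density [measurable]:
  assumes [measurable]: "u \<in> borel_measurable borel"
  shows "mix_density u b p \<in> borel_measurable (PiM p (\<lambda>_. \<eta>))"
  unfolding mix_density_def[abs_def] by measurable

text \<open>\<open>marginal_identity\<close> exhibits the law of the sample as a sum over partitions
  of the images under \<open>unties\<close> of measures with density
  \<open>unit_density p / D\<close>; integrals follow from the values on sets.\<close>

lemma nn_integral_marginal:
  assumes F: "F \<in> borel_measurable (sample_space n)"
  shows "(\<integral>\<^sup>+Y. F Y \<partial>marginal_law n Q)
    = (\<Sum>p | partition_on {1..n} p. \<integral>\<^sup>+Ys. unit_density p Ys / D * F (unties n p Ys) \<partial>PiM p (\<lambda>_. \<eta>))"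
proof -
  define L where "L p = distr (density (PiM p (\<lambda>_. \<eta>)) (\<lambda>Ys. unit_density p Ys / D)) (sample_space n) (unties n p)" for p
  have int: "(\<integral>\<^sup>+Y. H Y \<partial>L p) = (\<integral>\<^sup>+Ys. unit_density p Ys / D * H (unties n p Ys) \<partial>PiM p (\<lambda>_. \<eta>))"
    if p: "partition_on {1..n} p" and [measurable]: "H \<in> borel_measurable (sample_space n)" for H p
  proof -
    have [measurable]: "unties n p \<in> PiM p (\<lambda>_. \<eta>) \<rightarrow>\<^sub>M sample_space n"
      using p by (rule measurable_unties_eta)
    have "(\<integral>\<^sup>+Y. H Y \<partial>L p) = (\<integral>\<^sup>+Ys. H (unties n p Ys) \<partial>density (PiM p (\<lambda>_. \<eta>)) (\<lambda>Ys. unit_density p Ys / D))"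
      unfolding L_def by (rule nn_integral_distr) measurable
    also have "\<dots> = (\<integral>\<^sup>+Ys. unit_density p Ys / D * H (unties n p Ys) \<partial>PiM p (\<lambda>_. \<eta>))"
      by (rule nn_integral_density) measurable
    finally show ?thesis .
  qed
  have "(\<integral>\<^sup>+Y. F Y \<partial>marginal_law n Q) = (\<Sum>p | partition_on {1..n} p. \<integral>\<^sup>+Y. F Y \<partial>L p)"
  proof (rule nn_integral_eq_sum_of_measures)
    show "finite {p. partition_on {1..n} p}" by (intro finitely_many_partition_on) simp
    show "sets (L p) = sets (marginal_law n Q)" for p by (simp add: L_def sets_marginal)
    show "F \<in> borel_measurable (marginal_law n Q)"
      using F measurable_cong_sets[OF sets_marginal refl] by blast
    fix B assume "B \<in> sets (marginal_law n Q)"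
    then have B [measurable]: "B \<in> sets (sample_space n)" by (simp add: sets_marginal)
    have "emeasure (marginal_law n Q) B = D * emeasure (marginal_law n Q) B / D"
      by (rule D_divide[symmetric])
    also have "\<dots> = (\<Sum>p | partition_on {1..n} p. (\<integral>\<^sup>+Ys. unit_density p Ys * indicator B (unties n p Ys) \<partial>PiM p (\<lambda>_. \<eta>)) / D)"
      unfolding marginal_identity[OF B] divide_ennreal_def by (rule sum_distrib_right)
    also have "\<dots> = (\<Sum>p | partition_on {1..n} p. emeasure (L p) B)"
    proof (rule sum.cong[OF refl])
      fix p assume "p \<in> {p. partition_on {1..n} p}"
      then have p: "partition_on {1..n} p" by simp
      have [measurable]: "unties n p \<in> PiM p (\<lambda>_. \<eta>) \<rightarrow>\<^sub>M sample_space n"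
        using p by (rule measurable_unties_eta)
      have "emeasure (L p) B = (\<integral>\<^sup>+Y. indicator B Y \<partial>L p)"
        using B by (simp add: L_def)
      also have "\<dots> = (\<integral>\<^sup>+Ys. unit_density p Ys / D * indicator B (unties n p Ys) \<partial>PiM p (\<lambda>_. \<eta>))"
        by (rule int[OF p]) measurable
      also have "\<dots> = (\<integral>\<^sup>+Ys. (unit_density p Ys * indicator B (unties n p Ys)) / D \<partial>PiM p (\<lambda>_. \<eta>))"
        by (intro nn_integral_cong) (simp add: divide_ennreal_def ac_simps)
      also have "\<dots> = (\<integral>\<^sup>+Ys. unit_density p Ys * indicator B (unties n p Ys) \<partial>PiM p (\<lambda>_. \<eta>)) / D"
        by (rule nn_integral_divide) measurable
      finally show "(\<integral>\<^sup>+Ys. unit_density p Ys * indicator B (unties n p Ys) \<partial>PiM p (\<lambda>_. \<eta>)) / D = emeasure (L p) B" ..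
    qed
    finally show "emeasure (marginal_law n Q) B = \<dots>" .
  qed
  also have "\<dots> = (\<Sum>p | partition_on {1..n} p. \<integral>\<^sup>+Ys. unit_density p Ys / D * F (unties n p Ys) \<partial>PiM p (\<lambda>_. \<eta>))"
    using F by (intro sum.cong refl int) simp_all
  finally show ?thesis .
qed

text \<open>The encoding inverts \<open>unties\<close> wherever the block values are distinct, that
  is almost everywhere.\<close>

lemma AE_ties:
  assumes p: "partition_on {1..n} p"
  shows "AE Ys in PiM p (\<lambda>_. \<eta>). ties n (unties n p Ys) = p \<and> distinct_values n (unties n p Ys) = Ys"
proof -
  have fin: "finite p" using finite_elements[OF _ p] by simp
  show ?thesis
    using AE_inj_on[OF na fin] AE_space
  proof eventually_elim
    case (elim Ys)
    then have "Ys \<in> extensional p" by (simp add: space_PiM PiE_iff)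
    with elim show ?case using ties_unties[OF p] distinct_values_unties[OF p] by blast
  qed
qed

lemma measurable_representatives:
  assumes p: "partition_on {1..n} p"
  shows "(\<lambda>Y. \<lambda>C\<in>p. Y (Min C)) \<in> sample_space n \<rightarrow>\<^sub>M PiM p (\<lambda>_. borel)"
proof (rule measurable_restrict)
  fix C assume "C \<in> p"
  then have "Min C \<in> {1..n}" using Min_in_block[OF p] partition_onD1[OF p] by blast
  then show "(\<lambda>Y. Y (Min C)) \<in> sample_space n \<rightarrow>\<^sub>M borel" by (rule measurable_component_singleton)
qed

lemma distinct_values_eq: "ties n Y = p \<Longrightarrow> distinct_values n Y = (\<lambda>C\<in>p. Y (Min C))"
  by (simp add: distinct_values_def)

text \<open>In the sum over partitions \<open>p'\<close> for the law of the sample, the image under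
  \<open>unties n p'\<close> has partition \<open>p'\<close> almost everywhere, so the restriction
  to partition \<open>p\<close> keeps a single summand.\<close>

lemma nn_integral_marginal_part:
  assumes p: "partition_on {1..n} p" and F [measurable]: "F \<in> borel_measurable (PiM p (\<lambda>_. borel))"
  shows "(\<integral>\<^sup>+Ys. F Ys \<partial>marginal_part n Q p) = (\<integral>\<^sup>+Ys. unit_density p Ys / D * F Ys \<partial>PiM p (\<lambda>_. \<eta>))"
proof -
  \<comment> \<open>\<open>distinct_values n Y\<close> has an index set that varies with
    \<open>Y\<close>; \<open>R\<close> agrees with it on the event \<open>E\<close> and is
    measurable everywhere.\<close>
  define R where "R Y = (\<lambda>C\<in>p. Y (Min C))" for Y :: "nat \<Rightarrow> 'y"
  define E where "E = {Y \<in> space (sample_space n :: (nat \<Rightarrow> 'y) measure). ties n Y = p}"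
  have R [measurable]: "R \<in> sample_space n \<rightarrow>\<^sub>M PiM p (\<lambda>_. borel)"
    unfolding R_def[abs_def] by (rule measurable_representatives[OF p])
  have E [measurable]: "E \<in> sets (sample_space n)" unfolding E_def by (rule sets_ties[OF p])
  have sp: "space (marginal_law n Q) = space (sample_space n)" using sets_marginal by (rule sets_eq_imp_space_eq)
  have E': "{Y. ties n Y = p} \<inter> space (marginal_law n Q) = E" by (auto simp: E_def sp)
  have dv: "distinct_values n \<in> restrict_space (marginal_law n Q) {Y. ties n Y = p} \<rightarrow>\<^sub>M PiM p (\<lambda>_. borel)"
  proof (rule measurable_cong[THEN iffD1, OF _ measurable_restrict_space1])
    show "R \<in> marginal_law n Q \<rightarrow>\<^sub>M PiM p (\<lambda>_. borel)"
      using R measurable_cong_sets[OF sets_marginal refl] by blast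
    show "R Y = distinct_values n Y" if "Y \<in> space (restrict_space (marginal_law n Q) {Y. ties n Y = p})" for Y
      using that distinct_values_eq[of Y p] by (simp add: space_restrict_space R_def)
  qed
  have "(\<integral>\<^sup>+Ys. F Ys \<partial>marginal_part n Q p)
      = (\<integral>\<^sup>+Y. F (distinct_values n Y) \<partial>restrict_space (marginal_law n Q) {Y. ties n Y = p})"
    unfolding marginal_part_def by (rule nn_integral_distr[OF dv]) simp
  also have "\<dots> = (\<integral>\<^sup>+Y. F (distinct_values n Y) * indicator {Y. ties n Y = p} Y \<partial>marginal_law n Q)"
    using E by (intro nn_integral_restrict_space) (simp add: E' sets_marginal)
  also have "\<dots> = (\<integral>\<^sup>+Y. F (R Y) * indicator E Y \<partial>marginal_law n Q)"
  proof (rule nn_integral_cong)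
    fix Y assume "Y \<in> space (marginal_law n Q)"
    then show "F (distinct_values n Y) * indicator {Y. ties n Y = p} Y = F (R Y) * indicator E Y"
      using distinct_values_eq[of Y p] by (cases "ties n Y = p") (simp_all add: E_def sp R_def)
  qed
  also have "\<dots> = (\<Sum>p' | partition_on {1..n} p'. \<integral>\<^sup>+Ys. unit_density p' Ys / D
      * (F (R (unties n p' Ys)) * indicator E (unties n p' Ys)) \<partial>PiM p' (\<lambda>_. \<eta>))"
    by (rule nn_integral_marginal) measurable
  also have "\<dots> = (\<Sum>p'\<in>{p}. \<integral>\<^sup>+Ys. unit_density p' Ys / D
      * (F (R (unties n p' Ys)) * indicator E (unties n p' Ys)) \<partial>PiM p' (\<lambda>_. \<eta>))"
  proof (rule sum.mono_neutral_right)
    show "finite {p'. partition_on {1..n} p'}" by (intro finitely_many_partition_on) simp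
    show "{p} \<subseteq> {p'. partition_on {1..n} p'}" using p by simp
    show "\<forall>p'\<in>{p'. partition_on {1..n} p'} - {p}. (\<integral>\<^sup>+Ys. unit_density p' Ys / D
      * (F (R (unties n p' Ys)) * indicator E (unties n p' Ys)) \<partial>PiM p' (\<lambda>_. \<eta>)) = 0"
    proof
      fix p' assume p': "p' \<in> {p'. partition_on {1..n} p'} - {p}"
      then have q: "partition_on {1..n} p'" and ne: "p' \<noteq> p" by simp_all
      have "AE Ys in PiM p' (\<lambda>_. \<eta>). unit_density p' Ys / D
          * (F (R (unties n p' Ys)) * indicator E (unties n p' Ys)) = 0"
        using AE_ties[OF q]
      proof eventually_elim
        case (elim Ys)
        then have "unties n p' Ys \<notin> E" using ne by (simp add: E_def)
        then show ?case by simp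
      qed
      then show "(\<integral>\<^sup>+Ys. unit_density p' Ys / D
          * (F (R (unties n p' Ys)) * indicator E (unties n p' Ys)) \<partial>PiM p' (\<lambda>_. \<eta>)) = 0"
        by (simp add: nn_integral_cong_AE[where v="\<lambda>_. 0"])
    qed
  qed
  also have "\<dots> = (\<integral>\<^sup>+Ys. unit_density p Ys / D * F Ys \<partial>PiM p (\<lambda>_. \<eta>))"
  proof -
    have "AE Ys in PiM p (\<lambda>_. \<eta>). unit_density p Ys / D * (F (R (unties n p Ys)) * indicator E (unties n p Ys))
        = unit_density p Ys / D * F Ys"
      using AE_ties[OF p] AE_space
    proof eventually_elim
      case (elim Ys)
      have "unties n p Ys \<in> space (sample_space n)"
        using measurable_space[OF measurable_unties_eta[OF p] elim(2)] .
      then have "unties n p Ys \<in> E" using elim by (simp add: E_def)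
      moreover have "R (unties n p Ys) = Ys"
        using elim distinct_values_eq[of "unties n p Ys" p] by (simp add: R_def)
      ultimately show ?case by simp
    qed
    then show ?thesis by (simp add: nn_integral_cong_AE)
  qed
  finally show ?thesis .
qed

text \<open>What the conditional formulas produce literally, with \<open>jump_moment\<close> in
  place of \<open>kfun\<close>. It agrees with \<open>mix_density w a p\<close> unless some block
  value has jumps and \<open>1 + g < 0\<close> at once, hence almost everywhere.\<close>

definition tilted_density :: "nat set set \<Rightarrow> (nat set \<Rightarrow> 'y) \<Rightarrow> ennreal" where
  "tilted_density p Ys = (\<integral>\<^sup>+v. indicator {0<..} v * ennreal (v powr (a - 1)) * laplace_mass w v
      * (\<Prod>C\<in>p. jump_moment g v (card C) (Ys C)) \<partial>lborel)"

lemma measurable_tilted_density [measurable]: "tilted_density p \<in> borel_measurable (PiM p (\<lambda>_. \<eta>))"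
  unfolding tilted_density_def[abs_def] by measurable

lemma AE_tilted_density:
  assumes p: "partition_on {1..n} p"
  shows "AE Ys in PiM p (\<lambda>_. \<eta>). tilted_density p Ys = mix_density w a p Ys"
proof -
  have fin: "finite p" using finite_elements[OF _ p] by simp
  show ?thesis
    using AE_component[OF fin AE_nonneg]
  proof eventually_elim
    case (elim Ys)
    show ?case
      unfolding tilted_density_def mix_density_def
    proof (rule nn_integral_cong)
      fix v :: real
      show "indicator {0<..} v * ennreal (v powr (a - 1)) * laplace_mass w v * (\<Prod>C\<in>p. jump_moment g v (card C) (Ys C))
          = indicator {0<..} v * ennreal (v powr (a - 1)) * laplace_mass w v * (\<Prod>C\<in>p. kfun (card C) (\<lambda>y. ennreal v * w y) (Ys C))"
      proof (cases "0 < v")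
        case True
        have "(\<Prod>C\<in>p. jump_moment g v (card C) (Ys C)) = (\<Prod>C\<in>p. kfun (card C) (\<lambda>y. ennreal v * w y) (Ys C))"
          using elim by (intro prod.cong refl jump_moment_eq_kfun g_meas True) simp
        then show ?thesis by (simp only:)
      qed simp
    qed
  qed
qed

lemma mixing_weight_eq:
  "mixing_weight M N h \<rho> \<theta> n p Ys v = indicator {0<..} v * ennreal (v powr (a - 1)) * laplace_mass (\<lambda>_. 1) v
    * (\<Prod>C\<in>p. kappa h (card C) (tilt v h \<rho>) (Ys C))"
proof (cases "0 < v")
  case True
  then show ?thesis by (simp add: mixing_weight_def T_laplace_eq ac_simps)
qed (simp add: mixing_weight_def)

text \<open>The normalising constant of \<open>mixing_cond\<close> is the unnormalised density of
  the sample: this is the Bayes rule behind the posterior formula.\<close>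

lemma nn_integral_mixing_weight: "(\<integral>\<^sup>+v. mixing_weight M N h \<rho> \<theta> n p Ys v \<partial>lborel) = unit_density p Ys"
  unfolding mix_density_def
proof (rule nn_integral_cong)
  fix v :: real
  show "mixing_weight M N h \<rho> \<theta> n p Ys v = indicator {0<..} v * ennreal (v powr (a - 1)) * laplace_mass (\<lambda>_. 1) v
      * (\<Prod>C\<in>p. kfun (card C) (\<lambda>y. ennreal v * 1) (Ys C))"
    unfolding mixing_weight_eq by (cases "0 < v") (simp_all add: kappa_tilt_eq_kfun)
qed

lemma measurable_mixing_weight [measurable]:
  "(\<lambda>v. mixing_weight M N h \<rho> \<theta> n p Ys v) \<in> borel_measurable borel"
  unfolding mixing_weight_eq by measurable

abbreviation cond :: "nat set set \<Rightarrow> real \<Rightarrow> (nat set \<Rightarrow> 'y) \<Rightarrow> ennreal" where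
  "cond p v Ys \<equiv> laplace_cond h (\<lambda>y. v * g y) (tilt v h \<rho>) \<eta> p Ys"

lemma cond_eq:
  "cond p v Ys = ennreal (laplace h (\<lambda>y. v * g y) (tilt v h \<rho>) \<eta>)
    * (\<Prod>C\<in>p. jump_moment g v (card C) (Ys C) / kappa h (card C) (tilt v h \<rho>) (Ys C))"
  unfolding laplace_cond_def jump_moment_def ..

lemma measurable_cond [measurable]: "(\<lambda>v. cond p v Ys) \<in> borel_measurable borel"
  unfolding cond_eq by measurable

lemma measurable_cond_joint [measurable]:
  "(\<lambda>(v, Ys). cond p v Ys) \<in> borel_measurable (borel \<Otimes>\<^sub>M PiM p (\<lambda>_. \<eta>))"
  unfolding cond_eq by measurable

text \<open>Two cancellations: the product of \<open>kappa\<close> against the denominators in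
  \<open>cond\<close>, and \<open>laplace_ratio\<close>, which trades the Laplace transform of
  \<open>T\<close> for that of the integral of \<open>1 + g\<close>.\<close>

lemma cond_mult_kappa:
  assumes p: "partition_on {1..n} p" and v: "0 < v"
  shows "cond p v Ys * (\<Prod>C\<in>p. kappa h (card C) (tilt v h \<rho>) (Ys C)) * laplace_mass (\<lambda>_. 1) v
    = laplace_mass w v * (\<Prod>C\<in>p. jump_moment g v (card C) (Ys C))"
proof -
  have prod: "(\<Prod>C\<in>p. jump_moment g v (card C) (Ys C) / kappa h (card C) (tilt v h \<rho>) (Ys C))
      * (\<Prod>C\<in>p. kappa h (card C) (tilt v h \<rho>) (Ys C)) = (\<Prod>C\<in>p. jump_moment g v (card C) (Ys C))"
    unfolding prod.distrib[symmetric]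
    by (intro prod.cong refl jump_moment_cancel g_meas v card_block[OF p])
  have ratio: "ennreal (laplace h (\<lambda>y. v * g y) (tilt v h \<rho>) \<eta>) * laplace_mass (\<lambda>_. 1) v = laplace_mass w v"
  proof (rule laplace_ratio[OF g_meas AE_nonneg _ v])
    show "AE \<omega> in M. pint (jump w) \<omega> < \<top>" using AE_w by eventually_elim simp
  qed
  have "x * y * k * l = x * l * (y * k)" for x y k l :: ennreal
    by (simp only: ac_simps)
  then show ?thesis
    unfolding cond_eq prod[symmetric] ratio[symmetric] by this
qed

lemma cond_mult_weight:
  assumes p: "partition_on {1..n} p"
  shows "mixing_weight M N h \<rho> \<theta> n p Ys v * cond p v Ys
    = indicator {0<..} v * ennreal (v powr (a - 1)) * laplace_mass w v * (\<Prod>C\<in>p. jump_moment g v (card C) (Ys C))"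
proof (cases "0 < v")
  case True
  have "mixing_weight M N h \<rho> \<theta> n p Ys v * cond p v Ys = indicator {0<..} v * ennreal (v powr (a - 1))
      * (cond p v Ys * (\<Prod>C\<in>p. kappa h (card C) (tilt v h \<rho>) (Ys C)) * laplace_mass (\<lambda>_. 1) v)"
    unfolding mixing_weight_eq by (simp only: ac_simps)
  also have "\<dots> = indicator {0<..} v * ennreal (v powr (a - 1)) * laplace_mass w v * (\<Prod>C\<in>p. jump_moment g v (card C) (Ys C))"
    unfolding cond_mult_kappa[OF p True] by (simp only: mult.assoc)
  finally show ?thesis .
qed (simp add: mixing_weight_eq)

definition posterior_transform :: "nat set set \<Rightarrow> (nat set \<Rightarrow> 'y) \<Rightarrow> ennreal" where
  "posterior_transform p Ys = (\<integral>\<^sup>+v. cond p v Ys \<partial>mixing_cond M N h \<rho> \<theta> n p Ys)"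

lemma posterior_transform_eq:
  assumes p: "partition_on {1..n} p"
  shows "posterior_transform p Ys = tilted_density p Ys / unit_density p Ys"
proof -
  have "posterior_transform p Ys = (\<integral>\<^sup>+v. mixing_weight M N h \<rho> \<theta> n p Ys v / unit_density p Ys * cond p v Ys \<partial>lborel)"
    unfolding posterior_transform_def mixing_cond_def nn_integral_mixing_weight
    by (rule nn_integral_density) measurable
  also have "\<dots> = (\<integral>\<^sup>+v. (mixing_weight M N h \<rho> \<theta> n p Ys v * cond p v Ys) / unit_density p Ys \<partial>lborel)"
    by (intro nn_integral_cong) (simp add: divide_ennreal_def ac_simps)
  also have "\<dots> = (\<integral>\<^sup>+v. mixing_weight M N h \<rho> \<theta> n p Ys v * cond p v Ys \<partial>lborel) / unit_density p Ys"
    by (rule nn_integral_divide) measurable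
  finally show ?thesis
    unfolding cond_mult_weight[OF p] tilted_density_def .
qed

lemma measurable_posterior_transform:
  assumes p: "partition_on {1..n} p"
  shows "posterior_transform p \<in> borel_measurable (PiM p (\<lambda>_. borel))"
proof -
  have "(\<lambda>Ys. tilted_density p Ys / unit_density p Ys) \<in> borel_measurable (PiM p (\<lambda>_. \<eta>))" by measurable
  then show ?thesis
    unfolding posterior_transform_eq[OF p, abs_def] using measurable_cong_sets[OF sets_PiM_eta refl] by blast
qed

text \<open>Where the density of the sample is 0, the mixing weight vanishes for almost every
  \<open>v\<close>, so the numerator is 0 too. Where it is infinite the quotient loses the
  numerator, which \<open>fin\<close> excludes.\<close>

lemma posterior_transform_mult:
  assumes p: "partition_on {1..n} p" and fin: "unit_density p Ys < \<top>"
  shows "unit_density p Ys / D * posterior_transform p Ys = tilted_density p Ys / D"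
proof (cases "unit_density p Ys = 0")
  case True
  then have "AE v in lborel. mixing_weight M N h \<rho> \<theta> n p Ys v = 0"
    unfolding nn_integral_mixing_weight[symmetric] by (subst (asm) nn_integral_0_iff_AE) measurable
  then have "AE v in lborel. mixing_weight M N h \<rho> \<theta> n p Ys v * cond p v Ys = 0"
    by eventually_elim simp
  then have "tilted_density p Ys = 0"
    unfolding tilted_density_def cond_mult_weight[OF p, symmetric]
    by (subst nn_integral_0_iff_AE) measurable
  then show ?thesis using True by simp
next
  case False
  have "unit_density p Ys / D * posterior_transform p Ys
      = tilted_density p Ys * (unit_density p Ys / unit_density p Ys) / D"
    unfolding posterior_transform_eq[OF p] divide_ennreal_def by (simp only: ac_simps)
  then show ?thesis using ennreal_divide_self[OF False fin] by simp
qed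

section \<open>Total masses and the two unconditional formulas\<close>

lemma mass_Q: "emeasure Q (space Q) = 1"
proof -
  have "emeasure Q (space Q) = (\<integral>\<^sup>+P. 1 \<partial>Q)" by simp
  also have "\<dots> = (\<integral>\<^sup>+\<omega>. ennreal (enn2real (total_mass h (N \<omega>)) powr (- \<theta>)) / E0 * 1 \<partial>M)"
    by (rule nn_integral_P_tilde) measurable
  also have "\<dots> = E0 / E0"
    unfolding T_moment_def[of M N h "- \<theta>", symmetric]
    by (simp add: nn_integral_divide T_moment_def)
  also have "\<dots> = 1" by (rule ennreal_divide_self[OF E0_pos moment_finite])
  finally show ?thesis .
qed

text \<open>\<open>Q\<close> lives on subprobability measures but is carried by probability
  measures, for which the power measure of the whole space is 1.\<close>

lemma nn_integral_PiM_space: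
  assumes [measurable]: "F \<in> borel_measurable (subprob_algebra borel)"
  shows "(\<integral>\<^sup>+P. F P * emeasure (PiM {1..n} (\<lambda>_. P)) (space (sample_space n)) \<partial>Q) = (\<integral>\<^sup>+P. F P \<partial>Q)"
proof -
  have sp [measurable]: "space (sample_space n) \<in> sets (sample_space n)" by (rule sets.top)
  have "(\<integral>\<^sup>+P. F P * emeasure (PiM {1..n} (\<lambda>_. P)) (space (sample_space n)) \<partial>Q)
      = (\<integral>\<^sup>+\<omega>. ennreal (enn2real (total_mass h (N \<omega>)) powr (- \<theta>)) / E0
        * (F (nrm h (N \<omega>)) * emeasure (PiM {1..n} (\<lambda>_. nrm h (N \<omega>))) (space (sample_space n))) \<partial>M)"
    by (rule nn_integral_P_tilde) measurable
  also have "\<dots> = (\<integral>\<^sup>+\<omega>. ennreal (enn2real (total_mass h (N \<omega>)) powr (- \<theta>)) / E0 * F (nrm h (N \<omega>)) \<partial>M)"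
  proof (rule nn_integral_cong_AE)
    show "AE \<omega> in M. ennreal (enn2real (total_mass h (N \<omega>)) powr (- \<theta>)) / E0
        * (F (nrm h (N \<omega>)) * emeasure (PiM {1..n} (\<lambda>_. nrm h (N \<omega>))) (space (sample_space n)))
        = ennreal (enn2real (total_mass h (N \<omega>)) powr (- \<theta>)) / E0 * F (nrm h (N \<omega>))"
      using AE_prob_nrm
    proof eventually_elim
      case (elim \<omega>)
      have "space (sample_space n) = space (PiM {1..n} (\<lambda>_. nrm h (N \<omega>)))"
        by (intro sets_eq_imp_space_eq sets_PiM_cong) simp_all
      moreover have "prob_space (PiM {1..n} (\<lambda>_. nrm h (N \<omega>)))"
        using elim by (intro prob_space_PiM)
      ultimately show ?case using prob_space.emeasure_space_1 by fastforce
    qed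
  qed
  also have "\<dots> = (\<integral>\<^sup>+P. F P \<partial>Q)"
    by (rule nn_integral_P_tilde[symmetric]) measurable
  finally show ?thesis .
qed

lemma mass_marginal: "emeasure (marginal_law n Q) (space (marginal_law n Q)) = 1"
proof -
  have sp: "space (marginal_law n Q) = space (sample_space n)" using sets_marginal by (rule sets_eq_imp_space_eq)
  have "emeasure (marginal_law n Q) (space (marginal_law n Q)) = (\<integral>\<^sup>+P. emeasure (PiM {1..n} (\<lambda>_. P)) (space (sample_space n)) \<partial>Q)"
    unfolding sp by (rule emeasure_marginal) (rule sets.top)
  then show ?thesis
    using nn_integral_PiM_space[of "\<lambda>_. 1"] mass_Q by simp
qed

text \<open>The densities of all partitions together integrate to \<open>D\<close> times the mass of
  a probability measure, which is finite.\<close>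

lemma AE_unit_density_finite:
  assumes p: "partition_on {1..n} p"
  shows "AE Ys in PiM p (\<lambda>_. \<eta>). unit_density p Ys < \<top>"
proof -
  have fin: "finite {p. partition_on {1..n} p}" by (intro finitely_many_partition_on) simp
  have e: "D * emeasure (marginal_law n Q) (space (sample_space n))
    = (\<Sum>p | partition_on {1..n} p. \<integral>\<^sup>+Ys. unit_density p Ys * indicator (space (sample_space n)) (unties n p Ys) \<partial>PiM p (\<lambda>_. \<eta>))"
    by (rule marginal_identity) (rule sets.top)
  have "(\<integral>\<^sup>+Ys. unit_density p Ys \<partial>PiM p (\<lambda>_. \<eta>))
      = (\<integral>\<^sup>+Ys. unit_density p Ys * indicator (space (sample_space n)) (unties n p Ys) \<partial>PiM p (\<lambda>_. \<eta>))"
    using measurable_space[OF measurable_unties_eta[OF p]] by (intro nn_integral_cong) simp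
  also have "\<dots> \<le> D * emeasure (marginal_law n Q) (space (sample_space n))"
    unfolding e using p fin by (intro member_le_sum) simp_all
  also have "\<dots> < \<top>"
    using mass_marginal sets_eq_imp_space_eq[OF sets_marginal] D_finite by simp
  finally show ?thesis
    using nn_integral_PInf_AE[of "unit_density p" "PiM p (\<lambda>_. \<eta>)"] by (simp add: less_top)
qed

lemma marginal_density_mult:
  assumes p: "partition_on {1..n} p"
  shows "AE Ys in PiM p (\<lambda>_. \<eta>). unit_density p Ys / D * posterior_transform p Ys = mix_density w a p Ys / D"
  using AE_unit_density_finite[OF p] AE_tilted_density[OF p]
  by eventually_elim (simp add: posterior_transform_mult[OF p])

lemma transform_total:
  "(\<integral>\<^sup>+P. G P \<partial>Q) = (\<Sum>p | partition_on {1..n} p. \<integral>\<^sup>+Ys. mix_density w a p Ys / D \<partial>PiM p (\<lambda>_. \<eta>))"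
proof -
  have "(\<integral>\<^sup>+P. G P \<partial>Q) = (\<integral>\<^sup>+P. G P * emeasure (PiM {1..n} (\<lambda>_. P)) (space (sample_space n)) \<partial>Q)"
    by (rule nn_integral_PiM_space[symmetric]) measurable
  also have "\<dots> = D * \<dots> / D" by (rule D_divide[symmetric])
  also have "\<dots> = (\<Sum>p | partition_on {1..n} p. \<integral>\<^sup>+Ys. mix_density w a p Ys * indicator (space (sample_space n)) (unties n p Ys) \<partial>PiM p (\<lambda>_. \<eta>)) / D"
    by (subst transform_identity) (rule sets.top, rule refl)
  also have "\<dots> = (\<Sum>p | partition_on {1..n} p. (\<integral>\<^sup>+Ys. mix_density w a p Ys * indicator (space (sample_space n)) (unties n p Ys) \<partial>PiM p (\<lambda>_. \<eta>)) / D)"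
    unfolding divide_ennreal_def by (rule sum_distrib_right)
  also have "\<dots> = (\<Sum>p | partition_on {1..n} p. \<integral>\<^sup>+Ys. mix_density w a p Ys / D \<partial>PiM p (\<lambda>_. \<eta>))"
  proof (rule sum.cong[OF refl])
    fix p assume "p \<in> {p. partition_on {1..n} p}"
    then have p: "partition_on {1..n} p" by simp
    have "(\<integral>\<^sup>+Ys. mix_density w a p Ys * indicator (space (sample_space n)) (unties n p Ys) \<partial>PiM p (\<lambda>_. \<eta>))
        = (\<integral>\<^sup>+Ys. mix_density w a p Ys \<partial>PiM p (\<lambda>_. \<eta>))"
      using measurable_space[OF measurable_unties_eta[OF p]] by (intro nn_integral_cong) simp
    then show "(\<integral>\<^sup>+Ys. mix_density w a p Ys * indicator (space (sample_space n)) (unties n p Ys) \<partial>PiM p (\<lambda>_. \<eta>)) / D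
        = (\<integral>\<^sup>+Ys. mix_density w a p Ys / D \<partial>PiM p (\<lambda>_. \<eta>))"
      by (simp add: nn_integral_divide)
  qed
  finally show ?thesis .
qed


lemma kappa_total_cancel:
  assumes p: "partition_on {1..n} p" and v: "0 < v"
  shows "(\<Prod>C\<in>p. kappa h (card C) (tilt v h \<rho>) (Ys C) / kappa_total h (card C) (tilt v h \<rho>) \<eta>)
      * (\<Prod>C\<in>p. kappa_total h (card C) (tilt v h \<rho>) \<eta>) = (\<Prod>C\<in>p. kappa h (card C) (tilt v h \<rho>) (Ys C))"
  unfolding prod.distrib[symmetric]
proof (rule prod.cong[OF refl])
  fix C assume "C \<in> p"
  then have "card C \<ge> 1" by (rule card_block[OF p])
  then have "kappa_total h (card C) (tilt v h \<rho>) \<eta> / kappa_total h (card C) (tilt v h \<rho>) \<eta> = 1"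
    by (intro ennreal_divide_self kappa_total_pos_finite v)
  then show "kappa h (card C) (tilt v h \<rho>) (Ys C) / kappa_total h (card C) (tilt v h \<rho>) \<eta>
      * kappa_total h (card C) (tilt v h \<rho>) \<eta> = kappa h (card C) (tilt v h \<rho>) (Ys C)"
    by (simp add: divide_ennreal_def mult.assoc mult.commute[of "inverse _"])
qed

lemma measurable_laplace_part:
  assumes p: "partition_on {1..n} p"
  shows "(\<lambda>v. laplace_part h (\<lambda>y. v * g y) (tilt v h \<rho>) \<eta> p) \<in> borel_measurable borel"
proof -
  have "sigma_finite_measure (PiM p (\<lambda>_. \<eta>))"
    using product_sigma_finite.sigma_finite[OF product_eta] finite_elements[OF _ p] by simp
  then interpret P: sigma_finite_measure "PiM p (\<lambda>_. \<eta>)" .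
  show ?thesis unfolding laplace_part_def by measurable
qed

text \<open>The factors \<open>kappa_total\<close> of \<open>mixing\<close> cancel the denominators
  of \<open>laplace_part\<close>; then \<open>cond_mult_kappa\<close> applies under the integral,
  and Tonelli's theorem brings the integral over \<open>v\<close> inside.\<close>

lemma partition_integral:
  assumes p: "partition_on {1..n} p"
  shows "(\<integral>\<^sup>+v. laplace_part h (\<lambda>y. v * g y) (tilt v h \<rho>) \<eta> p \<partial>mixing M N h \<rho> \<eta> \<theta> n p)
    = (\<integral>\<^sup>+Ys. mix_density w a p Ys / D \<partial>PiM p (\<lambda>_. \<eta>))"
proof -
  have "sigma_finite_measure (PiM p (\<lambda>_. \<eta>))"
    using product_sigma_finite.sigma_finite[OF product_eta] finite_elements[OF _ p] by simp
  then interpret P: pair_sigma_finite "PiM p (\<lambda>_. \<eta>)" lborel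
    by (intro pair_sigma_finite.intro sigma_finite_lborel)
  note [measurable] = measurable_laplace_part[OF p]
  define kt where "kt v = (\<Prod>C\<in>p. kappa_total h (card C) (tilt v h \<rho>) \<eta>)" for v
  define c where "c v = indicator {0<..} v * ennreal (v powr (a - 1))" for v :: real
  define J where "J v Ys = (\<Prod>C\<in>p. jump_moment g v (card C) (Ys C))" for v Ys
  have [measurable]: "kt \<in> borel_measurable borel" unfolding kt_def[abs_def] by measurable
  have [measurable]: "c \<in> borel_measurable borel" unfolding c_def[abs_def] by measurable
  have [measurable]: "case_prod J \<in> borel_measurable (borel \<Otimes>\<^sub>M PiM p (\<lambda>_. \<eta>))" unfolding J_def[abs_def] by measurable
  have part: "laplace_part h (\<lambda>y. v * g y) (tilt v h \<rho>) \<eta> p * kt v * laplace_mass (\<lambda>_. 1) v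
      = (\<integral>\<^sup>+Ys. laplace_mass w v * J v Ys \<partial>PiM p (\<lambda>_. \<eta>))" if v: "0 < v" for v
  proof -
    have "laplace_part h (\<lambda>y. v * g y) (tilt v h \<rho>) \<eta> p * (kt v * laplace_mass (\<lambda>_. 1) v)
        = (\<integral>\<^sup>+Ys. cond p v Ys * (\<Prod>C\<in>p. kappa h (card C) (tilt v h \<rho>) (Ys C) / kappa_total h (card C) (tilt v h \<rho>) \<eta>)
            * (kt v * laplace_mass (\<lambda>_. 1) v) \<partial>PiM p (\<lambda>_. \<eta>))"
      unfolding laplace_part_def by (rule nn_integral_multc[symmetric]) measurable
    also have "\<dots> = (\<integral>\<^sup>+Ys. laplace_mass w v * J v Ys \<partial>PiM p (\<lambda>_. \<eta>))"
    proof (rule nn_integral_cong)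
      fix Ys
      have "x * y * (k * l) = x * (y * k) * l" for x y k l :: ennreal
        by (simp only: ac_simps)
      then have "cond p v Ys * (\<Prod>C\<in>p. kappa h (card C) (tilt v h \<rho>) (Ys C) / kappa_total h (card C) (tilt v h \<rho>) \<eta>)
            * (kt v * laplace_mass (\<lambda>_. 1) v)
          = cond p v Ys * ((\<Prod>C\<in>p. kappa h (card C) (tilt v h \<rho>) (Ys C) / kappa_total h (card C) (tilt v h \<rho>) \<eta>) * kt v)
            * laplace_mass (\<lambda>_. 1) v" by this
      also have "\<dots> = laplace_mass w v * J v Ys"
        unfolding kt_def kappa_total_cancel[OF p v] J_def by (rule cond_mult_kappa[OF p v])
      finally show "cond p v Ys * (\<Prod>C\<in>p. kappa h (card C) (tilt v h \<rho>) (Ys C) / kappa_total h (card C) (tilt v h \<rho>) \<eta>)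
            * (kt v * laplace_mass (\<lambda>_. 1) v) = laplace_mass w v * J v Ys" .
    qed
    finally show ?thesis by (simp only: mult.assoc)
  qed
  have "(\<integral>\<^sup>+v. laplace_part h (\<lambda>y. v * g y) (tilt v h \<rho>) \<eta> p \<partial>mixing M N h \<rho> \<eta> \<theta> n p)
      = (\<integral>\<^sup>+v. indicator {0<..} v * (kt v * ennreal (v powr (a - 1)) * T_laplace M N h v / D)
          * laplace_part h (\<lambda>y. v * g y) (tilt v h \<rho>) \<eta> p \<partial>lborel)"
    unfolding mixing_def kt_def[symmetric] by (rule nn_integral_density) measurable
  also have "\<dots> = (\<integral>\<^sup>+v. (\<integral>\<^sup>+Ys. c v * laplace_mass w v * J v Ys / D \<partial>PiM p (\<lambda>_. \<eta>)) \<partial>lborel)"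
  proof (rule nn_integral_cong)
    fix v :: real
    show "indicator {0<..} v * (kt v * ennreal (v powr (a - 1)) * T_laplace M N h v / D)
          * laplace_part h (\<lambda>y. v * g y) (tilt v h \<rho>) \<eta> p
        = (\<integral>\<^sup>+Ys. c v * laplace_mass w v * J v Ys / D \<partial>PiM p (\<lambda>_. \<eta>))"
    proof (cases "0 < v")
      case True
      then have T: "T_laplace M N h v = laplace_mass (\<lambda>_. 1) v" by (simp add: T_laplace_eq)
      have "i * (k * r * l / d) * x = i * r / d * (x * k * l)" for i k r l d x :: ennreal
        unfolding divide_ennreal_def by (simp only: ac_simps)
      then have "indicator {0<..} v * (kt v * ennreal (v powr (a - 1)) * T_laplace M N h v / D)
            * laplace_part h (\<lambda>y. v * g y) (tilt v h \<rho>) \<eta> p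
          = c v / D * (laplace_part h (\<lambda>y. v * g y) (tilt v h \<rho>) \<eta> p * kt v * laplace_mass (\<lambda>_. 1) v)"
        unfolding T c_def by this
      also have "\<dots> = (\<integral>\<^sup>+Ys. c v / D * (laplace_mass w v * J v Ys) \<partial>PiM p (\<lambda>_. \<eta>))"
        unfolding part[OF True] by (rule nn_integral_cmult[symmetric]) measurable
      also have "\<dots> = (\<integral>\<^sup>+Ys. c v * laplace_mass w v * J v Ys / D \<partial>PiM p (\<lambda>_. \<eta>))"
        unfolding divide_ennreal_def by (simp only: ac_simps)
      finally show ?thesis .
    qed (simp add: c_def)
  qed
  also have "\<dots> = (\<integral>\<^sup>+Ys. (\<integral>\<^sup>+v. c v * laplace_mass w v * J v Ys / D \<partial>lborel) \<partial>PiM p (\<lambda>_. \<eta>))"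
    by (rule P.Fubini') measurable
  also have "\<dots> = (\<integral>\<^sup>+Ys. tilted_density p Ys / D \<partial>PiM p (\<lambda>_. \<eta>))"
  proof (rule nn_integral_cong)
    fix Ys assume [measurable]: "Ys \<in> space (PiM p (\<lambda>_. \<eta>))"
    show "(\<integral>\<^sup>+v. c v * laplace_mass w v * J v Ys / D \<partial>lborel) = tilted_density p Ys / D"
      unfolding tilted_density_def c_def[symmetric] J_def[symmetric] by (rule nn_integral_divide) measurable
  qed
  also have "\<dots> = (\<integral>\<^sup>+Ys. mix_density w a p Ys / D \<partial>PiM p (\<lambda>_. \<eta>))"
  proof (rule nn_integral_cong_AE)
    show "AE Ys in PiM p (\<lambda>_. \<eta>). tilted_density p Ys / D = mix_density w a p Ys / D"
      using AE_tilted_density[OF p] by eventually_elim simp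
  qed
  finally show ?thesis .
qed

lemma mixture_formula:
  "(\<integral>\<^sup>+P. G P \<partial>Q) = (\<Sum>p | partition_on {1..n} p.
      \<integral>\<^sup>+v. laplace_part h (\<lambda>y. v * g y) (tilt v h \<rho>) \<eta> p \<partial>mixing M N h \<rho> \<eta> \<theta> n p)"
  unfolding transform_total by (intro sum.cong refl partition_integral[symmetric]) simp

lemma marginal_formula:
  "(\<integral>\<^sup>+P. G P \<partial>Q) = (\<Sum>p | partition_on {1..n} p. \<integral>\<^sup>+Ys. posterior_transform p Ys \<partial>marginal_part n Q p)"
  unfolding transform_total
proof (rule sum.cong[OF refl])
  fix p assume "p \<in> {p. partition_on {1..n} p}"
  then have p: "partition_on {1..n} p" by simp
  have "(\<integral>\<^sup>+Ys. posterior_transform p Ys \<partial>marginal_part n Q p)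
      = (\<integral>\<^sup>+Ys. unit_density p Ys / D * posterior_transform p Ys \<partial>PiM p (\<lambda>_. \<eta>))"
    by (rule nn_integral_marginal_part[OF p measurable_posterior_transform[OF p]])
  also have "\<dots> = (\<integral>\<^sup>+Ys. mix_density w a p Ys / D \<partial>PiM p (\<lambda>_. \<eta>))"
    by (rule nn_integral_cong_AE[OF marginal_density_mult[OF p]])
  finally show "(\<integral>\<^sup>+Ys. mix_density w a p Ys / D \<partial>PiM p (\<lambda>_. \<eta>))
      = (\<integral>\<^sup>+Ys. posterior_transform p Ys \<partial>marginal_part n Q p)" ..
qed

section \<open>The posterior law given the sample\<close>

definition transform_at :: "(nat \<Rightarrow> 'y) \<Rightarrow> ennreal" where
  "transform_at Y = posterior_transform (ties n Y) (distinct_values n Y)"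

text \<open>The index set of \<open>distinct_values n Y\<close> depends on \<open>Y\<close>, so the
  function is cut into finitely many pieces; on the event with a fixed partition the encoding is a
  selection of coordinates.\<close>

lemma measurable_transform_at [measurable]: "transform_at \<in> borel_measurable (sample_space n)"
proof -
  define parts where "parts = {p. partition_on {1..n} p}"
  define E where "E p = {Y \<in> space (sample_space n :: (nat \<Rightarrow> 'y) measure). ties n Y = p}" for p
  define F where "F p Y = posterior_transform p (\<lambda>C\<in>p. Y (Min C)) * indicator (E p) Y" for p Y
  have fin: "finite parts" unfolding parts_def by (intro finitely_many_partition_on) simp
  have F: "F p \<in> borel_measurable (sample_space n)" if "p \<in> parts" for p
  proof -
    have p: "partition_on {1..n} p" using that by (simp add: parts_def)
    have [measurable]: "E p \<in> sets (sample_space n)" unfolding E_def by (rule sets_ties[OF p])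
    have [measurable]: "(\<lambda>Y. posterior_transform p (\<lambda>C\<in>p. Y (Min C))) \<in> borel_measurable (sample_space n)"
      by (rule measurable_compose[OF measurable_representatives[OF p] measurable_posterior_transform[OF p]])
    show ?thesis unfolding F_def[abs_def] by measurable
  qed
  have "transform_at Y = (\<Sum>p\<in>parts. F p Y)" if Y: "Y \<in> space (sample_space n)" for Y
  proof -
    have "(\<Sum>p\<in>parts. F p Y) = (\<Sum>p\<in>{ties n Y}. F p Y)"
    proof (rule sum.mono_neutral_right[OF fin])
      show "{ties n Y} \<subseteq> parts" using partition_on_ties by (simp add: parts_def)
      show "\<forall>p\<in>parts - {ties n Y}. F p Y = 0"
      proof
        fix p assume "p \<in> parts - {ties n Y}"
        then have "p \<noteq> ties n Y" by blast
        then have "Y \<notin> E p" by (metis (mono_tags, lifting) E_def mem_Collect_eq)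
        then show "F p Y = 0" by (simp add: F_def)
      qed
    qed
    also have "\<dots> = transform_at Y"
      using Y distinct_values_eq[OF refl, of Y] by (simp add: F_def E_def transform_at_def)
    finally show ?thesis ..
  qed
  moreover have "(\<lambda>Y. \<Sum>p\<in>parts. F p Y) \<in> borel_measurable (sample_space n)"
    using F by (rule borel_measurable_sum)
  ultimately show ?thesis by (simp cong: measurable_cong)
qed

text \<open>This makes \<open>transform_at\<close> a version of the conditional expectation of
  \<open>G P\<close> given the sample; both sides reduce to the same sum over partitions.\<close>

lemma transform_at_marginal:
  assumes B [measurable]: "B \<in> sets (sample_space n)"
  shows "(\<integral>\<^sup>+Y. transform_at Y * indicator B Y \<partial>marginal_law n Q)
    = (\<integral>\<^sup>+P. G P * emeasure (PiM {1..n} (\<lambda>_. P)) B \<partial>Q)"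
proof -
  have "(\<integral>\<^sup>+Y. transform_at Y * indicator B Y \<partial>marginal_law n Q)
      = (\<Sum>p | partition_on {1..n} p. \<integral>\<^sup>+Ys. unit_density p Ys / D
          * (transform_at (unties n p Ys) * indicator B (unties n p Ys)) \<partial>PiM p (\<lambda>_. \<eta>))"
    by (rule nn_integral_marginal) measurable
  also have "\<dots> = (\<Sum>p | partition_on {1..n} p.
      (\<integral>\<^sup>+Ys. mix_density w a p Ys * indicator B (unties n p Ys) \<partial>PiM p (\<lambda>_. \<eta>)) / D)"
  proof (rule sum.cong[OF refl])
    fix p assume "p \<in> {p. partition_on {1..n} p}"
    then have p: "partition_on {1..n} p" by simp
    have [measurable]: "unties n p \<in> PiM p (\<lambda>_. \<eta>) \<rightarrow>\<^sub>M sample_space n"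
      using p by (rule measurable_unties_eta)
    have "(\<integral>\<^sup>+Ys. unit_density p Ys / D * (transform_at (unties n p Ys) * indicator B (unties n p Ys)) \<partial>PiM p (\<lambda>_. \<eta>))
        = (\<integral>\<^sup>+Ys. mix_density w a p Ys * indicator B (unties n p Ys) / D \<partial>PiM p (\<lambda>_. \<eta>))"
    proof (rule nn_integral_cong_AE)
      show "AE Ys in PiM p (\<lambda>_. \<eta>). unit_density p Ys / D * (transform_at (unties n p Ys) * indicator B (unties n p Ys))
          = mix_density w a p Ys * indicator B (unties n p Ys) / D"
        using AE_ties[OF p] marginal_density_mult[OF p]
      proof eventually_elim
        case (elim Ys)
        have "unit_density p Ys / D * (transform_at (unties n p Ys) * indicator B (unties n p Ys))
            = unit_density p Ys / D * posterior_transform p Ys * indicator B (unties n p Ys)"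
          using elim(1) by (simp only: transform_at_def mult.assoc)
        also have "\<dots> = mix_density w a p Ys * indicator B (unties n p Ys) / D"
          unfolding elim(2) by (simp only: divide_ennreal_def ac_simps)
        finally show ?case .
      qed
    qed
    also have "\<dots> = (\<integral>\<^sup>+Ys. mix_density w a p Ys * indicator B (unties n p Ys) \<partial>PiM p (\<lambda>_. \<eta>)) / D"
      by (rule nn_integral_divide) measurable
    finally show "(\<integral>\<^sup>+Ys. unit_density p Ys / D * (transform_at (unties n p Ys) * indicator B (unties n p Ys)) \<partial>PiM p (\<lambda>_. \<eta>))
        = \<dots>" .
  qed
  also have "\<dots> = (\<Sum>p | partition_on {1..n} p.
      \<integral>\<^sup>+Ys. mix_density w a p Ys * indicator B (unties n p Ys) \<partial>PiM p (\<lambda>_. \<eta>)) / D"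
    unfolding divide_ennreal_def by (rule sum_distrib_right[symmetric])
  also have "\<dots> = (\<integral>\<^sup>+P. G P * emeasure (PiM {1..n} (\<lambda>_. P)) B \<partial>Q)"
    unfolding transform_identity[OF B, symmetric] by (rule D_divide)
  finally show ?thesis .
qed

text \<open>Both functions have the same integral over every \<open>B\<close>, hence agree almost
  surely. The disintegration by \<open>K\<close> is known only on rectangles
  \<open>A \<times> B\<close>; fixing \<open>B\<close> and letting \<open>A\<close> vary identifies
  two measures on the space of measures, against which \<open>G\<close> is then integrated.\<close>

lemma posterior_formula:
  assumes K: "posterior_law n Q K"
  shows "AE Y in marginal_law n Q. (\<integral>\<^sup>+P. G P \<partial>K Y) = transform_at Y"
proof -
  have K_prob: "K \<in> sample_space n \<rightarrow>\<^sub>M prob_algebra (subprob_algebra borel)"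
    and K_joint: "\<And>A B. A \<in> sets (subprob_algebra borel) \<Longrightarrow> B \<in> sets (sample_space n)
      \<Longrightarrow> emeasure (joint_law n Q) (A \<times> B) = (\<integral>\<^sup>+Y\<in>B. emeasure (K Y) A \<partial>marginal_law n Q)"
    using K by (simp_all add: posterior_law_def)
  have Km [measurable]: "K \<in> sample_space n \<rightarrow>\<^sub>M subprob_algebra (subprob_algebra borel)"
    using K_prob by (rule measurable_prob_algebraD)
  have G_meas [measurable]: "G \<in> borel_measurable (subprob_algebra borel)" by measurable
  define \<phi> where "\<phi> Y = (\<integral>\<^sup>+P. G P \<partial>K Y)" for Y
  have \<phi> [measurable]: "\<phi> \<in> borel_measurable (sample_space n)"
    unfolding \<phi>_def[abs_def]
    by (rule measurable_compose[OF Km nn_integral_measurable_subprob_algebra[OF G_meas]])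
  interpret finite_measure "marginal_law n Q"
    by (rule finite_measureI) (simp add: mass_marginal)
  have disint: "(\<integral>\<^sup>+Y. \<phi> Y * indicator B Y \<partial>marginal_law n Q)
      = (\<integral>\<^sup>+P. G P * emeasure (PiM {1..n} (\<lambda>_. P)) B \<partial>Q)"
    if B [measurable]: "B \<in> sets (sample_space n)" for B
  proof -
    \<comment> \<open>The mass that \<open>X\<close> gives to \<open>A\<close> is the joint
      probability of \<open>A \<times> B\<close>, computed through \<open>K\<close>.\<close>
    define X where "X = density (marginal_law n Q) (indicator B) \<bind> K"
    have K': "K \<in> density (marginal_law n Q) (indicator B) \<rightarrow>\<^sub>M subprob_algebra (subprob_algebra borel)"
      using Km by measurable
    have ne: "space (density (marginal_law n Q) (indicator B)) \<noteq> {}"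
      using mass_marginal by auto
    have em_X: "emeasure X A = (\<integral>\<^sup>+P. indicator A P * emeasure (PiM {1..n} (\<lambda>_. P)) B \<partial>Q)"
      if A [measurable]: "A \<in> sets (subprob_algebra borel)" for A
    proof -
      have KA [measurable]: "(\<lambda>Y. emeasure (K Y) A) \<in> borel_measurable (sample_space n)"
        by (rule measurable_compose[OF Km measurable_emeasure_subprob_algebra[OF A]])
      have "emeasure X A = (\<integral>\<^sup>+Y. emeasure (K Y) A \<partial>density (marginal_law n Q) (indicator B))"
        unfolding X_def by (rule emeasure_bind[OF ne K' A])
      also have "\<dots> = (\<integral>\<^sup>+Y. indicator B Y * emeasure (K Y) A \<partial>marginal_law n Q)"
        by (rule nn_integral_density) measurable
      also have "\<dots> = emeasure (joint_law n Q) (A \<times> B)"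
        unfolding K_joint[OF A B] by (simp only: mult.commute)
      finally show ?thesis unfolding emeasure_joint[OF A B] .
    qed
    have eq: "X = density Q (\<lambda>P. emeasure (PiM {1..n} (\<lambda>_. P)) B)"
    proof (rule measure_eqI)
      have sX: "sets X = sets (subprob_algebra borel)"
        unfolding X_def by (rule sets_bind_measurable[OF K' ne])
      then show "sets X = sets (density Q (\<lambda>P. emeasure (PiM {1..n} (\<lambda>_. P)) B))"
        by (simp add: sets_Q)
      fix A assume "A \<in> sets X"
      then have A [measurable]: "A \<in> sets (subprob_algebra borel)" by (simp add: sX)
      have "emeasure (density Q (\<lambda>P. emeasure (PiM {1..n} (\<lambda>_. P)) B)) A
          = (\<integral>\<^sup>+P. emeasure (PiM {1..n} (\<lambda>_. P)) B * indicator A P \<partial>Q)"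
        by (rule emeasure_density) measurable
      then show "emeasure X A = emeasure (density Q (\<lambda>P. emeasure (PiM {1..n} (\<lambda>_. P)) B)) A"
        unfolding em_X[OF A] by (simp only: mult.commute)
    qed
    have "(\<integral>\<^sup>+Y. \<phi> Y * indicator B Y \<partial>marginal_law n Q) = (\<integral>\<^sup>+Y. indicator B Y * \<phi> Y \<partial>marginal_law n Q)"
      by (simp only: mult.commute)
    also have "\<dots> = (\<integral>\<^sup>+Y. \<phi> Y \<partial>density (marginal_law n Q) (indicator B))"
      by (rule nn_integral_density[symmetric]) measurable
    also have "\<dots> = (\<integral>\<^sup>+P. G P \<partial>X)"
      unfolding X_def \<phi>_def by (rule nn_integral_bind[OF G_meas K', symmetric])
    also have "\<dots> = (\<integral>\<^sup>+P. emeasure (PiM {1..n} (\<lambda>_. P)) B * G P \<partial>Q)"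
      unfolding eq by (rule nn_integral_density) measurable
    finally show ?thesis by (simp only: mult.commute)
  qed
  have "AE Y in marginal_law n Q. \<phi> Y = transform_at Y"
  proof (rule density_unique)
    show "density (marginal_law n Q) \<phi> = density (marginal_law n Q) transform_at"
    proof (rule measure_eqI)
      fix B assume "B \<in> sets (density (marginal_law n Q) \<phi>)"
      then have B [measurable]: "B \<in> sets (sample_space n)" by (simp add: sets_marginal)
      have "emeasure (density (marginal_law n Q) \<phi>) B = (\<integral>\<^sup>+Y. \<phi> Y * indicator B Y \<partial>marginal_law n Q)"
        by (rule emeasure_density) measurable
      also have "\<dots> = (\<integral>\<^sup>+Y. transform_at Y * indicator B Y \<partial>marginal_law n Q)"
        unfolding disint[OF B] transform_at_marginal[OF B] ..
      also have "\<dots> = emeasure (density (marginal_law n Q) transform_at) B"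
        by (rule emeasure_density[symmetric]) measurable
      finally show "emeasure (density (marginal_law n Q) \<phi>) B = \<dots>" .
    qed simp
  qed measurable
  then show ?thesis by (simp only: \<phi>_def)
qed

end

text \<open>\<open>Pf_exists\<close> and \<open>base_pos\<close> give meaning to
  \<open>P (f l)\<close> and to the real power when the \<open>f l\<close> take negative values. The
  posterior statement quantifies over every regular version \<open>K\<close> of the conditional law,
  so it is made for almost every sample.\<close>

theorem proposition6p2:
  fixes M :: "'w measure"
    and N :: "'w \<Rightarrow> ('s::polish_space \<times> 'y::polish_space) measure"
    and \<rho> :: "'y \<Rightarrow> 's measure" and \<eta> :: "'y measure" and h :: "'s \<Rightarrow> real"
    and n q :: nat and \<theta> :: real
    and f :: "nat \<Rightarrow> 'y \<Rightarrow> real" and z :: "nat \<Rightarrow> real" and g :: "'y \<Rightarrow> real"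
  assumes eta: "sets \<eta> = sets borel" "sigma_finite_measure \<eta>" "nonatomic \<eta>"
    and h: "h \<in> borel_measurable borel" "\<And>s. h s > 0"
    and rho: "levy_kernel h \<rho>"
    and N: "poisson_random_measure M N (intensity \<rho> \<eta>)"
    and T: "AE \<omega> in M. 0 < total_mass h (N \<omega>) \<and> total_mass h (N \<omega>) < \<infinity>"
    and n: "n \<ge> 1"
    and theta: "\<theta> + real n > 0"
    and moments: "\<theta> \<noteq> 0 \<Longrightarrow> T_moment M N h (- \<theta>) < \<infinity> \<and> T_moment M N h (- (\<theta> + real n)) < \<infinity>"
    and f: "\<And>l. l \<in> {1..q} \<Longrightarrow> f l \<in> borel_measurable borel"
    and z: "\<And>l. l \<in> {1..q} \<Longrightarrow> z l \<ge> 0"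
    and g: "g = (\<lambda>y. \<Sum>l=1..q. z l * f l y)"
    and Pf_exists: "AE \<omega> in M. \<forall>l\<in>{1..q}. integrable (nrm h (N \<omega>)) (f l)"
    and base_pos: "AE \<omega> in M. 1 + (\<Sum>l=1..q. z l * (LINT y|nrm h (N \<omega>). f l y)) > 0"
  shows
    "(\<integral>\<^sup>+P. ennreal ((1 + (\<Sum>l=1..q. z l * (LINT y|P. f l y))) powr (- (\<theta> + real n)))
        \<partial>P_tilde M N h \<theta>)
     = (\<Sum>p | partition_on {1..n} p.
          \<integral>\<^sup>+v. laplace_part h (\<lambda>y. v * g y) (tilt v h \<rho>) \<eta> p \<partial>mixing M N h \<rho> \<eta> \<theta> n p)
     \<and>
     (\<integral>\<^sup>+P. ennreal ((1 + (\<Sum>l=1..q. z l * (LINT y|P. f l y))) powr (- (\<theta> + real n)))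
        \<partial>P_tilde M N h \<theta>)
     = (\<Sum>p | partition_on {1..n} p.
          \<integral>\<^sup>+Ys. (\<integral>\<^sup>+v. laplace_cond h (\<lambda>y. v * g y) (tilt v h \<rho>) \<eta> p Ys
                    \<partial>mixing_cond M N h \<rho> \<theta> n p Ys)
             \<partial>marginal_part n (P_tilde M N h \<theta>) p)
     \<and>
     (\<forall>K. posterior_law n (P_tilde M N h \<theta>) K \<longrightarrow>
       (AE Y in marginal_law n (P_tilde M N h \<theta>).
          (\<integral>\<^sup>+P. ennreal ((1 + (\<Sum>l=1..q. z l * (LINT y|P. f l y))) powr (- (\<theta> + real n))) \<partial>K Y)
          = (\<integral>\<^sup>+v. laplace_cond h (\<lambda>y. v * g y) (tilt v h \<rho>) \<eta> (ties n Y) (distinct_values n Y)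
                \<partial>mixing_cond M N h \<rho> \<theta> n (ties n Y) (distinct_values n Y))))"
proof -
  define S where "S P = (\<Sum>l=1..q. z l * (LINT y|P. f l y))" for P
  have prob: "prob_space M" using N by (simp add: poisson_random_measure_def)
  interpret crm_setting h \<rho> \<eta> M N
    by (intro crm_setting.intro levy_setting.intro poisson_measure.intro crm_setting_axioms.intro
        poisson_measure_axioms.intro prob eta h rho N T)
  interpret stieltjes_setting h \<rho> \<eta> M N n \<theta> g S
  proof
    show "nonatomic \<eta>" by (rule eta)
    show "0 < \<theta> + real n" by (rule theta)
    show "T_moment M N h (- \<theta>) < \<top>"
    \<comment> \<open>For \<open>\<theta> = 0\<close> the integrand \<open>x powr 0\<close> is 1, or
      0 at \<open>x = 0\<close>, so the moment is at most 1.\<close>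
    proof (cases "\<theta> = 0")
      case True
      have "T_moment M N h (- \<theta>) \<le> (\<integral>\<^sup>+\<omega>. 1 \<partial>M)"
        unfolding T_moment_def using True by (intro nn_integral_mono) (simp add: powr_def)
      also have "\<dots> < \<top>" by (simp add: emeasure_space_1)
      finally show ?thesis .
    next
      case False
      then show ?thesis using moments by simp
    qed
    show "g \<in> borel_measurable borel"
      unfolding g using f by (intro borel_measurable_sum borel_measurable_times) simp_all
    have LINT: "(\<lambda>P. LINT y|P. f l y) \<in> borel_measurable (subprob_algebra borel)" if "l \<in> {1..q}" for l
    proof -
      have fl [measurable]: "f l \<in> borel_measurable borel" using f that .
      have "(\<lambda>P. if (\<integral>\<^sup>+y. ennreal \<bar>f l y\<bar> \<partial>P) < \<infinity>
          then enn2real (\<integral>\<^sup>+y. ennreal (f l y) \<partial>P) - enn2real (\<integral>\<^sup>+y. ennreal (- f l y) \<partial>P) else 0)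
          \<in> borel_measurable (subprob_algebra borel)"
        by measurable
      moreover have "f l \<in> borel_measurable P" if "P \<in> space (subprob_algebra borel)" for P
        using that fl by (simp add: space_subprob_algebra cong: measurable_cong_sets)
      ultimately show ?thesis
        by (simp add: lebesgue_integral_eq_nn_integrals cong: measurable_cong)
    qed
    show "S \<in> borel_measurable (subprob_algebra borel)"
      unfolding S_def[abs_def] by (intro borel_measurable_sum borel_measurable_times borel_measurable_const LINT)
    show "AE \<omega> in M. integrable (nrm h (N \<omega>)) g \<and> S (nrm h (N \<omega>)) = (LINT y|nrm h (N \<omega>). g y)
        \<and> 0 < 1 + S (nrm h (N \<omega>))"
      using Pf_exists base_pos
    proof eventually_elim
      case (elim \<omega>)
      have i: "integrable (nrm h (N \<omega>)) (\<lambda>y. z l * f l y)" if "l \<in> {1..q}" for l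
        using elim(1) that by (intro integrable_mult_right) simp
      then have "integrable (nrm h (N \<omega>)) g"
        unfolding g by (intro Bochner_Integration.integrable_sum)
      moreover have "(LINT y|nrm h (N \<omega>). g y) = S (nrm h (N \<omega>))"
        unfolding g S_def using i by (subst Bochner_Integration.integral_sum) simp_all
      ultimately show ?case using elim(2) by (simp add: S_def)
    qed
  qed
  show ?thesis
    using mixture_formula marginal_formula posterior_formula
    unfolding S_def transform_at_def posterior_transform_def by (intro conjI allI impI)
qed

end
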